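(* (Stochastic sewing lemma.) Let $0\le S<T<\infty$, $m\in[2,\infty)$ and $n\in[m,\infty]$. Let $A:\Delta_{S,T}\to L_m(\Omega)$ be such that $A_{s,t}$ is $\mathcal{F}_t$-measurable for every $(s,t)\in\Delta_{S,T}$. Assume that there exist constants $\Gamma_1,\Gamma_2\ge0$, $\varepsilon_1,\varepsilon_2>0$, $\alpha_1,\beta_1\in[0,1)$ and $\alpha_2,\beta_2\in[0,\frac12)$ such that for every $(s,t)\in\Delta_{S,T}$ and $u:=(s+t)/2$ $$\|\mathsf{E}^s[\delta A_{s,u,t}]\|_{L_n}\le\Gamma_1(u-S)^{-\alpha_1}(T-u)^{-\beta_1}|t-s|^{1+\varepsilon_1},$$ $$\bigl\|\,\|\delta A_{s,u,t}\|_{L_m|\mathcal{F}_S}\bigr\|_{L_n}\le\Gamma_2(u-S)^{-\alpha_2}(T-u)^{-\beta_2}|t-s|^{\frac12+\varepsilon_2}.$$ Further, suppose that there exists a process $\mathcal{A}=\{\mathcal{A}_t:t\in[S,T]\}$ such that for any $t\in[S,T]$ and any sequence of partitions $\Pi_N=\{S=t^N_0,\dots,t^N_{k(N)}=t\}$ of $[S,t]$ with mesh size $|\Pi_N|\to0$ as $N\to\infty$ one has $$\mathcal{A}_t=\lim_{N\to\infty}\sum_{i=0}^{k(N)-1}A_{t^N_i,t^N_{i+1}}\quad\text{in probability}.$$ Then there exists a constant $C=C(\varepsilon_1,\varepsilon_2,m)$ independent of $S,T$ such that for every $(s,t)\in\Delta_{S,T}$ $$\bigl\|\,\|\mathcal{A}_t-\mathcal{A}_s-A_{s,t}\|_{L_m|\mathcal{F}_S}\bigr\|_{L_n}\le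 C\Gamma_2\bigl(\eta_{S,T}^{(2\alpha_2,2\beta_2)}(s,t)\bigr)^{\frac12}|t-s|^{\varepsilon_2}+C\Gamma_1\,\eta_{S,T}^{(\alpha_1,\beta_1)}(s,t)|t-s|^{\varepsilon_1}$$ and $$\|\mathsf{E}^S[\mathcal{A}_t-\mathcal{A}_s-A_{s,t}]\|_{L_n}\le C\Gamma_1\,\eta_{S,T}^{(\alpha_1,\beta_1)}(s,t)|t-s|^{\varepsilon_1}.$$
   Context: $(\Omega,\mathcal{F},(\mathcal{F}_t)_{t\in[0,T]},\mathsf{P})$ is a filtered probability space; $\mathsf{E}^s[\cdot]=\mathsf{E}[\cdot|\mathcal{F}_s]$. $\Delta_{S,T}=\{(s,t)\in[S,T]^2:s\le t\}$. For $S\le s\le u\le t\le T$, $\delta A_{s,u,t}:=A_{s,t}-A_{s,u}-A_{u,t}$. $\|\cdot\|_{L_n}$ is the $L_n(\Omega)$ norm (essential supremum for $n=\infty$). For a sub-$\sigma$-algebra $\mathscr{G}$, $\|\xi\|_{L_m|\mathscr{G}}:=(\mathsf{E}[|\xi|^m|\mathscr{G}])^{1/m}$, a $\mathscr{G}$-measurable random variable. For $\alpha,\beta\in[0,1)$, $\eta_{S,T}^{(\alpha,\beta)}(s,t):=\int_s^t(r-S)^{-\alpha}(T-r)^{-\beta}\,dr$. *)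

theory Defs
  imports "HOL-Probability.Probability"
begin

text \<open>Power of an extended nonnegative number with exponent \<open>p > 0\<close>, so that \<open>\<infinity>\<close> is mapped to \<open>\<infinity>\<close>.\<close>

definition ennpowr :: "ennreal \<Rightarrow> real \<Rightarrow> ennreal" where
  "ennpowr x p = (if x = \<infinity> then \<infinity> else ennreal (enn2real x powr p))"

text \<open>
  Norms are \<open>ennreal\<close>-valued, hence they are meaningful (possibly \<open>\<infinity>\<close>) for every random variable,
  and a bound by a finite quantity includes the assertion that the norm is finite.
  \<open>Ln_norm\<close> takes the absolute value of a random variable as argument, because it is also
  applied to conditional norms, which take values in \<open>[0, \<infinity>]\<close>.
\<close>

definition Ln_norm :: "'a measure \<Rightarrow> ennreal \<Rightarrow> ('a \<Rightarrow> ennreal) \<Rightarrow> ennreal" where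
  "Ln_norm M n X =
     (if n = \<infinity> then esssup M X
      else ennpowr (\<integral>\<^sup>+ \<omega>. ennpowr (X \<omega>) (enn2real n) \<partial>M) (1 / enn2real n))"

definition cond_Lm_norm :: "'a measure \<Rightarrow> 'a measure \<Rightarrow> real \<Rightarrow> ('a \<Rightarrow> real) \<Rightarrow> 'a \<Rightarrow> ennreal" where
  "cond_Lm_norm M G m \<xi> =
     (\<lambda>\<omega>. ennpowr (nn_cond_exp M G (\<lambda>\<omega>'. ennreal (\<bar>\<xi> \<omega>'\<bar> powr m)) \<omega>) (1 / m))"

text \<open>A filtration \<open>(F\<^sub>t)\<close> indexed by \<open>t \<in> [0, T]\<close>; values of \<open>F\<close> outside \<open>[0, T]\<close> are irrelevant.\<close>

definition filtration_upto :: "'a measure \<Rightarrow> real \<Rightarrow> (real \<Rightarrow> 'a measure) \<Rightarrow> bool" where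
  "filtration_upto M T F \<longleftrightarrow>
     (\<forall>t\<in>{0..T}. subalgebra M (F t)) \<and>
     (\<forall>s\<in>{0..T}. \<forall>t\<in>{0..T}. s \<le> t \<longrightarrow> subalgebra (F t) (F s))"

definition simplex2 :: "real \<Rightarrow> real \<Rightarrow> (real \<times> real) set" where
  "simplex2 S T = {(s, t). S \<le> s \<and> s \<le> t \<and> t \<le> T}"

definition increment :: "(real \<Rightarrow> real \<Rightarrow> 'a \<Rightarrow> real) \<Rightarrow> real \<Rightarrow> real \<Rightarrow> real \<Rightarrow> 'a \<Rightarrow> real" where
  "increment A s u t = (\<lambda>\<omega>. A s t \<omega> - A s u \<omega> - A u t \<omega>)"

text \<open>
  Since \<open>0 powr x = 0\<close>, the singular weights are \<open>0\<close> at \<open>S\<close> and \<open>T\<close>: irrelevant for the integral, and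
  at \<open>s = t = u\<close> the convention \<open>\<infinity> * 0 = 0\<close> for \<open>(u - S) powr (-\<alpha>) * \<bar>t - s\<bar> powr q\<close> with \<open>q > 0\<close>.
\<close>

definition eta :: "real \<Rightarrow> real \<Rightarrow> real \<Rightarrow> real \<Rightarrow> real \<Rightarrow> real \<Rightarrow> real" where
  "eta S T \<alpha> \<beta> s t = (LBINT r:{s..t}. (r - S) powr (-\<alpha>) * (T - r) powr (-\<beta>))"

text \<open>
  The partition \<open>{p 0 < p 1 < \<dots> < p k}\<close> of \<open>[a, b]\<close>. The degenerate interval \<open>[a, a]\<close> has exactly
  one partition, with \<open>k = 0\<close>; its mesh is \<open>0\<close>.
\<close>

definition is_partition :: "real \<Rightarrow> real \<Rightarrow> nat \<Rightarrow> (nat \<Rightarrow> real) \<Rightarrow> bool" where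
  "is_partition a b k p \<longleftrightarrow> p 0 = a \<and> p k = b \<and> (\<forall>i<k. p i < p (Suc i))"

definition mesh :: "nat \<Rightarrow> (nat \<Rightarrow> real) \<Rightarrow> real" where
  "mesh k p = Max (insert 0 ((\<lambda>i. p (Suc i) - p i) ` {..<k}))"

definition tendsto_in_prob :: "'a measure \<Rightarrow> (nat \<Rightarrow> 'a \<Rightarrow> real) \<Rightarrow> ('a \<Rightarrow> real) \<Rightarrow> bool" where
  "tendsto_in_prob M X Y \<longleftrightarrow>
     (\<forall>\<epsilon>>0. (\<lambda>N. measure M {\<omega>\<in>space M. \<bar>X N \<omega> - Y \<omega>\<bar> > \<epsilon>}) \<longlonglongrightarrow> 0)"

end

theory Submission
  imports Defs
begin

text \<open>
  Fix \<open>s < t\<close> and let \<open>U\<^sub>k\<close> be the Riemann sum of \<open>A\<close> over the \<open>k\<close>-th dyadic partition of \<open>[s, t]\<close>.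
  Then \<open>U\<^sub>0 = A\<^sub>s\<^sub>,\<^sub>t\<close>, and \<open>U\<^sub>k\<close> tends to \<open>\<A>\<^sub>t - \<A>\<^sub>s\<close> in probability, as one sees by putting a
  partition of \<open>[S, s]\<close> in front. Hence it is enough to bound the differences \<open>U\<^sub>k - U\<^sub>k\<^sub>+\<^sub>1\<close> by terms
  of a geometric series. Such a difference is the sum of the increments \<open>\<delta>A\<close> over the cells of
  the \<open>k\<close>-th partition. Each increment splits into its conditional expectation at the left end of
  its cell and a remainder. The conditional expectations are small enough for the triangle
  inequality. The remainders are martingale differences, so for \<open>m \<ge> 2\<close> their sum has an
  \<open>L\<^sub>m\<close> norm of the order of the root of the sum of squares (\<open>Lm_bound_martingale\<close>). With cells
  of length \<open>h\<close>, the first bound gains the factor \<open>h\<close> to the power \<open>\<epsilon>\<^sub>1\<close> and the second one \<open>h\<close> to the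
  power \<open>\<epsilon>\<^sub>2\<close>, and \<open>h\<close> is halved at each step. The conditional expectation at time \<open>S\<close> removes the
  remainders, which leaves only the \<open>\<Gamma>\<^sub>1\<close> term in the second estimate.

  The singular weight \<open>(r - S) powr (-\<alpha>) * (T - r) powr (-\<beta>)\<close> is log-convex, hence convex. Its value at
  the midpoint of a cell times the length of the cell is therefore at most its integral over
  the cell (\<open>weight_midpoint_le_eta\<close>). No constant enters here, which is why \<open>C\<close> depends on
  neither the weight exponents nor \<open>S\<close> and \<open>T\<close>.

  The mixed norm, the \<open>L\<^sub>n\<close> norm of a conditional \<open>L\<^sub>m\<close> norm given \<open>F\<^sub>S\<close>, is handled by duality. A dual
  weight is a bounded nonnegative \<open>F\<^sub>S\<close>-measurable \<open>Z\<close> such that the \<open>L\<^sub>m\<close> norm with respect to the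
  measure \<open>Z dP\<close> is at most the \<open>L\<^sub>n\<close> norm with respect to \<open>P\<close>. Up to a factor \<open>2\<close>, the mixed norm is
  the supremum over \<open>Z\<close> of the \<open>L\<^sub>m\<close> norms for \<open>Z dP\<close> (\<open>Lm_bound_of_cond_Lm_norm\<close> and
  \<open>cond_Lm_norm_le\<close>). Because \<open>Z\<close> is measurable with respect to every \<open>F\<^sub>r\<close> with \<open>r \<ge> S\<close>, passing to
  \<open>Z dP\<close> preserves the orthogonality of martingale differences and the contractivity of conditional
  expectations. So the whole argument runs in the ordinary \<open>L\<^sub>m\<close> space of one measure, uniformly
  in \<open>Z\<close>, and treats \<open>n < \<infinity>\<close> and \<open>n = \<infinity>\<close> alike.
\<close>

section \<open>Inequalities for real powers\<close>

text \<open>A substitute for the weighted Young inequality: the larger of \<open>x\<close> and \<open>y\<close> dominates the product. The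
  constant lost against Young's inequality only enters the final \<open>C\<close>.\<close>
lemma powr_mult_powr_le_add:
  fixes x y p q :: real
  assumes "0 \<le> x" "0 \<le> y" "0 \<le> p" "0 \<le> q"
  shows "x powr p * y powr q \<le> x powr (p + q) + y powr (p + q)"
proof (cases "x \<le> y")
  case True
  have "x powr p * y powr q \<le> y powr p * y powr q"
    using True assms by (intro mult_right_mono powr_mono2) auto
  also have "\<dots> = y powr (p + q)" by (simp add: powr_add)
  finally show ?thesis by (simp add: add_increasing)
next
  case False
  have "x powr p * y powr q \<le> x powr p * x powr q"
    using False assms by (intro mult_left_mono powr_mono2) auto
  also have "\<dots> = x powr (p + q)" by (simp add: powr_add)
  finally show ?thesis by (simp add: add_increasing2)
qed

text \<open>The summand \<open>1 + m\<close> is for increments that change the sign, the last summand for the second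
  derivative of \<open>x powr m\<close>.\<close>
definition taylor_const :: "real \<Rightarrow> real" where
  "taylor_const m = 1 + m + m * (m - 1) * 2 powr (m - 2)"

lemma taylor_const_ge_1: "m \<ge> 2 \<Longrightarrow> taylor_const m \<ge> 1"
  by (simp add: taylor_const_def add_nonneg_nonneg)

text \<open>Second-order Taylor expansion, by two applications of the mean value theorem.\<close>
lemma powr_taylor_pos:
  fixes a b m :: real
  assumes m: "m \<ge> 2" and a: "a > 0" and ab: "a + b > 0"
  shows "(a + b) powr m \<le> a powr m + m * a powr (m - 1) * b
    + m * (m - 1) * (a + \<bar>b\<bar>) powr (m - 2) * b\<^sup>2"
proof -
  have mvt: "\<exists>z. 0 < z \<and> min x y \<le> z \<and> z \<le> max x y \<and> y powr p - x powr p = (y - x) * (p * z powr (p - 1))"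
    if xy: "0 < x" "0 < y" for x y p :: real
  proof -
    have *: "\<exists>z. 0 < z \<and> u < z \<and> z < v \<and> v powr p - u powr p = (v - u) * (p * z powr (p - 1))"
      if "0 < u" "u < v" for u v
    proof -
      have "\<exists>z. u < z \<and> z < v \<and> v powr p - u powr p = (v - u) * (p * z powr (p - 1))"
        using that by (intro MVT2) (auto intro!: derivative_eq_intros simp: powr_diff)
      with that show ?thesis by (meson less_trans)
    qed
    consider "x = y" | "x < y" | "y < x" by linarith
    then show ?thesis
    proof cases
      case 1 then show ?thesis using xy by (intro exI[of _ x]) auto
    next
      case 2
      then show ?thesis using *[of x y] xy by (auto intro: less_imp_le)
    next
      case 3
      then obtain z where "0 < z" "y < z" "z < x" "x powr p - y powr p = (x - y) * (p * z powr (p - 1))"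
        using *[of y x] xy by auto
      then show ?thesis by (intro exI[of _ z]) (auto simp: algebra_simps)
    qed
  qed
  obtain z where z: "0 < z" "min a (a + b) \<le> z" "z \<le> max a (a + b)"
    and e1: "(a + b) powr m - a powr m = b * (m * z powr (m - 1))"
    using mvt[OF a ab, of m] by auto
  obtain y where y: "0 < y" "min a z \<le> y" "y \<le> max a z"
    and e2: "z powr (m - 1) - a powr (m - 1) = (z - a) * ((m - 1) * y powr (m - 2))"
    using mvt[OF a z(1), of "m - 1"] by auto
  have "b * (z - a) \<le> b\<^sup>2"
    using z by (cases "b \<ge> 0") (auto simp: power2_eq_square mult_left_mono mult_left_mono_neg min_def max_def split: if_splits)
  moreover have "y powr (m - 2) \<le> (a + \<bar>b\<bar>) powr (m - 2)"
    using y z m by (intro powr_mono2) auto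
  moreover have "(0::real) \<le> b\<^sup>2" by simp
  ultimately have "(b * (z - a)) * y powr (m - 2) \<le> b\<^sup>2 * (a + \<bar>b\<bar>) powr (m - 2)"
    by (meson mult_mono powr_ge_zero)
  then have "m * (m - 1) * ((b * (z - a)) * y powr (m - 2)) \<le> m * (m - 1) * (b\<^sup>2 * (a + \<bar>b\<bar>) powr (m - 2))"
    using m by (intro mult_left_mono) auto
  moreover have "(a + b) powr m = a powr m + m * a powr (m - 1) * b
      + m * (m - 1) * ((b * (z - a)) * y powr (m - 2))"
  proof -
    have "z powr (m - 1) = a powr (m - 1) + (z - a) * ((m - 1) * y powr (m - 2))" using e2 by simp
    then have "(a + b) powr m = a powr m + b * (m * (a powr (m - 1) + (z - a) * ((m - 1) * y powr (m - 2))))"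
      using e1 by simp
    then show ?thesis by (simp add: algebra_simps)
  qed
  ultimately show ?thesis by (simp add: algebra_simps)
qed

text \<open>The second-order expansion of \<open>\<bar>x\<bar> powr m\<close> with the remainder split into the two powers that have
  useful moments. For \<open>m \<ge> 2\<close> the function is smooth enough for this even where \<open>a\<close> and \<open>a + b\<close>
  have opposite signs: there \<open>\<bar>a\<bar> \<le> \<bar>b\<bar>\<close>, and \<open>\<bar>b\<bar> powr m\<close> absorbs everything.\<close>
lemma abs_add_powr_le:
  fixes a b m :: real
  assumes m: "m \<ge> 2"
  shows "\<bar>a + b\<bar> powr m \<le> \<bar>a\<bar> powr m + m * (sgn a * \<bar>a\<bar> powr (m - 1) * b)
    + taylor_const m * (\<bar>a\<bar> powr (m - 2) * b\<^sup>2 + \<bar>b\<bar> powr m)"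
proof -
  have pos: "\<bar>a + b\<bar> powr m \<le> a powr m + m * (a powr (m - 1) * b)
    + taylor_const m * (a powr (m - 2) * b\<^sup>2 + \<bar>b\<bar> powr m)" if a: "a > 0" for a b
  proof (cases "a + b > 0")
    case True
    have b2: "b\<^sup>2 = \<bar>b\<bar> powr 2" by (cases "b = 0") (auto simp: powr_numeral)
    have "(a + \<bar>b\<bar>) powr (m - 2) * b\<^sup>2 \<le> 2 powr (m - 2) * (a powr (m - 2) * b\<^sup>2 + \<bar>b\<bar> powr m)"
    proof (cases "\<bar>b\<bar> \<le> a")
      case True
      have "(a + \<bar>b\<bar>) powr (m - 2) \<le> (2 * a) powr (m - 2)"
        using True a m by (intro powr_mono2) auto
      then have "(a + \<bar>b\<bar>) powr (m - 2) * b\<^sup>2 \<le> (2 powr (m - 2) * a powr (m - 2)) * b\<^sup>2"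
        using a by (intro mult_right_mono) (auto simp: powr_mult)
      also have "\<dots> \<le> 2 powr (m - 2) * (a powr (m - 2) * b\<^sup>2 + \<bar>b\<bar> powr m)"
        by (simp add: algebra_simps)
      finally show ?thesis .
    next
      case False
      have "(a + \<bar>b\<bar>) powr (m - 2) \<le> (2 * \<bar>b\<bar>) powr (m - 2)"
        using False a m by (intro powr_mono2) auto
      then have "(a + \<bar>b\<bar>) powr (m - 2) * b\<^sup>2 \<le> (2 powr (m - 2) * \<bar>b\<bar> powr (m - 2)) * b\<^sup>2"
        by (intro mult_right_mono) (auto simp: powr_mult)
      also have "\<dots> = 2 powr (m - 2) * \<bar>b\<bar> powr m"
        unfolding b2 mult.assoc powr_add[symmetric] by simp
      also have "\<dots> \<le> 2 powr (m - 2) * (a powr (m - 2) * b\<^sup>2 + \<bar>b\<bar> powr m)"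
        by (simp add: algebra_simps)
      finally show ?thesis .
    qed
    then have "m * (m - 1) * ((a + \<bar>b\<bar>) powr (m - 2) * b\<^sup>2)
        \<le> m * (m - 1) * (2 powr (m - 2) * (a powr (m - 2) * b\<^sup>2 + \<bar>b\<bar> powr m))"
      using m by (intro mult_left_mono) auto
    also have "\<dots> \<le> taylor_const m * (a powr (m - 2) * b\<^sup>2 + \<bar>b\<bar> powr m)"
      unfolding mult.assoc[symmetric] using m by (intro mult_right_mono) (auto simp: taylor_const_def)
    finally show ?thesis
      using powr_taylor_pos[OF m a True] True by (simp add: mult.assoc)
  next
    case False
    then have ba: "a \<le> \<bar>b\<bar>" "b < 0" using a by auto
    have "\<bar>a + b\<bar> powr m \<le> \<bar>b\<bar> powr m"
      using False a m by (intro powr_mono2) auto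
    moreover have "a powr (m - 1) * \<bar>b\<bar> \<le> \<bar>b\<bar> powr m"
    proof -
      have "a powr (m - 1) * \<bar>b\<bar> \<le> \<bar>b\<bar> powr (m - 1) * \<bar>b\<bar> powr 1"
        using ba a m by (intro mult_mono powr_mono2) auto
      also have "\<dots> = \<bar>b\<bar> powr m" unfolding powr_add[symmetric] by simp
      finally show ?thesis .
    qed
    then have "m * (a powr (m - 1) * \<bar>b\<bar>) \<le> m * \<bar>b\<bar> powr m"
      using m by (intro mult_left_mono) auto
    moreover have "m * (a powr (m - 1) * b) = - (m * (a powr (m - 1) * \<bar>b\<bar>))" using ba by simp
    moreover have "(1 + m) * \<bar>b\<bar> powr m \<le> taylor_const m * \<bar>b\<bar> powr m"
      using m by (intro mult_right_mono) (auto simp: taylor_const_def)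
    moreover have "0 \<le> taylor_const m * (a powr (m - 2) * b\<^sup>2)"
      using taylor_const_ge_1[OF m] by auto
    moreover have "0 \<le> a powr m" by simp
    ultimately show ?thesis unfolding distrib_left distrib_right mult_1 by linarith
  qed
  consider "a > 0" | "a = 0" | "a < 0" by linarith
  then show ?thesis
  proof cases
    case 1 then show ?thesis using pos[of a b] by simp
  next
    case 2
    then show ?thesis using mult_right_mono[OF taylor_const_ge_1[OF m], of "\<bar>b\<bar> powr m"] by simp
  next
    case 3
    have "\<bar>- a + - b\<bar> = \<bar>a + b\<bar>" by (simp add: abs_if)
    then show ?thesis using pos[of "-a" "-b"] 3 by simp
  qed
qed

text \<open>The numerical step of the induction in the martingale inequality: if the squares of the first
  increments add up to \<open>Q\<close> and \<open>c\<close> is the next square, then the bound for \<open>Q\<close> together with the second-order terms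
  stays below the bound for \<open>Q + c\<close>. With \<open>p = m / 2\<close>, \<open>q\<close> and \<open>e\<close> as in the
  proof, the factor \<open>4\<close> makes the error terms at most half of \<open>q powr (p - 1) * e\<close> and a quarter of
  \<open>e powr p\<close>, and \<open>(q + e) powr p - q powr p\<close> dominates both of these.\<close>
lemma martingale_recursion:
  fixes Q c m :: real
  assumes m: "m \<ge> 2" and Q: "Q > 0" and c: "c > 0"
  shows "(4 * taylor_const m * Q) powr (m / 2)
      + taylor_const m * (2 * ((4 * taylor_const m * Q) powr ((m - 2) / 2) * c) + c powr (m / 2))
    \<le> (4 * taylor_const m * (Q + c)) powr (m / 2)"
proof -
  define p where "p = m / 2"
  define q where "q = 4 * taylor_const m * Q"
  define e where "e = 4 * taylor_const m * c"
  have C: "taylor_const m \<ge> 1" by (rule taylor_const_ge_1[OF m])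
  have p: "p \<ge> 1" using m by (simp add: p_def)
  have qe: "q > 0" "e > 0" using C Q c by (auto simp: q_def e_def)
  have ec: "taylor_const m * c = e / 4" by (simp add: e_def)
  have cp: "taylor_const m * c powr p \<le> e powr p / 4"
  proof -
    have "4 * taylor_const m \<le> (4 * taylor_const m) powr p"
      using powr_mono[of 1 p "4 * taylor_const m"] C p by simp
    then have "(4 * taylor_const m) * c powr p \<le> (4 * taylor_const m) powr p * c powr p"
      by (intro mult_right_mono) auto
    then show ?thesis using C c by (simp add: e_def powr_mult)
  qed
  have split: "x powr p = x powr (p - 1) * x" if "x > 0" for x
    using that powr_add[of x "p - 1" 1] by simp
  have "q powr p + taylor_const m * (2 * (q powr (p - 1) * c) + c powr p)
      \<le> q powr p + q powr (p - 1) * e / 2 + e powr p / 4"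
  proof -
    have "taylor_const m * (2 * (q powr (p - 1) * c)) = q powr (p - 1) * 2 * (taylor_const m * c)" by simp
    also have "\<dots> = q powr (p - 1) * e / 2" unfolding ec by simp
    finally have "taylor_const m * (2 * (q powr (p - 1) * c)) = q powr (p - 1) * e / 2" .
    then show ?thesis using cp unfolding distrib_left by linarith
  qed
  also have "\<dots> \<le> (q + e) powr (p - 1) * q + (q + e) powr (p - 1) * e"
  proof -
    have "q powr (p - 1) * q \<le> (q + e) powr (p - 1) * q" "q powr (p - 1) * e \<le> (q + e) powr (p - 1) * e"
         "e powr (p - 1) * e \<le> (q + e) powr (p - 1) * e"
      using qe p by (intro mult_right_mono powr_mono2; simp)+
    moreover have "0 \<le> q powr (p - 1) * e" "0 \<le> e powr p" using qe by auto
    ultimately show ?thesis using split[of q] split[of e] qe by linarith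
  qed
  also have "\<dots> = (q + e) powr p" using split[of "q + e"] qe by (simp add: algebra_simps)
  finally show ?thesis by (simp add: q_def e_def p_def diff_divide_distrib distrib_left)
qed

section \<open>Bounds for \<open>m\<close>-th moments\<close>

text \<open>Convexity on the open half-line extends to \<open>0\<close> and is then carried over to negative
  arguments by the triangle inequality.\<close>
lemma convex_on_abs_powr:
  assumes "m \<ge> (1::real)"
  shows "convex_on UNIV (\<lambda>x::real. \<bar>x\<bar> powr m)"
proof (rule convex_onI)
  fix t x y :: real assume t: "0 < t" "t < 1"
  have pos: "((1 - t) * a + t * b) powr m \<le> (1 - t) * a powr m + t * b powr m"
    if ab: "a \<ge> 0" "b \<ge> 0" for a b
  proof -
    have z: "(r * c) powr m \<le> r * c powr m" if "0 < r" "r < 1" "c \<ge> 0" for r c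
    proof -
      have "r powr m \<le> r powr 1" using that assms by (intro powr_mono') auto
      then show ?thesis using that by (simp add: powr_mult mult_right_mono)
    qed
    consider "a = 0" | "b = 0" | "a > 0" "b > 0" using ab by linarith
    then show ?thesis
    proof cases
      case 3
      then show ?thesis using convex_onD[OF powr_convex[OF assms], of t a b] t by auto
    qed (use z[of t b] z[of "1 - t" a] t ab in auto)
  qed
  have "\<bar>(1 - t) * x + t * y\<bar> \<le> (1 - t) * \<bar>x\<bar> + t * \<bar>y\<bar>"
    using t by (intro order_trans[OF abs_triangle_ineq]) (auto simp: abs_mult)
  then have "\<bar>(1 - t) * x + t * y\<bar> powr m \<le> ((1 - t) * \<bar>x\<bar> + t * \<bar>y\<bar>) powr m"
    using assms by (intro powr_mono2) auto
  also have "\<dots> \<le> (1 - t) * \<bar>x\<bar> powr m + t * \<bar>y\<bar> powr m" by (rule pos) auto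
  finally show "\<bar>(1 - t) *\<^sub>R x + t *\<^sub>R y\<bar> powr m \<le> (1 - t) * \<bar>x\<bar> powr m + t * \<bar>y\<bar> powr m" by simp
qed auto

text \<open>The assertion that the \<open>L\<^sub>m\<close> norm of \<open>X\<close> is at most \<open>a\<close>. As a predicate rather than a norm it avoids
  all questions of integrability and of infinite values.\<close>
definition Lm_bound :: "'a measure \<Rightarrow> real \<Rightarrow> ('a \<Rightarrow> real) \<Rightarrow> real \<Rightarrow> bool" where
  "Lm_bound Q m X a \<longleftrightarrow> (\<integral>\<^sup>+\<omega>. ennreal (\<bar>X \<omega>\<bar> powr m) \<partial>Q) \<le> ennreal (a powr m)"

lemma Lm_bound_mono:
  "Lm_bound Q m X a \<Longrightarrow> 0 \<le> a \<Longrightarrow> a \<le> b \<Longrightarrow> 0 \<le> m \<Longrightarrow> Lm_bound Q m X b"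
  unfolding Lm_bound_def by (erule order_trans) (auto intro!: ennreal_leI powr_mono2)

lemma Lm_bound_cong_AE:
  "AE x in Q. X x = Y x \<Longrightarrow> Lm_bound Q m X a \<longleftrightarrow> Lm_bound Q m Y a"
  unfolding Lm_bound_def by (subst nn_integral_cong_AE[of "\<lambda>x. ennreal (\<bar>X x\<bar> powr m)" "\<lambda>x. ennreal (\<bar>Y x\<bar> powr m)"]) auto

lemma Lm_bound_uminus: "Lm_bound Q m (\<lambda>x. - X x) a \<longleftrightarrow> Lm_bound Q m X a"
  by (simp add: Lm_bound_def)

lemma Lm_bound_zero_imp_AE:
  assumes "X \<in> borel_measurable Q" "Lm_bound Q m X 0"
  shows "AE x in Q. X x = 0"
proof -
  note [measurable] = assms(1)
  have "(\<integral>\<^sup>+\<omega>. ennreal (\<bar>X \<omega>\<bar> powr m) \<partial>Q) = 0" using assms(2) by (simp add: Lm_bound_def)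
  then have "AE \<omega> in Q. ennreal (\<bar>X \<omega>\<bar> powr m) = 0" by (subst (asm) nn_integral_0_iff_AE) auto
  then show ?thesis by eventually_elim (auto simp: ennreal_eq_0_iff)
qed

lemma Lm_bound_zero: "Lm_bound Q m (\<lambda>_. 0) a"
  by (simp add: Lm_bound_def)

lemma Lm_bound_le_of_all_gt:
  assumes "\<And>\<delta>. \<delta> > 0 \<Longrightarrow> Lm_bound Q m X (a + \<delta>)" "a \<ge> 0" "m > 0"
  shows "Lm_bound Q m X a"
proof -
  have "(\<lambda>n. ennreal ((a + inverse (real (Suc n))) powr m)) \<longlonglongrightarrow> ennreal ((a + 0) powr m)"
    by (intro tendsto_ennrealI tendsto_powr2 tendsto_add LIMSEQ_inverse_real_of_nat tendsto_const)
       (use assms in auto)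
  then show ?thesis
    unfolding Lm_bound_def add_0_right
    by (rule LIMSEQ_le_const)
       (intro exI[of _ 0] allI impI assms(1)[unfolded Lm_bound_def] inverse_positive_iff_positive[THEN iffD2] of_nat_0_less_iff[THEN iffD2] zero_less_Suc)
qed

lemma Lm_bound_scaled:
  assumes "X \<in> borel_measurable Q" "Lm_bound Q m X a" "a > 0"
  shows "(\<integral>\<^sup>+\<omega>. ennreal ((\<bar>X \<omega>\<bar> / a) powr m) \<partial>Q) \<le> 1"
proof -
  note [measurable] = assms(1)
  have "(\<integral>\<^sup>+\<omega>. ennreal ((\<bar>X \<omega>\<bar> / a) powr m) \<partial>Q)
      = (\<integral>\<^sup>+\<omega>. ennreal (1 / a powr m) * ennreal (\<bar>X \<omega>\<bar> powr m) \<partial>Q)"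
    using assms(3) by (intro nn_integral_cong) (simp add: powr_divide ennreal_mult[symmetric])
  also have "\<dots> = ennreal (1 / a powr m) * (\<integral>\<^sup>+\<omega>. ennreal (\<bar>X \<omega>\<bar> powr m) \<partial>Q)"
    by (rule nn_integral_cmult) measurable
  also have "\<dots> \<le> ennreal (1 / a powr m) * ennreal (a powr m)"
    using assms(2) by (intro mult_left_mono) (auto simp: Lm_bound_def)
  also have "\<dots> = 1" using assms(3) by (simp add: ennreal_mult[symmetric])
  finally show ?thesis .
qed

text \<open>Minkowski's inequality, as convexity of the \<open>m\<close>-th power: \<open>(X + Y) / (a + b)\<close> is the convex
  combination of \<open>X / a\<close> and \<open>Y / b\<close> with weights \<open>a / (a + b)\<close> and \<open>b / (a + b)\<close>. Vanishing bounds are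
  reached as limits of positive ones.\<close>
lemma Lm_bound_add:
  assumes m: "m \<ge> 1" and X: "X \<in> borel_measurable Q" "Lm_bound Q m X a" "a \<ge> 0"
    and Y: "Y \<in> borel_measurable Q" "Lm_bound Q m Y b" "b \<ge> 0"
  shows "Lm_bound Q m (\<lambda>\<omega>. X \<omega> + Y \<omega>) (a + b)"
proof -
  note [measurable] = X(1) Y(1)
  have pos: "Lm_bound Q m (\<lambda>\<omega>. X \<omega> + Y \<omega>) (a + b)"
    if a: "Lm_bound Q m X a" "a > 0" and b: "Lm_bound Q m Y b" "b > 0" for a b
  proof -
    define t where "t = b / (a + b)"
    have t: "0 \<le> t" "t \<le> 1" "1 - t = a / (a + b)" using a b by (auto simp: t_def field_simps)
    have pw: "\<bar>x + y\<bar> powr m \<le> (a + b) powr m * ((1 - t) * (\<bar>x\<bar> / a) powr m + t * (\<bar>y\<bar> / b) powr m)" for x y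
    proof -
      have "x + y = (a + b) * ((1 - t) * (x / a) + t * (y / b))"
      proof -
        have "(a + b) * ((1 - t) * (x / a)) = x" using a b unfolding t(3) by simp
        moreover have "(a + b) * (t * (y / b)) = y" using a b unfolding t_def by simp
        ultimately show ?thesis by (simp add: distrib_left)
      qed
      then have "\<bar>x + y\<bar> powr m = (a + b) powr m * \<bar>(1 - t) * (x / a) + t * (y / b)\<bar> powr m"
        using a b by (simp add: abs_mult powr_mult)
      also have "\<dots> \<le> (a + b) powr m * ((1 - t) * \<bar>x / a\<bar> powr m + t * \<bar>y / b\<bar> powr m)"
        using convex_onD[OF convex_on_abs_powr[OF m], of t "x / a" "y / b"] t by (intro mult_left_mono) auto
      finally show ?thesis using a b by simp
    qed
    have "(\<integral>\<^sup>+\<omega>. ennreal (\<bar>X \<omega> + Y \<omega>\<bar> powr m) \<partial>Q)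
       \<le> (\<integral>\<^sup>+\<omega>. ennreal ((a + b) powr m) * (ennreal (1 - t) * ennreal ((\<bar>X \<omega>\<bar> / a) powr m)
              + ennreal t * ennreal ((\<bar>Y \<omega>\<bar> / b) powr m)) \<partial>Q)"
    proof (intro nn_integral_mono)
      fix \<omega>
      have t1: "0 \<le> 1 - t" using t by simp
      show "ennreal (\<bar>X \<omega> + Y \<omega>\<bar> powr m) \<le> ennreal ((a + b) powr m) * (ennreal (1 - t) * ennreal ((\<bar>X \<omega>\<bar> / a) powr m)
              + ennreal t * ennreal ((\<bar>Y \<omega>\<bar> / b) powr m))"
        using ennreal_leI[OF pw[of "X \<omega>" "Y \<omega>"]] t(1) t1
        by (simp add: ennreal_mult ennreal_plus del: t(3))
    qed
    also have "\<dots> = ennreal ((a + b) powr m) * (ennreal (1 - t) * (\<integral>\<^sup>+\<omega>. ennreal ((\<bar>X \<omega>\<bar> / a) powr m) \<partial>Q)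
              + ennreal t * (\<integral>\<^sup>+\<omega>. ennreal ((\<bar>Y \<omega>\<bar> / b) powr m) \<partial>Q))"
      by (simp add: nn_integral_cmult nn_integral_add)
    also have "\<dots> \<le> ennreal ((a + b) powr m) * (ennreal (1 - t) * 1 + ennreal t * 1)"
      by (intro mult_left_mono add_mono Lm_bound_scaled X Y a b) auto
    also have "\<dots> = ennreal ((a + b) powr m)"
    proof -
      have "ennreal (1 - t) + ennreal t = 1" using t(1,2) by (simp flip: ennreal_plus)
      then show ?thesis by simp
    qed
    finally show ?thesis by (simp add: Lm_bound_def)
  qed
  show ?thesis
  proof (rule Lm_bound_le_of_all_gt)
    fix \<delta> :: real assume d: "\<delta> > 0"
    have "Lm_bound Q m (\<lambda>\<omega>. X \<omega> + Y \<omega>) ((a + \<delta> / 2) + (b + \<delta> / 2))"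
      using d X Y m by (intro pos) (auto elim: Lm_bound_mono)
    then show "Lm_bound Q m (\<lambda>\<omega>. X \<omega> + Y \<omega>) (a + b + \<delta>)" by (simp add: algebra_simps)
  qed (use X Y m in auto)
qed

lemma Lm_bound_diff:
  assumes "m \<ge> 1" "X \<in> borel_measurable Q" "Lm_bound Q m X a" "a \<ge> 0"
    "Y \<in> borel_measurable Q" "Lm_bound Q m Y b" "b \<ge> 0"
  shows "Lm_bound Q m (\<lambda>\<omega>. X \<omega> - Y \<omega>) (a + b)"
  using Lm_bound_add[of m X Q a "\<lambda>\<omega>. - Y \<omega>" b] assms by (simp add: Lm_bound_uminus)

lemma Lm_bound_sum:
  assumes m: "m \<ge> 1" and "\<And>i. i \<in> I \<Longrightarrow> X i \<in> borel_measurable Q"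
    "\<And>i. i \<in> I \<Longrightarrow> Lm_bound Q m (X i) (a i)" "\<And>i. i \<in> I \<Longrightarrow> a i \<ge> 0"
  shows "Lm_bound Q m (\<lambda>\<omega>. \<Sum>i\<in>I. X i \<omega>) (\<Sum>i\<in>I. a i)"
  using assms(2-)
proof (induction I rule: infinite_finite_induct)
  case (insert i I)
  have "Lm_bound Q m (\<lambda>\<omega>. X i \<omega> + (\<Sum>i\<in>I. X i \<omega>)) (a i + (\<Sum>i\<in>I. a i))"
    using insert by (intro Lm_bound_add m) (auto intro: sum_nonneg)
  then show ?case using insert by simp
qed (auto simp: Lm_bound_zero)

lemma Lm_bound_Fatou:
  assumes m: "m > 0" and [measurable]: "\<And>k. X k \<in> borel_measurable Q"
    and lim: "AE \<omega> in Q. (\<lambda>k. X k \<omega>) \<longlonglongrightarrow> Y \<omega>"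
    and bd: "eventually (\<lambda>k. Lm_bound Q m (X k) a) sequentially"
  shows "Lm_bound Q m Y a"
proof -
  have "(\<integral>\<^sup>+\<omega>. ennreal (\<bar>Y \<omega>\<bar> powr m) \<partial>Q) = (\<integral>\<^sup>+\<omega>. liminf (\<lambda>k. ennreal (\<bar>X k \<omega>\<bar> powr m)) \<partial>Q)"
  proof (rule nn_integral_cong_AE, use lim in eventually_elim)
    case (elim \<omega>)
    have "(\<lambda>k. ennreal (\<bar>X k \<omega>\<bar> powr m)) \<longlonglongrightarrow> ennreal (\<bar>Y \<omega>\<bar> powr m)"
      using m by (intro tendsto_ennrealI tendsto_powr2 tendsto_rabs elim tendsto_const) auto
    then show ?case by (intro lim_imp_Liminf[symmetric]) auto
  qed
  also have "\<dots> \<le> liminf (\<lambda>k. \<integral>\<^sup>+\<omega>. ennreal (\<bar>X k \<omega>\<bar> powr m) \<partial>Q)"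
    by (rule nn_integral_liminf) measurable
  also have "\<dots> \<le> limsup (\<lambda>k. \<integral>\<^sup>+\<omega>. ennreal (\<bar>X k \<omega>\<bar> powr m) \<partial>Q)"
    by (rule Liminf_le_Limsup) simp
  also have "\<dots> \<le> ennreal (a powr m)"
    using bd unfolding Lm_bound_def by (rule Limsup_bounded)
  finally show ?thesis by (simp add: Lm_bound_def)
qed

lemma Lm_bound_integrable:
  assumes "X \<in> borel_measurable Q" "Lm_bound Q m X a"
  shows "integrable Q (\<lambda>\<omega>. \<bar>X \<omega>\<bar> powr m)"
  using assms unfolding Lm_bound_def
  by (intro integrableI_bounded) (auto simp: le_less_trans)

section \<open>A martingale inequality\<close>

text \<open>A bound of Hoelder type for the second-order term of the expansion. The constant \<open>2\<close> comes from
  using \<open>powr_mult_powr_le_add\<close> in place of Young's inequality.\<close>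
lemma Lm_bound_mixed:
  assumes m: "m \<ge> 2" and X: "X \<in> borel_measurable Q" "Lm_bound Q m X a" "a > 0"
    and Y: "Y \<in> borel_measurable Q" "Lm_bound Q m Y b" "b > 0"
  shows "(\<integral>\<^sup>+\<omega>. ennreal (\<bar>X \<omega>\<bar> powr (m - 2) * (Y \<omega>)\<^sup>2) \<partial>Q) \<le> ennreal (2 * (a powr (m - 2) * b\<^sup>2))"
proof -
  note [measurable] = X(1) Y(1)
  have pw: "\<bar>x\<bar> powr (m - 2) * y\<^sup>2 \<le> a powr (m - 2) * b\<^sup>2 * ((\<bar>x\<bar> / a) powr m + (\<bar>y\<bar> / b) powr m)" for x y
  proof -
    have "\<bar>x\<bar> powr (m - 2) * y\<^sup>2 = a powr (m - 2) * b\<^sup>2 * ((\<bar>x\<bar> / a) powr (m - 2) * (\<bar>y\<bar> / b) powr 2)"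
      using X Y by (cases "y = 0") (auto simp: powr_divide powr_numeral power_divide)
    also have "\<dots> \<le> a powr (m - 2) * b\<^sup>2 * ((\<bar>x\<bar> / a) powr (m - 2 + 2) + (\<bar>y\<bar> / b) powr (m - 2 + 2))"
      using m X Y by (intro mult_left_mono powr_mult_powr_le_add) auto
    finally show ?thesis by simp
  qed
  have "(\<integral>\<^sup>+\<omega>. ennreal (\<bar>X \<omega>\<bar> powr (m - 2) * (Y \<omega>)\<^sup>2) \<partial>Q)
      \<le> (\<integral>\<^sup>+\<omega>. ennreal (a powr (m - 2) * b\<^sup>2) * (ennreal ((\<bar>X \<omega>\<bar> / a) powr m) + ennreal ((\<bar>Y \<omega>\<bar> / b) powr m)) \<partial>Q)"
    using pw by (intro nn_integral_mono) (simp add: ennreal_mult[symmetric] ennreal_plus[symmetric] del: ennreal_plus)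
  also have "\<dots> = ennreal (a powr (m - 2) * b\<^sup>2) * ((\<integral>\<^sup>+\<omega>. ennreal ((\<bar>X \<omega>\<bar> / a) powr m) \<partial>Q)
      + (\<integral>\<^sup>+\<omega>. ennreal ((\<bar>Y \<omega>\<bar> / b) powr m) \<partial>Q))"
    by (simp add: nn_integral_cmult nn_integral_add)
  also have "\<dots> \<le> ennreal (a powr (m - 2) * b\<^sup>2) * (1 + 1)"
    by (intro mult_left_mono add_mono Lm_bound_scaled X Y) auto
  also have "\<dots> = ennreal (2 * (a powr (m - 2) * b\<^sup>2))"
    by (simp add: ennreal_mult mult.commute)
  finally show ?thesis .
qed

lemma integrable_of_Lm_bounds:
  assumes m: "m \<ge> 1" and X: "X \<in> borel_measurable Q" "Lm_bound Q m X a"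
    and Y: "Y \<in> borel_measurable Q" "Lm_bound Q m Y b"
  shows "integrable Q (\<lambda>\<omega>. sgn (X \<omega>) * \<bar>X \<omega>\<bar> powr (m - 1) * Y \<omega>)"
proof (rule Bochner_Integration.integrable_bound)
  note [measurable] = X(1) Y(1)
  show "integrable Q (\<lambda>\<omega>. \<bar>X \<omega>\<bar> powr m + \<bar>Y \<omega>\<bar> powr m)"
    using X Y by (intro Bochner_Integration.integrable_add Lm_bound_integrable)
  show "(\<lambda>\<omega>. sgn (X \<omega>) * \<bar>X \<omega>\<bar> powr (m - 1) * Y \<omega>) \<in> borel_measurable Q" by measurable
  have "norm (sgn x * \<bar>x\<bar> powr (m - 1) * y) \<le> norm (\<bar>x\<bar> powr m + \<bar>y\<bar> powr m)" for x y
  proof -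
    have "\<bar>x\<bar> powr (m - 1) * \<bar>y\<bar> powr 1 \<le> \<bar>x\<bar> powr (m - 1 + 1) + \<bar>y\<bar> powr (m - 1 + 1)"
      using m by (intro powr_mult_powr_le_add) auto
    then show ?thesis by (cases "x = 0") (auto simp: abs_mult abs_sgn_eq)
  qed
  then show "AE \<omega> in Q. norm (sgn (X \<omega>) * \<bar>X \<omega>\<bar> powr (m - 1) * Y \<omega>) \<le> norm (\<bar>X \<omega>\<bar> powr m + \<bar>Y \<omega>\<bar> powr m)"
    by simp
qed

text \<open>Adding an increment \<open>Y\<close> that is orthogonal to \<open>sgn X * \<bar>X\<bar> powr (m - 1)\<close>, the derivative of the
  \<open>m\<close>-th power up to a factor, makes the first-order term of the expansion vanish. Only quadratic terms remain, so
  the squares of the bounds add up.\<close>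
lemma Lm_bound_martingale_step:
  assumes m: "m \<ge> 2" and Q: "Q' > 0" and b: "b > 0"
    and X: "X \<in> borel_measurable Q" "Lm_bound Q m X (sqrt (4 * taylor_const m * Q'))"
    and Y: "Y \<in> borel_measurable Q" "Lm_bound Q m Y b"
    and orth: "(\<integral>\<omega>. sgn (X \<omega>) * \<bar>X \<omega>\<bar> powr (m - 1) * Y \<omega> \<partial>Q) = 0"
  shows "Lm_bound Q m (\<lambda>\<omega>. X \<omega> + Y \<omega>) (sqrt (4 * taylor_const m * (Q' + b\<^sup>2)))"
proof -
  note [measurable] = X(1) Y(1)
  define c where "c = taylor_const m"
  define a where "a = sqrt (4 * c * Q')"
  have c: "c \<ge> 1" using taylor_const_ge_1[OF m] by (simp add: c_def)
  have a: "a > 0" using c Q by (simp add: a_def)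
  have m1: "m \<ge> 1" using m by simp
  have Xa: "Lm_bound Q m X a" using X(2) by (simp add: a_def c_def)
  define f where "f = (\<lambda>\<omega>. \<bar>X \<omega>\<bar> powr m)"
  define g where "g = (\<lambda>\<omega>. sgn (X \<omega>) * \<bar>X \<omega>\<bar> powr (m - 1) * Y \<omega>)"
  define h where "h = (\<lambda>\<omega>. \<bar>X \<omega>\<bar> powr (m - 2) * (Y \<omega>)\<^sup>2)"
  define k where "k = (\<lambda>\<omega>. \<bar>Y \<omega>\<bar> powr m)"
  have hb: "(\<integral>\<^sup>+\<omega>. ennreal (h \<omega>) \<partial>Q) \<le> ennreal (2 * (a powr (m - 2) * b\<^sup>2))"
    unfolding h_def by (rule Lm_bound_mixed[OF m X(1) Xa a Y b])
  have int: "integrable Q f" "integrable Q g" "integrable Q k"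
    unfolding f_def g_def k_def using Lm_bound_integrable X Y integrable_of_Lm_bounds[OF m1 X Y] by blast+
  have inth: "integrable Q h"
    using hb by (intro integrableI_bounded) (auto simp: h_def le_less_trans)
  have bnd: "integral\<^sup>L Q u \<le> r" if "integrable Q u" "\<And>\<omega>. u \<omega> \<ge> 0" "(\<integral>\<^sup>+\<omega>. ennreal (u \<omega>) \<partial>Q) \<le> ennreal r" "r \<ge> 0" for u r
    using that by (subst (asm) nn_integral_eq_integral) auto
  have If: "integral\<^sup>L Q f \<le> a powr m" and Ik: "integral\<^sup>L Q k \<le> b powr m"
   and Ih: "integral\<^sup>L Q h \<le> 2 * (a powr (m - 2) * b\<^sup>2)"
    using Xa Y(2) hb int inth by (auto intro!: bnd simp: Lm_bound_def f_def k_def h_def)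
  let ?R = "\<lambda>\<omega>. f \<omega> + m * g \<omega> + c * (h \<omega> + k \<omega>)"
  have le: "\<bar>X \<omega> + Y \<omega>\<bar> powr m \<le> ?R \<omega>" for \<omega>
    unfolding f_def g_def h_def k_def c_def by (rule abs_add_powr_le[OF m])
  have intR: "integrable Q ?R" using int inth by auto
  have R0: "?R \<omega> \<ge> 0" for \<omega> using le[of \<omega>] powr_ge_zero order_trans by blast
  have "(\<integral>\<^sup>+\<omega>. ennreal (\<bar>X \<omega> + Y \<omega>\<bar> powr m) \<partial>Q) \<le> (\<integral>\<^sup>+\<omega>. ennreal (?R \<omega>) \<partial>Q)"
    using le by (intro nn_integral_mono ennreal_leI)
  also have "\<dots> = ennreal (integral\<^sup>L Q ?R)"
    using intR R0 by (intro nn_integral_eq_integral) auto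
  finally have calculation_le: "(\<integral>\<^sup>+\<omega>. ennreal (\<bar>X \<omega> + Y \<omega>\<bar> powr m) \<partial>Q) \<le> ennreal (integral\<^sup>L Q ?R)" .
  have "integral\<^sup>L Q ?R = integral\<^sup>L Q f + c * (integral\<^sup>L Q h + integral\<^sup>L Q k)"
    using int inth orth by (simp add: g_def)
  also have "\<dots> \<le> a powr m + c * (2 * (a powr (m - 2) * b\<^sup>2) + b powr m)"
    using If Ih Ik c by (intro add_mono mult_left_mono) auto
  also have "\<dots> = (4 * c * Q') powr (m / 2) + c * (2 * ((4 * c * Q') powr ((m - 2) / 2) * b\<^sup>2) + (b\<^sup>2) powr (m / 2))"
  proof -
    have root: "sqrt x powr p = x powr (p / 2)" if "x \<ge> 0" for x p :: real
      using that by (simp add: powr_half_sqrt[symmetric] powr_powr)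
    have "b powr m = (b\<^sup>2) powr (m / 2)" using root[of "b\<^sup>2" m] b by simp
    then show ?thesis using c Q unfolding a_def by (simp add: root)
  qed
  also have "\<dots> \<le> (4 * c * (Q' + b\<^sup>2)) powr (m / 2)"
    unfolding c_def using b by (intro martingale_recursion m Q) auto
  also have "\<dots> = sqrt (4 * c * (Q' + b\<^sup>2)) powr m"
    using c Q b by (simp add: powr_half_sqrt[symmetric] powr_powr)
  finally have "ennreal (integral\<^sup>L Q ?R) \<le> ennreal (sqrt (4 * c * (Q' + b\<^sup>2)) powr m)"
    by (rule ennreal_leI)
  then show ?thesis unfolding Lm_bound_def c_def[symmetric] using calculation_le by (rule order_trans[rotated])
qed

text \<open>The inequality of Burkholder, Davis and Gundy in the weak form with \<open>L\<^sub>m\<close> norms inside the square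
  sum. The martingale property enters as orthogonality of each increment to a signed power of the
  preceding partial sum, because this is the form that passes to weighted measures.\<close>
lemma Lm_bound_martingale:
  fixes N :: nat
  assumes m: "m \<ge> 2"
    and meas: "\<And>i. i < N \<Longrightarrow> d i \<in> borel_measurable Q"
    and bd: "\<And>i. i < N \<Longrightarrow> Lm_bound Q m (d i) (b i)" "\<And>i. i < N \<Longrightarrow> b i \<ge> 0"
    and orth: "\<And>j. j < N \<Longrightarrow>
      (\<integral>\<omega>. sgn (\<Sum>i<j. d i \<omega>) * \<bar>\<Sum>i<j. d i \<omega>\<bar> powr (m - 1) * d j \<omega> \<partial>Q) = 0"
  shows "Lm_bound Q m (\<lambda>\<omega>. \<Sum>i<N. d i \<omega>) (sqrt (4 * taylor_const m * (\<Sum>i<N. (b i)\<^sup>2)))"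
  using meas bd orth
proof (induction N)
  case 0
  then show ?case by (simp add: Lm_bound_zero)
next
  case (Suc N)
  define c where "c = 4 * taylor_const m"
  have c: "c \<ge> 1" using taylor_const_ge_1[OF m] by (simp add: c_def)
  define q where "q = (\<Sum>i<N. (b i)\<^sup>2)"
  define X where "X = (\<lambda>\<omega>. \<Sum>i<N. d i \<omega>)"
  have X[measurable]: "X \<in> borel_measurable Q" and d[measurable]: "d N \<in> borel_measurable Q"
    using Suc.prems by (auto simp: X_def)
  have IH: "Lm_bound Q m X (sqrt (c * q))"
    using Suc by (simp add: X_def q_def c_def)
  have dN: "Lm_bound Q m (d N) (b N)" "b N \<ge> 0" using Suc.prems by auto
  have q: "q \<ge> 0" by (auto simp: q_def intro: sum_nonneg)
  have goal: "Lm_bound Q m (\<lambda>\<omega>. X \<omega> + d N \<omega>) (sqrt (c * (q + (b N)\<^sup>2)))"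
  proof -
    consider "q = 0" | "b N = 0" | "q > 0" "b N > 0" using q dN by linarith
    then show ?thesis
    proof cases
      case 1
      then have "AE \<omega> in Q. X \<omega> = 0" using Lm_bound_zero_imp_AE[OF X, of m] IH by simp
      then have "AE \<omega> in Q. X \<omega> + d N \<omega> = d N \<omega>" by auto
      moreover have "Lm_bound Q m (d N) (sqrt (c * (q + (b N)\<^sup>2)))"
      proof (rule Lm_bound_mono[OF dN])
        have "1 * (b N)\<^sup>2 \<le> c * (q + (b N)\<^sup>2)" using c q by (intro mult_mono) auto
        then show "b N \<le> sqrt (c * (q + (b N)\<^sup>2))" by (intro real_le_rsqrt) simp
      qed (use m in auto)
      ultimately show ?thesis by (subst Lm_bound_cong_AE) auto
    next
      case 2
      then have "AE \<omega> in Q. d N \<omega> = 0" using Lm_bound_zero_imp_AE[OF d, of m] dN by simp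
      then have "AE \<omega> in Q. X \<omega> + d N \<omega> = X \<omega>" by auto
      then show ?thesis using IH 2 by (subst Lm_bound_cong_AE) auto
    next
      case 3
      then show ?thesis
        using Lm_bound_martingale_step[OF m 3 X IH[unfolded c_def] d dN(1)] Suc.prems(4)[of N]
        by (simp add: X_def c_def)
    qed
  qed
  then show ?case by (simp add: X_def q_def c_def)
qed

section \<open>Duality for the norm\<close>

lemma ennpowr_ennreal [simp]: "a \<ge> 0 \<Longrightarrow> ennpowr (ennreal a) p = ennreal (a powr p)"
  by (simp add: ennpowr_def)

lemma ennpowr_top [simp]: "ennpowr top p = top"
  by (simp add: ennpowr_def)

lemma ennpowr_0 [simp]: "ennpowr 0 p = 0"
  by (simp add: ennpowr_def)

lemma ennpowr_measurable [measurable]: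
  "(\<lambda>x. ennpowr x p) \<in> borel_measurable borel"
  unfolding ennpowr_def by measurable

lemma ennpowr_mono:
  assumes "x \<le> y" "p \<ge> 0"
  shows "ennpowr x p \<le> ennpowr y p"
proof (cases y)
  case (real b)
  then obtain a where "x = ennreal a" "a \<ge> 0" using assms by (cases x) (auto simp: top_unique)
  then show ?thesis using real assms by (auto intro!: ennreal_leI powr_mono2)
qed simp

lemma ennpowr_ennpowr:
  assumes "p > 0" "q > 0"
  shows "ennpowr (ennpowr x p) q = ennpowr x (p * q)"
  by (cases x) (auto simp: powr_powr)

lemma ennpowr_one [simp]: "ennpowr x 1 = x"
  by (cases x) auto

lemma Ln_norm_ennreal:
  assumes "\<nu> \<ge> 0"
  shows "Ln_norm M (ennreal \<nu>) X = ennpowr (\<integral>\<^sup>+ \<omega>. ennpowr (X \<omega>) \<nu> \<partial>M) (1 / \<nu>)"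
  using assms by (simp add: Ln_norm_def)

text \<open>The nonnegative bounded \<open>G\<close>-measurable densities that turn \<open>L\<^sub>n\<close> bounds into \<open>L\<^sub>m\<close> bounds. For
  \<open>m \<le> n < \<infinity>\<close> they are the densities in the unit ball of the \<open>L\<close>-space whose exponent is conjugate to
  \<open>n / m\<close>; this formulation never mentions that exponent and includes \<open>n = \<infinity>\<close>.\<close>
definition dual_weight :: "'a measure \<Rightarrow> 'a measure \<Rightarrow> real \<Rightarrow> ennreal \<Rightarrow> ('a \<Rightarrow> real) \<Rightarrow> bool" where
  "dual_weight M G m n Z \<longleftrightarrow>
     Z \<in> borel_measurable G \<and> (\<forall>\<omega>. 0 \<le> Z \<omega>) \<and> (\<exists>B. \<forall>\<omega>. Z \<omega> \<le> B) \<and>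
     (\<forall>Y\<in>borel_measurable M.
        (\<integral>\<^sup>+\<omega>. ennreal (Z \<omega>) * ennpowr (Y \<omega>) m \<partial>M) \<le> ennpowr (Ln_norm M n Y) m)"

lemma weighted_nn_integral_le:
  fixes l \<nu> m :: real
  assumes m: "m > 0" "m \<le> \<nu>" and l: "l > 0"
    and g[measurable]: "g \<in> borel_measurable M" and g0: "\<And>\<omega>. 0 \<le> g \<omega>"
    and gI: "(\<integral>\<^sup>+\<omega>. ennreal (g \<omega> powr \<nu>) \<partial>M) \<le> 1"
    and Y[measurable]: "Y \<in> borel_measurable M"
    and YI: "(\<integral>\<^sup>+\<omega>. ennpowr (Y \<omega>) \<nu> \<partial>M) \<le> ennreal (l powr \<nu>)"
  shows "(\<integral>\<^sup>+\<omega>. ennreal (g \<omega> powr (\<nu> - m) / 2) * ennpowr (Y \<omega>) m \<partial>M) \<le> ennreal (l powr m)"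
proof -
  have pw: "ennreal (x powr (\<nu> - m) / 2) * ennpowr y m
      \<le> ennreal (l powr m / 2) * (ennreal (x powr \<nu>) + ennreal (1 / l powr \<nu>) * ennpowr y \<nu>)"
    if x: "x \<ge> 0" for x y
  proof (cases y)
    case (real b)
    have "x powr (\<nu> - m) * (b / l) powr m \<le> x powr (\<nu> - m + m) + (b / l) powr (\<nu> - m + m)"
      using x l m real by (intro powr_mult_powr_le_add) auto
    then have "(l powr m / 2) * (x powr (\<nu> - m) * (b / l) powr m)
        \<le> (l powr m / 2) * (x powr \<nu> + 1 / l powr \<nu> * b powr \<nu>)"
      using real l by (intro mult_left_mono) (auto simp: powr_divide)
    moreover have "(l powr m / 2) * (x powr (\<nu> - m) * (b / l) powr m) = x powr (\<nu> - m) / 2 * b powr m"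
      using real l by (simp add: powr_divide)
    ultimately have le: "ennreal (x powr (\<nu> - m) / 2 * b powr m)
        \<le> ennreal ((l powr m / 2) * (x powr \<nu> + 1 / l powr \<nu> * b powr \<nu>))"
      by (intro ennreal_leI) linarith
    have dist: "ennreal (p * (q + r * s)) = ennreal p * (ennreal q + ennreal r * ennreal s)"
      if "p \<ge> 0" "q \<ge> 0" "r \<ge> 0" "s \<ge> 0" for p q r s
      using that by (simp add: ennreal_mult)
    have e1: "ennreal (x powr (\<nu> - m) / 2 * b powr m) = ennreal (x powr (\<nu> - m) / 2) * ennreal (b powr m)"
      by (rule ennreal_mult) auto
    have e2: "ennreal ((l powr m / 2) * (x powr \<nu> + 1 / l powr \<nu> * b powr \<nu>))
       = ennreal (l powr m / 2) * (ennreal (x powr \<nu>) + ennreal (1 / l powr \<nu>) * ennreal (b powr \<nu>))"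
      by (rule dist) auto
    show ?thesis using le unfolding e1 e2 using real by simp
  next
    case top
    then show ?thesis using l by (simp add: ennreal_mult_top ennreal_top_mult)
  qed
  have "(\<integral>\<^sup>+\<omega>. ennreal (g \<omega> powr (\<nu> - m) / 2) * ennpowr (Y \<omega>) m \<partial>M)
    \<le> (\<integral>\<^sup>+\<omega>. ennreal (l powr m / 2) * (ennreal (g \<omega> powr \<nu>) + ennreal (1 / l powr \<nu>) * ennpowr (Y \<omega>) \<nu>) \<partial>M)"
    by (intro nn_integral_mono pw g0)
  also have "\<dots> = ennreal (l powr m / 2) * ((\<integral>\<^sup>+\<omega>. ennreal (g \<omega> powr \<nu>) \<partial>M)
      + ennreal (1 / l powr \<nu>) * (\<integral>\<^sup>+\<omega>. ennpowr (Y \<omega>) \<nu> \<partial>M))"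
    by (simp add: nn_integral_cmult nn_integral_add)
  also have "\<dots> \<le> ennreal (l powr m / 2) * (1 + ennreal (1 / l powr \<nu>) * ennreal (l powr \<nu>))"
    by (intro mult_left_mono add_mono gI YI) auto
  also have "ennreal (1 / l powr \<nu>) * ennreal (l powr \<nu>) = 1"
    using l by (simp flip: ennreal_mult)
  also have "ennreal (l powr m / 2) * (1 + 1) = ennreal (l powr m / 2) * ennreal 2" by simp
  also have "\<dots> = ennreal (l powr m)" by (subst ennreal_mult[symmetric]) auto
  finally show ?thesis .
qed

text \<open>The extremal densities of the duality between \<open>L\<close>-spaces, halved to make up for the constant in
  \<open>powr_mult_powr_le_add\<close>.\<close>
lemma dual_weight_finite_exponent:
  fixes g :: "'a \<Rightarrow> real"
  assumes m: "m > 0" "m \<le> \<nu>" and G: "subalgebra M G"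
    and g: "g \<in> borel_measurable G" "\<And>\<omega>. 0 \<le> g \<omega>" "\<And>\<omega>. g \<omega> \<le> B"
    and gI: "(\<integral>\<^sup>+\<omega>. ennreal (g \<omega> powr \<nu>) \<partial>M) \<le> 1"
  shows "dual_weight M G m (ennreal \<nu>) (\<lambda>\<omega>. g \<omega> powr (\<nu> - m) / 2)"
  unfolding dual_weight_def
proof (intro conjI ballI)
  note [measurable] = g(1)
  have gM[measurable]: "g \<in> borel_measurable M" using measurable_from_subalg[OF G g(1)] .
  show "(\<lambda>\<omega>. g \<omega> powr (\<nu> - m) / 2) \<in> borel_measurable G" by measurable
  show "\<exists>C. \<forall>\<omega>. g \<omega> powr (\<nu> - m) / 2 \<le> C"
    using m g by (intro exI[of _ "B powr (\<nu> - m) / 2"]) (auto intro!: powr_mono2)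
  fix Y :: "'a \<Rightarrow> ennreal" assume Y[measurable]: "Y \<in> borel_measurable M"
  define I where "I = (\<integral>\<^sup>+ \<omega>. ennpowr (Y \<omega>) \<nu> \<partial>M)"
  have nu: "\<nu> > 0" using m by simp
  have N: "Ln_norm M (ennreal \<nu>) Y = ennpowr I (1 / \<nu>)" using nu by (simp add: Ln_norm_ennreal I_def)
  consider "I = \<infinity>" | "I = 0" | j where "I = ennreal j" "j > 0"
    by (cases I) (auto simp: less_le)
  then show "(\<integral>\<^sup>+ \<omega>. ennreal (g \<omega> powr (\<nu> - m) / 2) * ennpowr (Y \<omega>) m \<partial>M)
      \<le> ennpowr (Ln_norm M (ennreal \<nu>) Y) m"
  proof cases
    case 2
    then have "AE \<omega> in M. ennpowr (Y \<omega>) \<nu> = 0"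
      unfolding I_def by (subst (asm) nn_integral_0_iff_AE) auto
    then have "AE \<omega> in M. ennreal (g \<omega> powr (\<nu> - m) / 2) * ennpowr (Y \<omega>) m = 0"
    proof eventually_elim
      case (elim \<omega>)
      then show ?case by (cases "Y \<omega>") auto
    qed
    then show ?thesis by (subst nn_integral_cong_AE[of _ "\<lambda>_. 0"]) auto
  next
    case 3
    define l where "l = j powr (1 / \<nu>)"
    have l: "l > 0" "l powr \<nu> = j" using 3 nu by (auto simp: l_def powr_powr)
    have "(\<integral>\<^sup>+ \<omega>. ennreal (g \<omega> powr (\<nu> - m) / 2) * ennpowr (Y \<omega>) m \<partial>M) \<le> ennreal (l powr m)"
      using l 3 by (intro weighted_nn_integral_le[OF m l(1) gM g(2) gI Y]) (auto simp: I_def)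
    also have "ennreal (l powr m) = ennpowr (Ln_norm M (ennreal \<nu>) Y) m"
      using 3 by (simp add: N l_def)
    finally show ?thesis .
  qed (use N in auto)
qed (use g in auto)

lemma dual_weight_top:
  assumes m: "m > 0" and G: "subalgebra M G"
    and Z: "Z \<in> borel_measurable G" "\<And>\<omega>. 0 \<le> Z \<omega>" "\<And>\<omega>. Z \<omega> \<le> B"
    and ZI: "(\<integral>\<^sup>+\<omega>. ennreal (Z \<omega>) \<partial>M) \<le> 1"
  shows "dual_weight M G m \<infinity> Z"
  unfolding dual_weight_def
proof (intro conjI ballI)
  have [measurable]: "Z \<in> borel_measurable M" using measurable_from_subalg[OF G Z(1)] .
  fix Y :: "'a \<Rightarrow> ennreal" assume [measurable]: "Y \<in> borel_measurable M"
  have "(\<integral>\<^sup>+\<omega>. ennreal (Z \<omega>) * ennpowr (Y \<omega>) m \<partial>M) \<le> (\<integral>\<^sup>+\<omega>. ennreal (Z \<omega>) * ennpowr (esssup M Y) m \<partial>M)"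
    using esssup_AE[where M = M and f = Y] m by (intro nn_integral_mono_AE) (auto elim!: eventually_mono intro!: mult_left_mono ennpowr_mono)
  also have "\<dots> = (\<integral>\<^sup>+\<omega>. ennreal (Z \<omega>) \<partial>M) * ennpowr (esssup M Y) m"
    by (rule nn_integral_multc) measurable
  also have "\<dots> \<le> 1 * ennpowr (esssup M Y) m"
    by (intro mult_right_mono ZI) auto
  finally show "(\<integral>\<^sup>+\<omega>. ennreal (Z \<omega>) * ennpowr (Y \<omega>) m \<partial>M) \<le> ennpowr (Ln_norm M \<infinity> Y) m"
    by (simp add: Ln_norm_def)
qed (use Z in auto)

text \<open>A constant dual weight, through which bounds under dual weights give integrability under \<open>M\<close> itself.\<close>
lemma (in prob_space) dual_weight_half:
  assumes m: "m > 0" "ennreal m \<le> n" and G: "subalgebra M G"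
  shows "dual_weight M G m n (\<lambda>_. 1 / 2)"
proof (cases "n = \<infinity>")
  case True
  have "(\<integral>\<^sup>+\<omega>. ennreal (1 / 2) \<partial>M) \<le> (\<integral>\<^sup>+\<omega>. 1 \<partial>M)"
    using ennreal_leI[of "1 / 2" 1] by (intro nn_integral_mono) simp
  then show ?thesis
    unfolding True using m G by (intro dual_weight_top[where B = 1]) (auto simp: emeasure_space_1)
next
  case False
  then obtain \<nu> where n: "n = ennreal \<nu>" "\<nu> \<ge> 0" by (cases n) auto
  then have "m \<le> \<nu>" using m by simp
  then show ?thesis using dual_weight_finite_exponent[OF m(1) _ G, of \<nu> "\<lambda>_. 1" 1] n
    by (simp add: emeasure_space_1)
qed

text \<open>Test with the normalised power \<open>\<nu> - m\<close> of the truncation of \<open>Y\<close> at \<open>N\<close>, for which the weighted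
  integral of \<open>Y\<close> recovers the \<open>L\<^sub>n\<close> norm of the truncation; then let \<open>N\<close> tend to infinity. Truncation
  makes the weight bounded and its normalising constant finite.\<close>
lemma (in prob_space) Ln_norm_le_dual_finite:
  assumes m: "m \<ge> 1" "m \<le> \<nu>" and G: "subalgebra M G" and Y: "Y \<in> borel_measurable G" and c: "c \<ge> 0"
    and dual: "\<And>Z. dual_weight M G m (ennreal \<nu>) Z \<Longrightarrow>
      (\<integral>\<^sup>+\<omega>. ennreal (Z \<omega>) * ennpowr (Y \<omega>) m \<partial>M) \<le> ennreal (c powr m)"
  shows "Ln_norm M (ennreal \<nu>) Y \<le> ennreal (2 * c)"
proof -
  note [measurable] = Y
  have YM[measurable]: "Y \<in> borel_measurable M" using measurable_from_subalg[OF G Y] .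
  have nu: "\<nu> > 0" "m > 0" using m by auto
  define g where "g = (\<lambda>N \<omega>. enn2real (min (Y \<omega>) (of_nat N)))"
  have g0: "0 \<le> g N \<omega>" for N \<omega> by (simp add: g_def)
  have gN: "ennreal (g N \<omega>) = min (Y \<omega>) (of_nat N)" for N \<omega>
    unfolding g_def by (intro ennreal_enn2real le_less_trans[OF min.cobounded2])
      (simp add: ennreal_of_nat_eq_real_of_nat)
  have gle: "g N \<omega> \<le> real N" for N \<omega>
  proof -
    have "ennreal (g N \<omega>) \<le> ennreal (real N)" unfolding gN by (simp add: ennreal_of_nat_eq_real_of_nat)
    then show ?thesis by simp
  qed
  have gY: "ennreal (g N \<omega>) \<le> Y \<omega>" for N \<omega> by (simp add: gN)
  have gmeas[measurable]: "g N \<in> borel_measurable G" for N unfolding g_def by measurable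
  have gM[measurable]: "g N \<in> borel_measurable M" for N unfolding g_def by measurable
  have bound: "(\<integral>\<^sup>+\<omega>. ennreal (g N \<omega> powr \<nu>) \<partial>M) \<le> ennreal ((2 * c) powr \<nu>)" for N
  proof -
    define J where "J = (\<integral>\<^sup>+\<omega>. ennreal (g N \<omega> powr \<nu>) \<partial>M)"
    have "J \<le> (\<integral>\<^sup>+\<omega>. ennreal (real N powr \<nu>) \<partial>M)"
      unfolding J_def using nu g0 gle by (intro nn_integral_mono ennreal_leI powr_mono2) auto
    also have "\<dots> < \<infinity>" by (simp add: emeasure_space_1)
    finally obtain j where j: "J = ennreal j" "j \<ge> 0" by (cases J) auto
    show ?thesis
    proof (cases "j = 0")
      case True
      then show ?thesis using j by (simp add: J_def)
    next
      case False
      then have jp: "j > 0" using j by simp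
      define l where "l = j powr (1 / \<nu>)"
      have l: "l > 0" "l powr \<nu> = j" using jp nu by (auto simp: l_def powr_powr)
      define h where "h = (\<lambda>\<omega>. g N \<omega> / l)"
      have hint: "(\<integral>\<^sup>+\<omega>. ennreal (h \<omega> powr \<nu>) \<partial>M) = 1"
      proof -
        have "(\<integral>\<^sup>+\<omega>. ennreal (h \<omega> powr \<nu>) \<partial>M) = (\<integral>\<^sup>+\<omega>. ennreal (1 / j) * ennreal (g N \<omega> powr \<nu>) \<partial>M)"
          using l g0 jp by (intro nn_integral_cong) (simp add: h_def powr_divide flip: ennreal_mult)
        also have "\<dots> = ennreal (1 / j) * J" unfolding J_def by (rule nn_integral_cmult) measurable
        also have "\<dots> = 1" using jp by (simp add: j flip: ennreal_mult)
        finally show ?thesis .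
      qed
      have dw: "dual_weight M G m (ennreal \<nu>) (\<lambda>\<omega>. h \<omega> powr (\<nu> - m) / 2)"
      proof (rule dual_weight_finite_exponent[OF nu(2) m(2) G])
        show "h \<in> borel_measurable G" unfolding h_def by measurable
        show "h \<omega> \<le> real N / l" for \<omega> using l gle by (simp add: h_def divide_right_mono)
      qed (use hint g0 l in \<open>auto simp: h_def\<close>)
      have "ennreal (l powr m / 2) = ennreal (l powr m / 2) * (\<integral>\<^sup>+\<omega>. ennreal (h \<omega> powr \<nu>) \<partial>M)"
        by (simp add: hint)
      also have "\<dots> = (\<integral>\<^sup>+\<omega>. ennreal (l powr m / 2) * ennreal (h \<omega> powr \<nu>) \<partial>M)"
        unfolding h_def by (rule nn_integral_cmult[symmetric]) measurable
      also have "\<dots> \<le> (\<integral>\<^sup>+\<omega>. ennreal (h \<omega> powr (\<nu> - m) / 2) * ennpowr (Y \<omega>) m \<partial>M)"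
      proof (rule nn_integral_mono)
        fix \<omega>
        have "h \<omega> powr \<nu> = h \<omega> powr (\<nu> - m) * h \<omega> powr m" by (simp flip: powr_add)
        then have "(l powr m / 2) * h \<omega> powr \<nu> = h \<omega> powr (\<nu> - m) / 2 * g N \<omega> powr m"
          using l g0 by (simp add: h_def powr_divide)
        then have "ennreal (l powr m / 2) * ennreal (h \<omega> powr \<nu>) = ennreal (h \<omega> powr (\<nu> - m) / 2) * ennpowr (ennreal (g N \<omega>)) m"
          using g0 by (simp flip: ennreal_mult)
        also have "\<dots> \<le> ennreal (h \<omega> powr (\<nu> - m) / 2) * ennpowr (Y \<omega>) m"
          using nu by (intro mult_left_mono ennpowr_mono gY) auto
        finally show "ennreal (l powr m / 2) * ennreal (h \<omega> powr \<nu>) \<le> ennreal (h \<omega> powr (\<nu> - m) / 2) * ennpowr (Y \<omega>) m" .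
      qed
      also have "\<dots> \<le> ennreal (c powr m)" by (rule dual[OF dw])
      finally have lc: "l powr m \<le> 2 * c powr m" by simp
      also have "\<dots> \<le> 2 powr m * c powr m"
        using powr_mono[of 1 m 2] m by (intro mult_right_mono) auto
      also have "\<dots> = (2 * c) powr m" using c by (simp add: powr_mult)
      finally have "l \<le> 2 * c"
        using powr_less_mono2[of m "2 * c" l] nu c l by (meson leD mult_nonneg_nonneg not_le zero_le_numeral)
      then have "j \<le> (2 * c) powr \<nu>" using l nu by (auto intro: powr_mono2)
      then show ?thesis using j by (simp add: J_def ennreal_leI)
    qed
  qed
  have "(\<integral>\<^sup>+\<omega>. ennpowr (Y \<omega>) \<nu> \<partial>M) = (\<integral>\<^sup>+\<omega>. liminf (\<lambda>N. ennreal (g N \<omega> powr \<nu>)) \<partial>M)"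
  proof (rule nn_integral_cong)
    fix \<omega>
    have "(\<lambda>N. ennreal (g N \<omega> powr \<nu>)) \<longlonglongrightarrow> ennpowr (Y \<omega>) \<nu>"
    proof (cases "Y \<omega>")
      case (real y)
      obtain K :: nat where K: "y \<le> real K" using real_arch_simple by blast
      have "g N \<omega> = y" if "N \<ge> K" for N
      proof -
        have "ennreal (g N \<omega>) = ennreal y"
          using real K that by (auto simp: gN ennreal_of_nat_eq_real_of_nat min_def)
        then show ?thesis using real g0 by simp
      qed
      then have "eventually (\<lambda>N. ennreal (g N \<omega> powr \<nu>) = ennpowr (Y \<omega>) \<nu>) sequentially"
        using real by (intro eventually_sequentiallyI[of K]) auto
      then show ?thesis by (rule tendsto_eventually)
    next
      case top
      have "g N \<omega> = real N" for N by (simp add: g_def top)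
      moreover have "(\<lambda>N. ennreal (real N powr \<nu>)) \<longlonglongrightarrow> top"
        using nu by (intro ennreal_tendsto_top_eq_at_top[THEN iffD2] filterlim_compose[OF real_powr_at_top] filterlim_real_sequentially)
      ultimately show ?thesis using top by simp
    qed
    then show "ennpowr (Y \<omega>) \<nu> = liminf (\<lambda>N. ennreal (g N \<omega> powr \<nu>))"
      by (intro lim_imp_Liminf[symmetric]) auto
  qed
  also have "\<dots> \<le> liminf (\<lambda>N. \<integral>\<^sup>+\<omega>. ennreal (g N \<omega> powr \<nu>) \<partial>M)"
    by (rule nn_integral_liminf) measurable
  also have "\<dots> \<le> ennreal ((2 * c) powr \<nu>)"
    by (intro order_trans[OF Liminf_le_Limsup] Limsup_bounded always_eventually allI bound) simp
  finally have "ennpowr (\<integral>\<^sup>+\<omega>. ennpowr (Y \<omega>) \<nu> \<partial>M) (1 / \<nu>) \<le> ennpowr (ennreal ((2 * c) powr \<nu>)) (1 / \<nu>)"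
    using nu by (intro ennpowr_mono) auto
  then show ?thesis using nu c by (simp add: Ln_norm_ennreal powr_powr)
qed

text \<open>If \<open>Y\<close> exceeded some \<open>d > c\<close> on a set of positive probability, then the normalised indicator of
  this set would be a dual weight that violates the assumption.\<close>
lemma (in prob_space) Ln_norm_le_dual_top:
  assumes m: "m \<ge> 1" and G: "subalgebra M G" and Y: "Y \<in> borel_measurable G" and c: "c \<ge> 0"
    and dual: "\<And>Z. dual_weight M G m \<infinity> Z \<Longrightarrow>
      (\<integral>\<^sup>+\<omega>. ennreal (Z \<omega>) * ennpowr (Y \<omega>) m \<partial>M) \<le> ennreal (c powr m)"
  shows "Ln_norm M \<infinity> Y \<le> ennreal c"
proof -
  note [measurable] = Y
  have YM[measurable]: "Y \<in> borel_measurable M" using measurable_from_subalg[OF G Y] .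
  have spG: "space G = space M" using G by (simp add: subalgebra_def)
  have "esssup M Y \<le> ennreal c"
  proof (rule dense_le, rule ccontr)
    fix y assume y: "y < esssup M Y" "\<not> y \<le> ennreal c"
    then obtain d where d: "y = ennreal d" "d \<ge> 0" by (cases y) (auto simp: top_unique)
    have dc: "c < d" using y d c by (simp add: not_le)
    define B where "B = {\<omega>\<in>space M. ennreal d < Y \<omega>}"
    have BG[measurable]: "B \<in> sets G" unfolding B_def spG[symmetric] by measurable
    have BM[measurable]: "B \<in> sets M" using BG G by (auto simp: subalgebra_def)
    define b where "b = measure M B"
    have "emeasure M B \<noteq> 0"
    proof
      assume "emeasure M B = 0"
      then have "AE \<omega> in M. Y \<omega> \<le> ennreal d"
        by (intro AE_I[of _ _ B]) (auto simp: B_def not_le)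
      then have "esssup M Y \<le> ennreal d" by (intro esssup_I) auto
      then show False using y d by simp
    qed
    then have b: "b > 0" by (simp add: b_def emeasure_eq_measure zero_less_measure_iff)
    define Z where "Z = (\<lambda>\<omega>. indicator B \<omega> / b)"
    have ZI: "(\<integral>\<^sup>+\<omega>. ennreal (Z \<omega>) \<partial>M) = 1"
    proof -
      have "(\<integral>\<^sup>+\<omega>. ennreal (Z \<omega>) \<partial>M) = (\<integral>\<^sup>+\<omega>. ennreal (1 / b) * indicator B \<omega> \<partial>M)"
        by (intro nn_integral_cong) (auto simp: Z_def indicator_def)
      also have "\<dots> = 1" using b by (simp add: nn_integral_cmult_indicator emeasure_eq_measure b_def flip: ennreal_mult)
      finally show ?thesis .
    qed
    have dw: "dual_weight M G m \<infinity> Z"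
      using m b ZI by (intro dual_weight_top[OF _ G, where B = "1 / b"]) (auto simp: Z_def indicator_def)
    have "ennreal (d powr m) = ennreal (d powr m) * (\<integral>\<^sup>+\<omega>. ennreal (Z \<omega>) \<partial>M)" by (simp add: ZI)
    also have "\<dots> = (\<integral>\<^sup>+\<omega>. ennreal (Z \<omega>) * ennreal (d powr m) \<partial>M)"
      by (subst nn_integral_multc) (auto simp: Z_def mult.commute)
    also have "\<dots> \<le> (\<integral>\<^sup>+\<omega>. ennreal (Z \<omega>) * ennpowr (Y \<omega>) m \<partial>M)"
    proof (rule nn_integral_mono)
      fix \<omega>
      have "ennpowr (ennreal d) m \<le> ennpowr (Y \<omega>) m" if "\<omega> \<in> B"
        using that m by (intro ennpowr_mono) (auto simp: B_def)
      then show "ennreal (Z \<omega>) * ennreal (d powr m) \<le> ennreal (Z \<omega>) * ennpowr (Y \<omega>) m"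
        using d by (cases "\<omega> \<in> B") (auto simp: Z_def intro!: mult_left_mono)
    qed
    also have "\<dots> \<le> ennreal (c powr m)" by (rule dual[OF dw])
    finally have "d powr m \<le> c powr m" by simp
    moreover have "c powr m < d powr m" using dc c m by (intro powr_less_mono2) auto
    ultimately show False by simp
  qed
  then show ?thesis by (simp add: Ln_norm_def)
qed

lemma (in prob_space) Ln_norm_le_dual:
  assumes m: "m \<ge> 1" "ennreal m \<le> n" and G: "subalgebra M G" and Y: "Y \<in> borel_measurable G" and c: "c \<ge> 0"
    and dual: "\<And>Z. dual_weight M G m n Z \<Longrightarrow>
      (\<integral>\<^sup>+\<omega>. ennreal (Z \<omega>) * ennpowr (Y \<omega>) m \<partial>M) \<le> ennreal (c powr m)"
  shows "Ln_norm M n Y \<le> ennreal (2 * c)"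
proof (cases n)
  case (real \<nu>)
  then show ?thesis using Ln_norm_le_dual_finite[OF m(1) _ G Y c, of \<nu>] dual m by simp
next
  case top
  have "Ln_norm M \<infinity> Y \<le> ennreal c"
    using top dual by (intro Ln_norm_le_dual_top[OF m(1) G Y c]) auto
  also have "\<dots> \<le> ennreal (2 * c)" using c by (intro ennreal_leI) auto
  finally show ?thesis using top by simp
qed

section \<open>Conditional expectations under a weighted measure\<close>

definition in_Lm :: "'a measure \<Rightarrow> real \<Rightarrow> ('a \<Rightarrow> real) \<Rightarrow> bool" where
  "in_Lm M m X \<longleftrightarrow> X \<in> borel_measurable M \<and> (\<exists>a\<ge>0. Lm_bound M m X a)"

lemma in_Lm_measurable: "in_Lm M m X \<Longrightarrow> X \<in> borel_measurable M"
  by (simp add: in_Lm_def)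

lemma in_Lm_iff_integrable:
  assumes "m > 0"
  shows "in_Lm M m X \<longleftrightarrow> X \<in> borel_measurable M \<and> integrable M (\<lambda>\<omega>. \<bar>X \<omega>\<bar> powr m)"
proof safe
  assume X: "X \<in> borel_measurable M" and i: "integrable M (\<lambda>\<omega>. \<bar>X \<omega>\<bar> powr m)"
  define j where "j = (\<integral>\<omega>. \<bar>X \<omega>\<bar> powr m \<partial>M)"
  have "j \<ge> 0" by (simp add: j_def)
  then have "Lm_bound M m X (j powr (1 / m))"
    using assms nn_integral_eq_integral[OF i] by (simp add: Lm_bound_def powr_powr j_def)
  then show "in_Lm M m X" using X by (auto simp: in_Lm_def intro!: exI[of _ "j powr (1 / m)"])
qed (auto simp: in_Lm_def intro: Lm_bound_integrable)

lemma in_Lm_diff: "m \<ge> 1 \<Longrightarrow> in_Lm M m X \<Longrightarrow> in_Lm M m Y \<Longrightarrow> in_Lm M m (\<lambda>\<omega>. X \<omega> - Y \<omega>)"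
  unfolding in_Lm_def by (auto intro!: Lm_bound_diff add_nonneg_nonneg)

lemma in_Lm_sum:
  assumes "m \<ge> 1" "\<And>i. i \<in> I \<Longrightarrow> in_Lm M m (X i)"
  shows "in_Lm M m (\<lambda>\<omega>. \<Sum>i\<in>I. X i \<omega>)"
proof -
  obtain a where "\<And>i. i \<in> I \<Longrightarrow> a i \<ge> 0 \<and> Lm_bound M m (X i) (a i)"
    using assms(2) unfolding in_Lm_def by metis
  then show ?thesis
    unfolding in_Lm_def using assms
    by (intro conjI exI[of _ "\<Sum>i\<in>I. a i"] Lm_bound_sum borel_measurable_sum)
       (auto intro: sum_nonneg in_Lm_measurable)
qed

lemma (in prob_space) in_Lm_integrable:
  assumes "m \<ge> 1" "in_Lm M m X"
  shows "integrable M X"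
proof (rule Bochner_Integration.integrable_bound[of _ "\<lambda>\<omega>. 1 + \<bar>X \<omega>\<bar> powr m"])
  show "integrable M (\<lambda>\<omega>. 1 + \<bar>X \<omega>\<bar> powr m)"
    using assms by (simp add: in_Lm_iff_integrable)
  have "\<bar>x\<bar> \<le> 1 + \<bar>x\<bar> powr m" for x :: real
  proof (cases "\<bar>x\<bar> \<le> 1")
    case False
    then show ?thesis using powr_mono[of 1 m "\<bar>x\<bar>"] assms by simp
  qed (simp add: add_increasing2)
  then show "AE \<omega> in M. norm (X \<omega>) \<le> norm (1 + \<bar>X \<omega>\<bar> powr m)" by (simp add: abs_of_nonneg add_nonneg_nonneg)
qed (use assms in \<open>simp add: in_Lm_def\<close>)

lemma Lm_bound_density:
  assumes "Z \<in> borel_measurable M" "X \<in> borel_measurable M"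
  shows "Lm_bound (density M (\<lambda>\<omega>. ennreal (Z \<omega>))) m X a
    \<longleftrightarrow> (\<integral>\<^sup>+\<omega>. ennreal (Z \<omega>) * ennreal (\<bar>X \<omega>\<bar> powr m) \<partial>M) \<le> ennreal (a powr m)"
proof -
  note [measurable] = assms
  have "(\<integral>\<^sup>+\<omega>. ennreal (\<bar>X \<omega>\<bar> powr m) \<partial>density M (\<lambda>\<omega>. ennreal (Z \<omega>)))
    = (\<integral>\<^sup>+\<omega>. ennreal (Z \<omega>) * ennreal (\<bar>X \<omega>\<bar> powr m) \<partial>M)"
    by (rule nn_integral_density) measurable
  then show ?thesis by (simp only: Lm_bound_def)
qed

lemma (in prob_space) sigma_finite_subalgebraI: "subalgebra M G \<Longrightarrow> sigma_finite_subalgebra M G"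
  by (intro finite_measure_subalgebra_is_sigma_finite finite_measure_subalgebra.intro
      finite_measure_axioms finite_measure_subalgebra_axioms.intro)

text \<open>Connects Jensen's inequality, stated for \<open>real_cond_exp\<close>, with the integral identity for
  \<open>nn_cond_exp\<close>. The inequality is pointwise because \<open>real_cond_exp\<close> reads an infinite value as \<open>0\<close>.\<close>
lemma ennreal_real_cond_exp_le:
  "ennreal (real_cond_exp M G f \<omega>) \<le> nn_cond_exp M G (\<lambda>\<omega>. ennreal (f \<omega>)) \<omega>"
proof -
  have "ennreal (real_cond_exp M G f \<omega>) \<le> ennreal (enn2real (nn_cond_exp M G (\<lambda>\<omega>. ennreal (f \<omega>)) \<omega>))"
    by (intro ennreal_leI) (simp add: real_cond_exp_def)
  also have "\<dots> \<le> nn_cond_exp M G (\<lambda>\<omega>. ennreal (f \<omega>)) \<omega>"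
    by (simp add: ennreal_enn2real_if)
  finally show ?thesis .
qed

text \<open>Conditional Jensen inequality for the \<open>m\<close>-th power. The density \<open>Z\<close> may be carried along because it is
  measurable with respect to the \<open>\<sigma>\<close>-algebra of conditioning.\<close>
lemma (in prob_space) cond_exp_contraction:
  assumes m: "m \<ge> 1" and H: "subalgebra M H" and Z: "Z \<in> borel_measurable H" "\<And>\<omega>. 0 \<le> Z \<omega>"
    and X: "in_Lm M m X" and bd: "Lm_bound (density M (\<lambda>\<omega>. ennreal (Z \<omega>))) m X a"
  shows "Lm_bound (density M (\<lambda>\<omega>. ennreal (Z \<omega>))) m (real_cond_exp M H X) a"
proof -
  interpret sigma_finite_subalgebra M H by (rule sigma_finite_subalgebraI[OF H])
  note [measurable] = Z(1) in_Lm_measurable[OF X]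
  have ZM[measurable]: "Z \<in> borel_measurable M" using measurable_from_subalg[OF H Z(1)] .
  have i: "integrable M X" "integrable M (\<lambda>\<omega>. \<bar>X \<omega>\<bar> powr m)"
    using in_Lm_integrable[OF m X] X m by (auto simp: in_Lm_iff_integrable)
  have "AE \<omega> in M. \<bar>real_cond_exp M H X \<omega>\<bar> powr m \<le> real_cond_exp M H (\<lambda>\<omega>. \<bar>X \<omega>\<bar> powr m) \<omega>"
    using real_cond_exp_jensens_inequality(2)[OF i(1) _ _ i(2) convex_on_abs_powr[OF m]] by auto
  then have "(\<integral>\<^sup>+\<omega>. ennreal (Z \<omega>) * ennreal (\<bar>real_cond_exp M H X \<omega>\<bar> powr m) \<partial>M)
     \<le> (\<integral>\<^sup>+\<omega>. ennreal (Z \<omega>) * nn_cond_exp M H (\<lambda>\<omega>. ennreal (\<bar>X \<omega>\<bar> powr m)) \<omega> \<partial>M)"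
    by (intro nn_integral_mono_AE, eventually_elim)
       (auto intro!: mult_left_mono order_trans[OF ennreal_leI ennreal_real_cond_exp_le])
  also have "\<dots> = (\<integral>\<^sup>+\<omega>. ennreal (Z \<omega>) * ennreal (\<bar>X \<omega>\<bar> powr m) \<partial>M)"
    by (rule nn_cond_exp_intg) measurable
  also have "\<dots> \<le> ennreal (a powr m)" using bd by (simp add: Lm_bound_density)
  finally show ?thesis by (subst Lm_bound_density) auto
qed

lemma (in prob_space) in_Lm_cond_exp:
  assumes m: "m \<ge> 1" and H: "subalgebra M H" and X: "in_Lm M m X"
  shows "in_Lm M m (real_cond_exp M H X)"
proof -
  have 1: "density M (\<lambda>_. ennreal 1) = M" by (simp add: density_1)
  show ?thesis
    using cond_exp_contraction[OF m H _ _ X, of "\<lambda>_. 1"] X unfolding 1 by (auto simp: in_Lm_def)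
qed

text \<open>Martingale differences stay orthogonal to the past under the measure with density \<open>Z\<close>, since \<open>Z\<close>
  belongs to the past and can be absorbed into the test function. The conditional expectation is
  still the one with respect to \<open>M\<close>.\<close>
lemma (in prob_space) cond_exp_orthogonal:
  assumes m: "m \<ge> 1" and H: "subalgebra M H" and Z: "Z \<in> borel_measurable H" "\<And>\<omega>. 0 \<le> Z \<omega>" "\<And>\<omega>. Z \<omega> \<le> B"
    and S: "S \<in> borel_measurable H" "in_Lm M m S" and X: "in_Lm M m X"
  shows "(\<integral>\<omega>. sgn (S \<omega>) * \<bar>S \<omega>\<bar> powr (m - 1) * (X \<omega> - real_cond_exp M H X \<omega>)
    \<partial>density M (\<lambda>\<omega>. ennreal (Z \<omega>))) = 0"
proof -
  interpret sigma_finite_subalgebra M H by (rule sigma_finite_subalgebraI[OF H])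
  note [measurable] = Z(1) S(1) in_Lm_measurable[OF X]
  have ZM[measurable]: "Z \<in> borel_measurable M" using measurable_from_subalg[OF H Z(1)] .
  have SM[measurable]: "S \<in> borel_measurable M" using measurable_from_subalg[OF H S(1)] .
  define W where "W = (\<lambda>\<omega>. Z \<omega> * (sgn (S \<omega>) * \<bar>S \<omega>\<bar> powr (m - 1)))"
  have WH: "W \<in> borel_measurable H" unfolding W_def by measurable
  have int: "integrable M (\<lambda>\<omega>. W \<omega> * X \<omega>)"
  proof (rule Bochner_Integration.integrable_bound)
    show "integrable M (\<lambda>\<omega>. B * (sgn (S \<omega>) * \<bar>S \<omega>\<bar> powr (m - 1) * X \<omega>))"
      using S X unfolding in_Lm_def by (auto intro!: integrable_mult_right integrable_of_Lm_bounds[OF m])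
    have "0 \<le> B" using Z(2,3) order_trans by blast
    then show "AE \<omega> in M. norm (W \<omega> * X \<omega>) \<le> norm (B * (sgn (S \<omega>) * \<bar>S \<omega>\<bar> powr (m - 1) * X \<omega>))"
      using Z by (auto simp: W_def abs_mult mult.assoc intro!: mult_right_mono AE_I2)
  qed (simp add: W_def)
  have "(\<integral>\<omega>. sgn (S \<omega>) * \<bar>S \<omega>\<bar> powr (m - 1) * (X \<omega> - real_cond_exp M H X \<omega>)
      \<partial>density M (\<lambda>\<omega>. ennreal (Z \<omega>))) = (\<integral>\<omega>. W \<omega> * X \<omega> - W \<omega> * real_cond_exp M H X \<omega> \<partial>M)"
    using Z by (subst integral_density) (auto simp: W_def algebra_simps)
  also have "\<dots> = 0"
    using real_cond_exp_intg[OF int WH] int by simp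
  finally show ?thesis .
qed

lemma real_cond_exp_sum_finite:
  assumes "sigma_finite_subalgebra M G" "\<And>i. i \<in> I \<Longrightarrow> integrable M (X i)"
  shows "AE \<omega> in M. real_cond_exp M G (\<lambda>\<omega>. \<Sum>i\<in>I. X i \<omega>) \<omega> = (\<Sum>i\<in>I. real_cond_exp M G (X i) \<omega>)"
proof -
  interpret sigma_finite_subalgebra M G by fact
  \<comment> \<open>\<open>real_cond_exp_sum\<close> asks for integrability at every index, so the others are replaced by \<open>0\<close>\<close>
  define Y where "Y = (\<lambda>i. if i \<in> I then X i else (\<lambda>_. 0))"
  have "integrable M (Y i)" for i using assms by (simp add: Y_def)
  from real_cond_exp_sum[of Y I, OF this] show ?thesis by (simp add: Y_def)
qed

text \<open>By the tower property, conditioning on \<open>G\<close> sees \<open>X i\<close> only through its conditional expectation given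
  \<open>H i\<close>.\<close>
lemma (in prob_space) sum_cond_exp_bound:
  assumes m: "m \<ge> 1" and G: "subalgebra M G" and Z: "Z \<in> borel_measurable G" "\<And>\<omega>. 0 \<le> Z \<omega>"
    and H: "\<And>i. i < N \<Longrightarrow> subalgebra M (H i)" "\<And>i. i < N \<Longrightarrow> subalgebra (H i) G"
    and X: "\<And>i. i < N \<Longrightarrow> in_Lm M m (X i)"
    and a: "\<And>i. i < N \<Longrightarrow> Lm_bound (density M (\<lambda>\<omega>. ennreal (Z \<omega>))) m (real_cond_exp M (H i) (X i)) (a i)"
       "\<And>i. i < N \<Longrightarrow> 0 \<le> a i"
  shows "Lm_bound (density M (\<lambda>\<omega>. ennreal (Z \<omega>))) m
     (real_cond_exp M G (\<lambda>\<omega>. \<Sum>i<N. X i \<omega>)) (\<Sum>i<(N::nat). a i)"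
proof -
  interpret sigma_finite_subalgebra M G by (rule sigma_finite_subalgebraI[OF G])
  let ?Q = "density M (\<lambda>\<omega>. ennreal (Z \<omega>))"
  have ZM[measurable]: "Z \<in> borel_measurable M" using measurable_from_subalg[OF G Z(1)] .
  have int: "integrable M (X i)" if "i < N" for i using in_Lm_integrable[OF m X[OF that]] .
  have "AE \<omega> in M. \<forall>i\<in>{..<N}. real_cond_exp M G (real_cond_exp M (H i) (X i)) \<omega> = real_cond_exp M G (X i) \<omega>"
    using H int by (intro AE_ball_countable[THEN iffD2] ballI real_cond_exp_nested_subalg) auto
  moreover have "AE \<omega> in M. real_cond_exp M G (\<lambda>\<omega>. \<Sum>i<N. X i \<omega>) \<omega> = (\<Sum>i<N. real_cond_exp M G (X i) \<omega>)"
    by (intro real_cond_exp_sum_finite sigma_finite_subalgebra_axioms) (use int in auto)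
  ultimately have "AE \<omega> in M. real_cond_exp M G (\<lambda>\<omega>. \<Sum>i<N. X i \<omega>) \<omega>
      = (\<Sum>i<N. real_cond_exp M G (real_cond_exp M (H i) (X i)) \<omega>)"
    by eventually_elim auto
  then have eq: "AE \<omega> in ?Q. real_cond_exp M G (\<lambda>\<omega>. \<Sum>i<N. X i \<omega>) \<omega>
      = (\<Sum>i<N. real_cond_exp M G (real_cond_exp M (H i) (X i)) \<omega>)"
    by (subst AE_density) auto
  have "Lm_bound ?Q m (\<lambda>\<omega>. \<Sum>i<N. real_cond_exp M G (real_cond_exp M (H i) (X i)) \<omega>) (\<Sum>i<N. a i)"
    by (intro Lm_bound_sum m cond_exp_contraction[OF m G Z] in_Lm_cond_exp[OF m] H X a) auto
  then show ?thesis using Lm_bound_cong_AE[OF eq] by blast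
qed

text \<open>Splitting \<open>X i\<close> into its conditional expectation given \<open>H i\<close> and a martingale difference, which is
  at most twice as large as \<open>X i\<close>; hence the factor \<open>16 = 4 * 2\<^sup>2\<close>.\<close>
lemma (in prob_space) sum_martingale_bound:
  fixes N :: nat
  assumes m: "m \<ge> 2" and G: "subalgebra M G" and Z: "Z \<in> borel_measurable G" "\<And>\<omega>. 0 \<le> Z \<omega>" "\<And>\<omega>. Z \<omega> \<le> B"
    and H: "\<And>i. i \<le> N \<Longrightarrow> subalgebra M (H i)" "\<And>i. i \<le> N \<Longrightarrow> subalgebra (H i) G"
      "\<And>i j. i \<le> j \<Longrightarrow> j \<le> N \<Longrightarrow> subalgebra (H j) (H i)"
    and X: "\<And>i. i < N \<Longrightarrow> in_Lm M m (X i)" "\<And>i. i < N \<Longrightarrow> X i \<in> borel_measurable (H (Suc i))"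
    and a: "\<And>i. i < N \<Longrightarrow> Lm_bound (density M (\<lambda>\<omega>. ennreal (Z \<omega>))) m (real_cond_exp M (H i) (X i)) (a i)"
       "\<And>i. i < N \<Longrightarrow> 0 \<le> a i"
    and b: "\<And>i. i < N \<Longrightarrow> Lm_bound (density M (\<lambda>\<omega>. ennreal (Z \<omega>))) m (X i) (b i)"
       "\<And>i. i < N \<Longrightarrow> 0 \<le> b i"
  shows "Lm_bound (density M (\<lambda>\<omega>. ennreal (Z \<omega>))) m (\<lambda>\<omega>. \<Sum>i<N. X i \<omega>)
     (sqrt (16 * taylor_const m * (\<Sum>i<N. (b i)\<^sup>2)) + (\<Sum>i<N. a i))"
proof -
  let ?Q = "density M (\<lambda>\<omega>. ennreal (Z \<omega>))"
  have m1: "m \<ge> 1" using m by simp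
  define E where "E = (\<lambda>i. real_cond_exp M (H i) (X i))"
  define d where "d = (\<lambda>i \<omega>. X i \<omega> - E i \<omega>)"
  have Em: "E i \<in> borel_measurable M" for i unfolding E_def by simp
  have Xm: "X i \<in> borel_measurable M" if "i < N" for i using X that by (auto intro: in_Lm_measurable)
  have ZH: "Z \<in> borel_measurable (H i)" if "i \<le> N" for i using measurable_from_subalg[OF H(2)[OF that] Z(1)] .
  have dLm: "in_Lm M m (d i)" if "i < N" for i
    unfolding d_def E_def using that m1 X H by (intro in_Lm_diff in_Lm_cond_exp) auto
  have dH: "d i \<in> borel_measurable (H j)" if "i < j" "j \<le> N" for i j
  proof -
    have "X i \<in> borel_measurable (H j)"
      using measurable_from_subalg[OF H(3)[of "Suc i" j] X(2)[of i]] that by auto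
    moreover have "E i \<in> borel_measurable (H j)"
      unfolding E_def by (rule measurable_from_subalg[OF H(3)[of i j]]) (use that in auto)
    ultimately show ?thesis unfolding d_def by measurable
  qed
  have mart: "Lm_bound ?Q m (\<lambda>\<omega>. \<Sum>i<N. d i \<omega>) (sqrt (4 * taylor_const m * (\<Sum>i<N. (b i + b i)\<^sup>2)))"
  proof (rule Lm_bound_martingale[OF m])
    fix i assume i: "i < N"
    show "d i \<in> borel_measurable ?Q" using dLm[OF i] by (simp add: in_Lm_def)
    show "Lm_bound ?Q m (d i) (b i + b i)"
      unfolding d_def E_def
      using i Xm by (intro Lm_bound_diff[OF m1] b cond_exp_contraction[OF m1 H(1) ZH Z(2)] X) auto
    show "0 \<le> b i + b i" using b i by simp
    have "(\<lambda>\<omega>. \<Sum>k<i. d k \<omega>) \<in> borel_measurable (H i)"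
      using i dH by (intro borel_measurable_sum) auto
    moreover have "in_Lm M m (\<lambda>\<omega>. \<Sum>k<i. d k \<omega>)" using i dLm by (intro in_Lm_sum m1) auto
    moreover have di: "d i \<omega> = X i \<omega> - real_cond_exp M (H i) (X i) \<omega>" for \<omega> by (simp add: d_def E_def)
    ultimately show "(\<integral>\<omega>. sgn (\<Sum>k<i. d k \<omega>) * \<bar>\<Sum>k<i. d k \<omega>\<bar> powr (m - 1) * d i \<omega> \<partial>?Q) = 0"
      unfolding di
      using i by (intro cond_exp_orthogonal[OF m1 H(1) ZH Z(2,3)] X) auto
  qed
  \<comment> \<open>the differences have bounds \<open>2 * b i\<close>\<close>
  have s: "4 * taylor_const m * (\<Sum>i<N. (b i + b i)\<^sup>2) = 16 * taylor_const m * (\<Sum>i<N. (b i)\<^sup>2)"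
    by (simp add: sum_distrib_left power2_eq_square algebra_simps)
  have "Lm_bound ?Q m (\<lambda>\<omega>. (\<Sum>i<N. d i \<omega>) + (\<Sum>i<N. E i \<omega>))
      (sqrt (16 * taylor_const m * (\<Sum>i<N. (b i)\<^sup>2)) + (\<Sum>i<N. a i))"
  proof (rule Lm_bound_add[OF m1])
    show "Lm_bound ?Q m (\<lambda>\<omega>. \<Sum>i<N. E i \<omega>) (\<Sum>i<N. a i)"
      using Em a by (intro Lm_bound_sum m1) (auto simp: E_def)
    show "(\<lambda>\<omega>. \<Sum>i<N. d i \<omega>) \<in> borel_measurable ?Q"
      using in_Lm_measurable[OF dLm] by (auto intro: borel_measurable_sum)
    show "(\<lambda>\<omega>. \<Sum>i<N. E i \<omega>) \<in> borel_measurable ?Q" using Em by simp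
    show "0 \<le> sqrt (16 * taylor_const m * (\<Sum>i<N. (b i)\<^sup>2))"
      using taylor_const_ge_1[OF m] by (auto intro!: mult_nonneg_nonneg sum_nonneg)
  qed (use mart[unfolded s] a in \<open>auto intro: sum_nonneg\<close>)
  moreover have "(\<Sum>i<N. d i \<omega>) + (\<Sum>i<N. E i \<omega>) = (\<Sum>i<N. X i \<omega>)" for \<omega>
    by (simp add: d_def flip: sum.distrib)
  ultimately show ?thesis by simp
qed

section \<open>Passing to limits in probability\<close>

lemma (in prob_space) tendsto_in_prob_diff:
  assumes meas: "\<And>k. X k \<in> borel_measurable M" "\<And>k. X' k \<in> borel_measurable M"
      "Y \<in> borel_measurable M" "Y' \<in> borel_measurable M"
    and lim: "tendsto_in_prob M X Y" "tendsto_in_prob M X' Y'"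
  shows "tendsto_in_prob M (\<lambda>k \<omega>. X k \<omega> - X' k \<omega>) (\<lambda>\<omega>. Y \<omega> - Y' \<omega>)"
  unfolding tendsto_in_prob_def
proof (intro allI impI)
  fix \<epsilon> :: real assume e: "\<epsilon> > 0"
  note [measurable] = meas
  let ?A = "\<lambda>k. {\<omega>\<in>space M. \<bar>X k \<omega> - Y \<omega>\<bar> > \<epsilon> / 2}"
  let ?B = "\<lambda>k. {\<omega>\<in>space M. \<bar>X' k \<omega> - Y' \<omega>\<bar> > \<epsilon> / 2}"
  let ?C = "\<lambda>k. {\<omega>\<in>space M. \<bar>X k \<omega> - X' k \<omega> - (Y \<omega> - Y' \<omega>)\<bar> > \<epsilon>}"
  have le: "measure M (?C k) \<le> measure M (?A k) + measure M (?B k)" for k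
  proof -
    have "\<bar>x - y\<bar> > \<epsilon> / 2 \<or> \<bar>x' - y'\<bar> > \<epsilon> / 2" if "\<bar>x - x' - (y - y')\<bar> > \<epsilon>" for x x' y y' :: real
      using that by linarith
    then have "?C k \<subseteq> ?A k \<union> ?B k" by blast
    then have "measure M (?C k) \<le> measure M (?A k \<union> ?B k)"
      by (rule finite_measure_mono) measurable
    also have "\<dots> \<le> measure M (?A k) + measure M (?B k)"
      by (intro measure_Un_le) auto
    finally show ?thesis .
  qed
  have "(\<lambda>k. measure M (?A k) + measure M (?B k)) \<longlonglongrightarrow> 0 + 0"
    using e by (intro tendsto_add lim[unfolded tendsto_in_prob_def, rule_format]) simp_all
  then have "(\<lambda>k. measure M (?A k) + measure M (?B k)) \<longlonglongrightarrow> 0" by simp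
  then show "(\<lambda>k. measure M (?C k)) \<longlonglongrightarrow> 0"
    by (rule tendsto_sandwich[OF _ _ tendsto_const, rotated 2])
       (rule always_eventually, rule allI, rule measure_nonneg, rule always_eventually, rule allI, rule le)
qed

text \<open>Convergence in probability is \<open>L\<^sub>1\<close> convergence of the truncated distances \<open>min 1 \<bar>X k - Y\<bar>\<close>, and
  \<open>L\<^sub>1\<close> convergence yields an almost surely convergent subsequence.\<close>
lemma (in prob_space) tendsto_in_prob_AE_subseq:
  assumes meas: "\<And>k. X k \<in> borel_measurable M" "Y \<in> borel_measurable M"
    and lim: "tendsto_in_prob M X Y"
  shows "\<exists>r::nat \<Rightarrow> nat. strict_mono r \<and> (AE \<omega> in M. (\<lambda>k. X (r k) \<omega>) \<longlonglongrightarrow> Y \<omega>)"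
proof -
  note [measurable] = meas
  define v where "v = (\<lambda>k \<omega>. min 1 \<bar>X k \<omega> - Y \<omega>\<bar>)"
  have int: "integrable M (v k)" for k
    by (rule integrable_const_bound[of _ 1]) (auto simp: v_def)
  have "(\<lambda>k. \<integral>\<omega>. norm (v k \<omega>) \<partial>M) \<longlonglongrightarrow> 0"
  proof (rule LIMSEQ_I)
    fix \<delta> :: real assume d: "\<delta> > 0"
    have "(\<lambda>k. measure M {\<omega>\<in>space M. \<bar>X k \<omega> - Y \<omega>\<bar> > \<delta> / 2}) \<longlonglongrightarrow> 0"
      using lim[unfolded tendsto_in_prob_def, rule_format, of "\<delta> / 2"] d by simp
    then have "eventually (\<lambda>k. measure M {\<omega>\<in>space M. \<bar>X k \<omega> - Y \<omega>\<bar> > \<delta> / 2} < \<delta> / 2) sequentially"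
      using d by (intro order_tendstoD(2)[where y = 0]) auto
    then obtain K where K: "\<And>k. k \<ge> K \<Longrightarrow> measure M {\<omega>\<in>space M. \<bar>X k \<omega> - Y \<omega>\<bar> > \<delta> / 2} < \<delta> / 2"
      by (auto simp: eventually_sequentially)
    have "(\<integral>\<omega>. norm (v k \<omega>) \<partial>M) < \<delta>" if "k \<ge> K" for k
    proof -
      let ?B = "{\<omega>\<in>space M. \<bar>X k \<omega> - Y \<omega>\<bar> > \<delta> / 2}"
      have B: "?B \<in> sets M" by measurable
      have iB: "integrable M (indicat_real ?B)"
        using B by (intro integrable_real_indicator) (auto simp: emeasure_eq_measure)
      have "norm (v k \<omega>) \<le> \<delta> / 2 + indicat_real ?B \<omega>" if "\<omega> \<in> space M" for \<omega>
        using that d by (cases "\<omega> \<in> ?B") (auto simp: v_def min_def)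
      then have "(\<integral>\<omega>. norm (v k \<omega>) \<partial>M) \<le> (\<integral>\<omega>. \<delta> / 2 + indicat_real ?B \<omega> \<partial>M)"
        by (rule integral_mono[OF integrable_norm[OF int] Bochner_Integration.integrable_add[OF _ iB], rotated]) auto
      also have "\<dots> = (\<integral>\<omega>. \<delta> / 2 \<partial>M) + (\<integral>\<omega>. indicat_real ?B \<omega> \<partial>M)"
        by (rule Bochner_Integration.integral_add[OF _ iB]) simp
      also have "\<dots> = \<delta> / 2 + measure M ?B"
        using B by (simp add: prob_space)
      also have "\<dots> < \<delta>" using K[OF that] by simp
      finally show ?thesis .
    qed
    moreover have "norm ((\<integral>\<omega>. norm (v k \<omega>) \<partial>M) - 0) = (\<integral>\<omega>. norm (v k \<omega>) \<partial>M)" for k by simp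
    ultimately show "\<exists>K. \<forall>k\<ge>K. norm ((\<integral>\<omega>. norm (v k \<omega>) \<partial>M) - 0) < \<delta>"
      by metis
  qed
  from tendsto_L1_AE_subseq[OF int this] obtain r :: "nat \<Rightarrow> nat"
    where r: "strict_mono r" "AE \<omega> in M. (\<lambda>k. v (r k) \<omega>) \<longlonglongrightarrow> 0" by blast
  have "AE \<omega> in M. (\<lambda>k. X (r k) \<omega>) \<longlonglongrightarrow> Y \<omega>"
    using r(2)
  proof eventually_elim
    case (elim \<omega>)
    show ?case
    proof (rule LIMSEQ_I)
      fix \<delta> :: real assume d: "\<delta> > 0"
      have "eventually (\<lambda>k. v (r k) \<omega> < min \<delta> 1) sequentially"
        using d by (intro order_tendstoD(2)[OF elim]) auto
      then have "eventually (\<lambda>k. norm (X (r k) \<omega> - Y \<omega>) < \<delta>) sequentially"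
        by eventually_elim (simp add: v_def min_def split: if_splits)
      then show "\<exists>K. \<forall>k\<ge>K. norm (X (r k) \<omega> - Y \<omega>) < \<delta>"
        by (simp add: eventually_sequentially)
    qed
  qed
  with r(1) show ?thesis by blast
qed

text \<open>The limit in probability is taken under \<open>M\<close>, the bound under the weighted measure; an almost
  surely convergent subsequence connects the two, because null sets of \<open>M\<close> are null sets of the
  weighted measure. Fatou's lemma concludes.\<close>
lemma (in prob_space) Lm_bound_limit_in_prob:
  assumes m: "m \<ge> 1" and Z[measurable]: "Z \<in> borel_measurable M"
    and meas: "\<And>k. U k \<in> borel_measurable M" "Y \<in> borel_measurable M"
    and lim: "tendsto_in_prob M U Y"
    and bd: "\<And>l. Lm_bound (density M (\<lambda>\<omega>. ennreal (Z \<omega>))) m (\<lambda>\<omega>. U k \<omega> - U (k + l) \<omega>) a"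
  shows "Lm_bound (density M (\<lambda>\<omega>. ennreal (Z \<omega>))) m (\<lambda>\<omega>. U k \<omega> - Y \<omega>) a"
proof -
  note [measurable] = meas
  obtain r :: "nat \<Rightarrow> nat" where r: "strict_mono r" "AE \<omega> in M. (\<lambda>j. U (r j) \<omega>) \<longlonglongrightarrow> Y \<omega>"
    using tendsto_in_prob_AE_subseq[OF meas lim] by blast
  show ?thesis
  proof (rule Lm_bound_Fatou[where X = "\<lambda>j \<omega>. U k \<omega> - U (r j) \<omega>"])
    show "AE \<omega> in density M (\<lambda>\<omega>. ennreal (Z \<omega>)). (\<lambda>j. U k \<omega> - U (r j) \<omega>) \<longlonglongrightarrow> U k \<omega> - Y \<omega>"
      using r(2) by (subst AE_density) (auto elim!: eventually_mono intro!: tendsto_intros)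
    have "Lm_bound (density M (\<lambda>\<omega>. ennreal (Z \<omega>))) m (\<lambda>\<omega>. U k \<omega> - U (r j) \<omega>) a" if "j \<ge> k" for j
      using bd[of "r j - k"] seq_suble[OF r(1), of j] that by simp
    then show "eventually (\<lambda>j. Lm_bound (density M (\<lambda>\<omega>. ennreal (Z \<omega>))) m (\<lambda>\<omega>. U k \<omega> - U (r j) \<omega>) a) sequentially"
      by (rule eventually_sequentiallyI)
  qed (use m in auto)
qed

text \<open>A bound for conditional expectations survives the limit because conditional expectation is an
  \<open>L\<^sub>m\<close> contraction and the tails \<open>U k - Y\<close> vanish in \<open>L\<^sub>m\<close>.\<close>
lemma (in prob_space) Lm_bound_cond_exp_limit:
  assumes m: "m \<ge> 1" and G: "subalgebra M G" and Z: "Z \<in> borel_measurable G" "\<And>\<omega>. 0 \<le> Z \<omega>"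
    and U: "\<And>k. in_Lm M m (U k)" and Y: "in_Lm M m Y"
    and conv: "\<And>k. Lm_bound (density M (\<lambda>\<omega>. ennreal (Z \<omega>))) m (\<lambda>\<omega>. U k \<omega> - Y \<omega>) (r k)"
      "\<And>k. r k \<ge> 0" "r \<longlonglongrightarrow> 0"
    and bd: "\<And>k. Lm_bound (density M (\<lambda>\<omega>. ennreal (Z \<omega>))) m (real_cond_exp M G (\<lambda>\<omega>. U 0 \<omega> - U k \<omega>)) e"
      "e \<ge> 0"
  shows "Lm_bound (density M (\<lambda>\<omega>. ennreal (Z \<omega>))) m (real_cond_exp M G (\<lambda>\<omega>. U 0 \<omega> - Y \<omega>)) e"
proof (rule Lm_bound_le_of_all_gt)
  interpret sigma_finite_subalgebra M G by (rule sigma_finite_subalgebraI[OF G])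
  let ?Q = "density M (\<lambda>\<omega>. ennreal (Z \<omega>))"
  note [measurable] = in_Lm_measurable[OF U] in_Lm_measurable[OF Y]
  have ZM[measurable]: "Z \<in> borel_measurable M" using measurable_from_subalg[OF G Z(1)] .
  fix \<delta> :: real assume "\<delta> > 0"
  then have "eventually (\<lambda>k. r k < \<delta>) sequentially" by (intro order_tendstoD(2)[OF conv(3)])
  then obtain k where k: "r k < \<delta>" by (auto simp: eventually_sequentially)
  have i: "integrable M (\<lambda>\<omega>. U 0 \<omega> - U k \<omega>)" "integrable M (\<lambda>\<omega>. U k \<omega> - Y \<omega>)"
    using U Y by (auto intro!: in_Lm_integrable[OF m] in_Lm_diff[OF m])
  have "AE \<omega> in M. real_cond_exp M G (\<lambda>\<omega>. (U 0 \<omega> - U k \<omega>) + (U k \<omega> - Y \<omega>)) \<omega>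
      = real_cond_exp M G (\<lambda>\<omega>. U 0 \<omega> - U k \<omega>) \<omega> + real_cond_exp M G (\<lambda>\<omega>. U k \<omega> - Y \<omega>) \<omega>"
    by (rule real_cond_exp_add[OF i])
  then have eq: "AE \<omega> in ?Q. real_cond_exp M G (\<lambda>\<omega>. U 0 \<omega> - Y \<omega>) \<omega>
      = real_cond_exp M G (\<lambda>\<omega>. U 0 \<omega> - U k \<omega>) \<omega> + real_cond_exp M G (\<lambda>\<omega>. U k \<omega> - Y \<omega>) \<omega>"
    by (subst AE_density) auto
  have "Lm_bound ?Q m (\<lambda>\<omega>. real_cond_exp M G (\<lambda>\<omega>. U 0 \<omega> - U k \<omega>) \<omega> + real_cond_exp M G (\<lambda>\<omega>. U k \<omega> - Y \<omega>) \<omega>) (e + r k)"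
    by (intro Lm_bound_add[OF m _ bd _ cond_exp_contraction[OF m G Z _ conv(1)] conv(2)]
        in_Lm_diff[OF m] U Y) auto
  then have "Lm_bound ?Q m (real_cond_exp M G (\<lambda>\<omega>. U 0 \<omega> - Y \<omega>)) (e + r k)"
    using Lm_bound_cong_AE[OF eq] by blast
  then show "Lm_bound ?Q m (real_cond_exp M G (\<lambda>\<omega>. U 0 \<omega> - Y \<omega>)) (e + \<delta>)"
    using k m bd(2) conv(2)[of k] by (elim Lm_bound_mono) auto
qed (use m bd in auto)

section \<open>Conditional norms as suprema over dual weights\<close>

lemma dual_weight_measurable:
  assumes "subalgebra M G" "dual_weight M G m n Z"
  shows "Z \<in> borel_measurable G" "Z \<in> borel_measurable M" "0 \<le> Z \<omega>"
proof -
  show Z: "Z \<in> borel_measurable G" and "0 \<le> Z \<omega>" using assms(2) by (simp_all add: dual_weight_def)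
  show "Z \<in> borel_measurable M" by (rule measurable_from_subalg[OF assms(1) Z])
qed

lemma dual_weight_le:
  assumes "dual_weight M G m n Z" "Y \<in> borel_measurable M"
  shows "(\<integral>\<^sup>+\<omega>. ennreal (Z \<omega>) * ennpowr (Y \<omega>) m \<partial>M) \<le> ennpowr (Ln_norm M n Y) m"
  using assms by (simp add: dual_weight_def)

lemma Lm_bound_of_Ln_norm:
  assumes m: "m \<ge> 0" and G: "subalgebra M G" and Z: "dual_weight M G m n Z" and c: "c \<ge> 0"
    and Y[measurable]: "Y \<in> borel_measurable M"
    and le: "Ln_norm M n (\<lambda>\<omega>. ennreal \<bar>Y \<omega>\<bar>) \<le> ennreal c"
  shows "Lm_bound (density M (\<lambda>\<omega>. ennreal (Z \<omega>))) m Y c"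
proof -
  have "(\<integral>\<^sup>+\<omega>. ennreal (Z \<omega>) * ennpowr (ennreal \<bar>Y \<omega>\<bar>) m \<partial>M) \<le> ennpowr (Ln_norm M n (\<lambda>\<omega>. ennreal \<bar>Y \<omega>\<bar>)) m"
    by (rule dual_weight_le[OF Z]) measurable
  also have "\<dots> \<le> ennpowr (ennreal c) m" by (intro ennpowr_mono le m)
  finally show ?thesis
    unfolding Lm_bound_density[OF dual_weight_measurable(2)[OF G Z] Y] using c by simp
qed

lemma (in prob_space) nn_integral_cond_Lm_norm:
  assumes m: "m > 0" and G: "subalgebra M G" and Z[measurable]: "Z \<in> borel_measurable G"
    and X[measurable]: "X \<in> borel_measurable M"
  shows "(\<integral>\<^sup>+\<omega>. ennreal (Z \<omega>) * ennpowr (cond_Lm_norm M G m X \<omega>) m \<partial>M)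
     = (\<integral>\<^sup>+\<omega>. ennreal (Z \<omega>) * ennreal (\<bar>X \<omega>\<bar> powr m) \<partial>M)"
proof -
  interpret sigma_finite_subalgebra M G by (rule sigma_finite_subalgebraI[OF G])
  have "ennpowr (cond_Lm_norm M G m X \<omega>) m = nn_cond_exp M G (\<lambda>\<omega>. ennreal (\<bar>X \<omega>\<bar> powr m)) \<omega>" for \<omega>
    using m by (simp add: cond_Lm_norm_def ennpowr_ennpowr)
  moreover have "(\<integral>\<^sup>+\<omega>. ennreal (Z \<omega>) * nn_cond_exp M G (\<lambda>\<omega>. ennreal (\<bar>X \<omega>\<bar> powr m)) \<omega> \<partial>M)
     = (\<integral>\<^sup>+\<omega>. ennreal (Z \<omega>) * ennreal (\<bar>X \<omega>\<bar> powr m) \<partial>M)"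
    by (rule nn_cond_exp_intg) measurable
  ultimately show ?thesis by simp
qed

lemma cond_Lm_norm_measurable:
  "cond_Lm_norm M G m X \<in> borel_measurable G"
  unfolding cond_Lm_norm_def by measurable

lemma (in prob_space) Lm_bound_of_cond_Lm_norm:
  assumes m: "m > 0" and G: "subalgebra M G" and Z: "dual_weight M G m n Z" and c: "c \<ge> 0"
    and X[measurable]: "X \<in> borel_measurable M"
    and le: "Ln_norm M n (cond_Lm_norm M G m X) \<le> ennreal c"
  shows "Lm_bound (density M (\<lambda>\<omega>. ennreal (Z \<omega>))) m X c"
proof -
  note Zm = dual_weight_measurable[OF G Z]
  have [measurable]: "cond_Lm_norm M G m X \<in> borel_measurable M"
    using measurable_from_subalg[OF G cond_Lm_norm_measurable] .
  have "(\<integral>\<^sup>+\<omega>. ennreal (Z \<omega>) * ennreal (\<bar>X \<omega>\<bar> powr m) \<partial>M)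
      = (\<integral>\<^sup>+\<omega>. ennreal (Z \<omega>) * ennpowr (cond_Lm_norm M G m X \<omega>) m \<partial>M)"
    using nn_integral_cond_Lm_norm[OF m G Zm(1) X] by simp
  also have "\<dots> \<le> ennpowr (Ln_norm M n (cond_Lm_norm M G m X)) m"
    by (rule dual_weight_le[OF Z]) measurable
  also have "\<dots> \<le> ennpowr (ennreal c) m" using m by (intro ennpowr_mono le) auto
  finally show ?thesis unfolding Lm_bound_density[OF Zm(2) X] using c by simp
qed

lemma (in prob_space) cond_Lm_norm_le:
  assumes m: "m \<ge> 1" "ennreal m \<le> n" and G: "subalgebra M G" and c: "c \<ge> 0"
    and X[measurable]: "X \<in> borel_measurable M"
    and bd: "\<And>Z. dual_weight M G m n Z \<Longrightarrow> Lm_bound (density M (\<lambda>\<omega>. ennreal (Z \<omega>))) m X c"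
  shows "Ln_norm M n (cond_Lm_norm M G m X) \<le> ennreal (2 * c)"
proof (rule Ln_norm_le_dual[OF m G cond_Lm_norm_measurable c])
  fix Z assume Z: "dual_weight M G m n Z"
  note Zm = dual_weight_measurable[OF G Z]
  have m0: "m > 0" using m by simp
  show "(\<integral>\<^sup>+\<omega>. ennreal (Z \<omega>) * ennpowr (cond_Lm_norm M G m X \<omega>) m \<partial>M) \<le> ennreal (c powr m)"
    using bd[OF Z] unfolding Lm_bound_density[OF Zm(2) X] nn_integral_cond_Lm_norm[OF m0 G Zm(1) X] .
qed

lemma (in prob_space) Ln_norm_le_of_Lm_bound:
  assumes m: "m \<ge> 1" "ennreal m \<le> n" and G: "subalgebra M G" and c: "c \<ge> 0"
    and Y[measurable]: "Y \<in> borel_measurable G"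
    and bd: "\<And>Z. dual_weight M G m n Z \<Longrightarrow> Lm_bound (density M (\<lambda>\<omega>. ennreal (Z \<omega>))) m Y c"
  shows "Ln_norm M n (\<lambda>\<omega>. ennreal \<bar>Y \<omega>\<bar>) \<le> ennreal (2 * c)"
proof (rule Ln_norm_le_dual[OF m G _ c])
  fix Z assume Z: "dual_weight M G m n Z"
  have YM: "Y \<in> borel_measurable M" using measurable_from_subalg[OF G Y] .
  show "(\<integral>\<^sup>+\<omega>. ennreal (Z \<omega>) * ennpowr (ennreal \<bar>Y \<omega>\<bar>) m \<partial>M) \<le> ennreal (c powr m)"
    using bd[OF Z] unfolding Lm_bound_density[OF dual_weight_measurable(2)[OF G Z] YM] by simp
qed auto

section \<open>The singular weights\<close>

definition weight :: "real \<Rightarrow> real \<Rightarrow> real \<Rightarrow> real \<Rightarrow> real \<Rightarrow> real" where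
  "weight S T \<alpha> \<beta> r = (r - S) powr (-\<alpha>) * (T - r) powr (-\<beta>)"

lemma eta_eq: "eta S T \<alpha> \<beta> s t = (LBINT r:{s..t}. weight S T \<alpha> \<beta> r)"
  by (simp add: eta_def weight_def)

lemma weight_nonneg [simp]: "weight S T \<alpha> \<beta> r \<ge> 0"
  by (simp add: weight_def)

lemma weight_measurable [measurable]: "weight S T \<alpha> \<beta> \<in> borel_measurable borel"
  unfolding weight_def[abs_def] by measurable

text \<open>Squaring doubles the exponents; this turns \<open>\<alpha>\<^sub>2, \<beta>\<^sub>2 < 1/2\<close> into integrable exponents below \<open>1\<close>.\<close>
lemma weight_square: "(weight S T \<alpha> \<beta> r)\<^sup>2 = weight S T (2 * \<alpha>) (2 * \<beta>) r"
proof -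
  have "(x powr (- a))\<^sup>2 = x powr (- (2 * a))" for x a :: real
    unfolding power2_eq_square powr_add[symmetric] by simp
  then show ?thesis by (simp add: weight_def power_mult_distrib)
qed

text \<open>Logarithmic form of the tangent inequality \<open>ln y \<le> ln x + (y - x) / x\<close>.\<close>
lemma powr_le_tangent:
  fixes x y \<alpha> :: real
  assumes "x > 0" "y > 0" "\<alpha> \<ge> 0"
  shows "x powr (-\<alpha>) * exp (- (\<alpha> * (y - x) / x)) \<le> y powr (-\<alpha>)"
proof -
  have "ln (y / x) \<le> y / x - 1" using assms by (intro ln_le_minus_one) auto
  then have "ln y \<le> ln x + (y - x) / x" using assms by (simp add: ln_div diff_divide_distrib)
  then have "\<alpha> * ln y \<le> \<alpha> * (ln x + (y - x) / x)" using assms by (intro mult_left_mono) auto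
  then have "- \<alpha> * ln x + - (\<alpha> * (y - x) / x) \<le> - \<alpha> * ln y"
    by (simp add: algebra_simps)
  then have "exp (- \<alpha> * ln x + - (\<alpha> * (y - x) / x)) \<le> exp (- \<alpha> * ln y)"
    by (simp only: exp_le_cancel_iff)
  then show ?thesis using assms unfolding exp_add by (simp add: powr_def)
qed

text \<open>The weight is the exponential of a convex function, so it lies above the exponential of a tangent,
  and a fortiori above its own tangent at \<open>u\<close>.\<close>
lemma weight_above_tangent:
  assumes "S < u" "u < T" "\<alpha> \<ge> 0" "\<beta> \<ge> 0"
  obtains c where "\<And>r. S < r \<Longrightarrow> r < T \<Longrightarrow> weight S T \<alpha> \<beta> u * (1 + c * (r - u)) \<le> weight S T \<alpha> \<beta> r"
proof
  fix r assume r: "S < r" "r < T"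
  let ?c = "\<beta> / (T - u) - \<alpha> / (u - S)"
  have "weight S T \<alpha> \<beta> u * (1 + ?c * (r - u)) \<le> weight S T \<alpha> \<beta> u * exp (?c * (r - u))"
    by (intro mult_left_mono exp_ge_add_one_self) auto
  also have "exp (?c * (r - u)) = exp (- (\<alpha> * ((r - S) - (u - S)) / (u - S)) + - (\<beta> * ((T - r) - (T - u)) / (T - u)))"
    using assms by (simp add: diff_divide_distrib algebra_simps)
  also have "weight S T \<alpha> \<beta> u * \<dots>
      = ((u - S) powr (-\<alpha>) * exp (- (\<alpha> * ((r - S) - (u - S)) / (u - S))))
        * ((T - u) powr (-\<beta>) * exp (- (\<beta> * ((T - r) - (T - u)) / (T - u))))"
    unfolding exp_add weight_def by (simp only: mult_ac)
  also have "\<dots> \<le> (r - S) powr (-\<alpha>) * (T - r) powr (-\<beta>)"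
    using assms r by (intro mult_mono powr_le_tangent) auto
  finally show "weight S T \<alpha> \<beta> u * (1 + ?c * (r - u)) \<le> weight S T \<alpha> \<beta> r"
    by (simp add: weight_def)
qed

lemma integrable_powr_shift:
  fixes \<alpha> S T :: real
  assumes "\<alpha> < 1" "S \<le> T"
  shows "set_integrable lborel {S..T} (\<lambda>r. (r - S) powr (-\<alpha>))"
    and "set_integrable lborel {S..T} (\<lambda>r. (T - r) powr (-\<alpha>))"
proof -
  have "(\<lambda>x. x powr (-\<alpha>)) integrable_on {0..T - S}"
    using has_integral_powr_from_0[of "-\<alpha>" "T - S"] assms by (auto simp: integrable_on_def)
  then have "(\<lambda>x. x powr (-\<alpha>)) absolutely_integrable_on {0..T - S}"
    by (rule nonnegative_absolutely_integrable_1) auto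
  then have "set_integrable lborel {0..T - S} (\<lambda>x. x powr (-\<alpha>))"
    unfolding set_integrable_def by (subst (asm) integrable_completion) auto
  then have *: "integrable lborel (\<lambda>x. indicator {0..T - S} x *\<^sub>R x powr (-\<alpha>))"
    unfolding set_integrable_def .
  have "integrable lborel (\<lambda>x. indicator {0..T - S} (- S + 1 * x) *\<^sub>R (- S + 1 * x) powr (-\<alpha>))"
    using lborel_integrable_real_affine[OF *, of 1 "-S"] by simp
  also have "(\<lambda>x. indicator {0..T - S} (- S + 1 * x) *\<^sub>R (- S + 1 * x) powr (-\<alpha>))
     = (\<lambda>x. indicator {S..T} x *\<^sub>R (x - S) powr (-\<alpha>))"
    by (auto simp: indicator_def fun_eq_iff)
  finally show "set_integrable lborel {S..T} (\<lambda>r. (r - S) powr (-\<alpha>))"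
    unfolding set_integrable_def .
  have "integrable lborel (\<lambda>x. indicator {0..T - S} (T + (-1) * x) *\<^sub>R (T + (-1) * x) powr (-\<alpha>))"
    using lborel_integrable_real_affine[OF *, of "-1" "T"] by simp
  also have "(\<lambda>x. indicator {0..T - S} (T + (-1) * x) *\<^sub>R (T + (-1) * x) powr (-\<alpha>))
     = (\<lambda>x. indicator {S..T} x *\<^sub>R (T - x) powr (-\<alpha>))"
    by (auto simp: indicator_def fun_eq_iff)
  finally show "set_integrable lborel {S..T} (\<lambda>r. (T - r) powr (-\<alpha>))"
    unfolding set_integrable_def .
qed

text \<open>On each half of \<open>[S, T]\<close> one factor is bounded and the other is an integrable power.\<close>
lemma weight_integrable:
  assumes ST: "S < T" and ab: "0 \<le> \<alpha>" "\<alpha> < 1" "0 \<le> \<beta>" "\<beta> < 1"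
    and st: "S \<le> s" "t \<le> T"
  shows "set_integrable lborel {s..t} (weight S T \<alpha> \<beta>)"
proof -
  define h where "h = (T - S) / 2"
  have h: "h > 0" using ST by (simp add: h_def)
  have bd: "weight S T \<alpha> \<beta> r \<le> h powr (-\<beta>) * (r - S) powr (-\<alpha>) + h powr (-\<alpha>) * (T - r) powr (-\<beta>)"
    if r: "S \<le> r" "r \<le> T" for r
  proof (cases "r - S \<le> h")
    case True
    then have "(T - r) powr (-\<beta>) \<le> h powr (-\<beta>)"
      using h ab by (intro powr_mono2') (auto simp: h_def field_simps)
    then have "(r - S) powr (-\<alpha>) * (T - r) powr (-\<beta>) \<le> (r - S) powr (-\<alpha>) * h powr (-\<beta>)"
      by (intro mult_left_mono) auto
    moreover have "0 \<le> h powr (-\<alpha>) * (T - r) powr (-\<beta>)" by simp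
    ultimately show ?thesis unfolding weight_def mult.commute[of "h powr (-\<beta>)"] by linarith
  next
    case False
    then have "(r - S) powr (-\<alpha>) \<le> h powr (-\<alpha>)"
      using h ab by (intro powr_mono2') auto
    then have "(r - S) powr (-\<alpha>) * (T - r) powr (-\<beta>) \<le> h powr (-\<alpha>) * (T - r) powr (-\<beta>)"
      by (intro mult_right_mono) auto
    moreover have "0 \<le> h powr (-\<beta>) * (r - S) powr (-\<alpha>)" by simp
    ultimately show ?thesis unfolding weight_def by linarith
  qed
  have "set_integrable lborel {S..T} (weight S T \<alpha> \<beta>)"
  proof (rule set_integrable_bound)
    show "set_integrable lborel {S..T}
        (\<lambda>r. h powr (-\<beta>) * (r - S) powr (-\<alpha>) + h powr (-\<alpha>) * (T - r) powr (-\<beta>))"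
      using ST ab by (intro set_integral_add(1) set_integrable_mult_right integrable_powr_shift) auto
    show "AE x in lborel. x \<in> {S..T} \<longrightarrow> norm (weight S T \<alpha> \<beta> x)
        \<le> norm (h powr - \<beta> * (x - S) powr - \<alpha> + h powr - \<alpha> * (T - x) powr - \<beta>)"
      using bd by (intro AE_I2) (auto simp: abs_of_nonneg add_nonneg_nonneg)
  qed (auto simp: set_borel_measurable_def)
  then show ?thesis by (rule set_integrable_subset) (use st in auto)
qed

locale weight_params =
  fixes S T \<alpha> \<beta> :: real
  assumes ST: "S < T" and alpha: "0 \<le> \<alpha>" "\<alpha> < 1" and beta: "0 \<le> \<beta>" "\<beta> < 1"
begin

lemma eta_integral:
  assumes "S \<le> s" "t \<le> T"
  shows "weight S T \<alpha> \<beta> integrable_on {s..t}" "eta S T \<alpha> \<beta> s t = integral {s..t} (weight S T \<alpha> \<beta>)"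
  using set_borel_integral_eq_integral[OF weight_integrable[OF ST alpha beta assms]]
  by (auto simp: eta_eq)

lemma eta_nonneg: "S \<le> s \<Longrightarrow> t \<le> T \<Longrightarrow> 0 \<le> eta S T \<alpha> \<beta> s t"
  by (simp add: eta_integral integral_nonneg)

lemma eta_combine:
  assumes "S \<le> s" "s \<le> u" "u \<le> t" "t \<le> T"
  shows "eta S T \<alpha> \<beta> s u + eta S T \<alpha> \<beta> u t = eta S T \<alpha> \<beta> s t"
  using assms by (simp add: eta_integral Henstock_Kurzweil_Integration.integral_combine)

lemma weight_midpoint_le_eta:
  assumes st: "S \<le> s" "s < t" "t \<le> T"
  shows "weight S T \<alpha> \<beta> ((s + t) / 2) * (t - s) \<le> eta S T \<alpha> \<beta> s t"
proof -
  define u where "u = (s + t) / 2"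
  have u: "S < u" "u < T" using st by (auto simp: u_def)
  obtain c where c: "\<And>r. S < r \<Longrightarrow> r < T \<Longrightarrow> weight S T \<alpha> \<beta> u * (1 + c * (r - u)) \<le> weight S T \<alpha> \<beta> r"
    using weight_above_tangent[OF u alpha(1) beta(1)] by blast
  \<comment> \<open>an antiderivative of the tangent; its quadratic part takes equal values at \<open>s\<close> and \<open>t\<close>, which is where the midpoint matters\<close>
  define G where "G = (\<lambda>r. weight S T \<alpha> \<beta> u * (r + c * ((r - u)\<^sup>2 / 2)))"
  have "((\<lambda>r. weight S T \<alpha> \<beta> u * (1 + c * (r - u))) has_integral G t - G s) {s..t}"
    unfolding G_def using st
    by (intro fundamental_theorem_of_calculus)
       (auto intro!: derivative_eq_intros simp flip: has_real_derivative_iff_has_vector_derivative)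
  moreover have "G t - G s = weight S T \<alpha> \<beta> u * (t - s)"
  proof -
    have "(t - u)\<^sup>2 = (s - u)\<^sup>2" by (simp add: u_def power2_eq_square field_simps)
    then show ?thesis by (simp add: G_def algebra_simps)
  qed
  ultimately have L: "((\<lambda>r. weight S T \<alpha> \<beta> u * (1 + c * (r - u))) has_integral weight S T \<alpha> \<beta> u * (t - s)) {s..t}"
    by simp
  have R: "(weight S T \<alpha> \<beta> has_integral eta S T \<alpha> \<beta> s t) {s..t}"
    using eta_integral st by (simp add: integrable_integral)
  have "((\<lambda>r. if r \<in> box s t then weight S T \<alpha> \<beta> u * (1 + c * (r - u)) else 0)
      has_integral weight S T \<alpha> \<beta> u * (t - s)) (cbox s t)"
    by (rule has_integral_spike_interior[OF L[folded cbox_interval]]) auto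
  then have "weight S T \<alpha> \<beta> u * (t - s) \<le> eta S T \<alpha> \<beta> s t"
    by (rule has_integral_le[OF _ R[folded cbox_interval]]) (use c st in \<open>auto simp: box_real\<close>)
  then show ?thesis by (simp add: u_def)
qed

text \<open>The midpoint rule for a convex function underestimates the integral on each cell. The second
  conjunct carries the induction.\<close>
lemma weight_sum_le_eta:
  fixes p :: "nat \<Rightarrow> real"
  assumes "S \<le> p 0" "\<And>i. i < N \<Longrightarrow> p i < p (Suc i)" "p N \<le> T"
  shows "(\<Sum>i<N. weight S T \<alpha> \<beta> ((p i + p (Suc i)) / 2) * (p (Suc i) - p i)) \<le> eta S T \<alpha> \<beta> (p 0) (p N)
    \<and> p 0 \<le> p N"
  using assms(2,3)
proof (induction N)
  case 0
  then show ?case using assms(1) by (auto intro: eta_nonneg)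
next
  case (Suc N)
  have lt: "p N < p (Suc N)" using Suc.prems by simp
  then have IH: "(\<Sum>i<N. weight S T \<alpha> \<beta> ((p i + p (Suc i)) / 2) * (p (Suc i) - p i)) \<le> eta S T \<alpha> \<beta> (p 0) (p N)"
    "p 0 \<le> p N"
    using Suc.IH[OF Suc.prems(1)[OF less_SucI]] Suc.prems(2) by auto
  have "weight S T \<alpha> \<beta> ((p N + p (Suc N)) / 2) * (p (Suc N) - p N) \<le> eta S T \<alpha> \<beta> (p N) (p (Suc N))"
    using assms(1) IH lt Suc.prems(2) by (intro weight_midpoint_le_eta) auto
  moreover have "eta S T \<alpha> \<beta> (p 0) (p N) + eta S T \<alpha> \<beta> (p N) (p (Suc N)) = eta S T \<alpha> \<beta> (p 0) (p (Suc N))"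
    using assms(1) Suc.prems(2) IH less_imp_le[OF lt] by (intro eta_combine)
  ultimately show ?case using IH lt by simp
qed

end

section \<open>Dyadic Riemann sums\<close>

lemma sum_pairs: "(\<Sum>i<2 * N. f i) = (\<Sum>i<N. f (2 * i) + f (Suc (2 * i)))" for f :: "nat \<Rightarrow> real"
  by (induction N) auto

definition dyadic :: "real \<Rightarrow> real \<Rightarrow> nat \<Rightarrow> nat \<Rightarrow> real" where
  "dyadic s t k i = s + real i * ((t - s) / 2 ^ k)"

lemma dyadic_ends [simp]: "dyadic s t k 0 = s" "dyadic s t k (2 ^ k) = t"
  by (simp_all add: dyadic_def)

lemma dyadic_step: "dyadic s t k (Suc i) - dyadic s t k i = (t - s) / 2 ^ k"
  unfolding dyadic_def of_nat_Suc distrib_right by simp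

lemma dyadic_mono: "s \<le> t \<Longrightarrow> i \<le> j \<Longrightarrow> dyadic s t k i \<le> dyadic s t k j"
  by (simp add: dyadic_def mult_right_mono divide_right_mono)

lemma dyadic_less_Suc: "s < t \<Longrightarrow> dyadic s t k i < dyadic s t k (Suc i)"
  using dyadic_step[of s t k i] by (smt (verit) divide_pos_pos zero_less_power)

lemma dyadic_range:
  assumes "s \<le> t" "i \<le> 2 ^ k"
  shows "s \<le> dyadic s t k i" "dyadic s t k i \<le> t"
  using dyadic_mono[OF assms(1), of 0 i k] dyadic_mono[OF assms, of k] by simp_all

lemma dyadic_Suc_even: "dyadic s t (Suc k) (2 * i) = dyadic s t k i"
  by (simp add: dyadic_def)

lemma dyadic_Suc_odd: "dyadic s t (Suc k) (Suc (2 * i)) = (dyadic s t k i + dyadic s t k (Suc i)) / 2"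
  by (simp add: dyadic_def field_simps)

definition dyadic_sum :: "(real \<Rightarrow> real \<Rightarrow> 'a \<Rightarrow> real) \<Rightarrow> real \<Rightarrow> real \<Rightarrow> nat \<Rightarrow> 'a \<Rightarrow> real" where
  "dyadic_sum A s t k = (\<lambda>\<omega>. \<Sum>i<2 ^ k. A (dyadic s t k i) (dyadic s t k (Suc i)) \<omega>)"

lemma dyadic_sum_0 [simp]: "dyadic_sum A s t 0 = A s t"
  by (simp add: dyadic_sum_def dyadic_def)

definition dyadic_increment :: "(real \<Rightarrow> real \<Rightarrow> 'a \<Rightarrow> real) \<Rightarrow> real \<Rightarrow> real \<Rightarrow> nat \<Rightarrow> nat \<Rightarrow> 'a \<Rightarrow> real" where
  "dyadic_increment A s t k i =
     increment A (dyadic s t k i) ((dyadic s t k i + dyadic s t k (Suc i)) / 2) (dyadic s t k (Suc i))"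

lemma dyadic_sum_refine:
  "dyadic_sum A s t k \<omega> - dyadic_sum A s t (Suc k) \<omega> = (\<Sum>i<2 ^ k. dyadic_increment A s t k i \<omega>)"
proof -
  have "dyadic s t (Suc k) (Suc (Suc (2 * i))) = dyadic s t k (Suc i)" for i
    using dyadic_Suc_even[of s t k "Suc i"] by simp
  then show ?thesis
    unfolding dyadic_sum_def power_Suc sum_pairs
    by (simp add: dyadic_Suc_even dyadic_Suc_odd dyadic_increment_def increment_def sum_subtractf sum.distrib)
qed

lemma dyadic_mesh_powr:
  fixes s t \<epsilon> :: real
  assumes "s < t"
  shows "((t - s) / 2 ^ k) powr \<epsilon> = (t - s) powr \<epsilon> * (2 powr (-\<epsilon>)) ^ k"
proof -
  have "(2 ^ k :: real) powr \<epsilon> = (2 powr \<epsilon>) ^ k"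
    by (simp add: powr_realpow[symmetric] powr_powr mult.commute)
  then show ?thesis using assms by (simp add: powr_divide powr_minus_divide power_one_over)
qed

text \<open>The sum of the geometric series of ratio \<open>2 powr (-\<epsilon>)\<close>.\<close>
definition geom_const :: "real \<Rightarrow> real" where "geom_const \<epsilon> = 1 / (1 - 2 powr (-\<epsilon>))"

lemma geom_ratio: "\<epsilon> > 0 \<Longrightarrow> 0 < 2 powr (-\<epsilon>) \<and> 2 powr (-\<epsilon>) < (1::real)"
  using powr_less_mono[of "-\<epsilon>" 0 2] by simp

lemma geom_pos: "\<epsilon> > 0 \<Longrightarrow> geom_const \<epsilon> > 0"
  using geom_ratio[of \<epsilon>] by (simp add: geom_const_def)

lemma sum_geom_le:
  assumes "\<epsilon> > 0"
  shows "(\<Sum>j<l. (2 powr (-\<epsilon>)) ^ (k + j)) \<le> geom_const \<epsilon> * (2 powr (-\<epsilon>)) ^ k"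
proof -
  define \<rho> where "\<rho> = 2 powr (-\<epsilon>)"
  have r: "0 < \<rho>" "\<rho> < 1" using geom_ratio[OF assms] by (auto simp: \<rho>_def)
  have "(\<Sum>j<l. \<rho> ^ j) = (1 - \<rho> ^ l) / (1 - \<rho>)" using r by (simp add: sum_gp_strict)
  also have "\<dots> \<le> 1 / (1 - \<rho>)" using r by (intro divide_right_mono) auto
  finally have "\<rho> ^ k * (\<Sum>j<l. \<rho> ^ j) \<le> \<rho> ^ k * (1 / (1 - \<rho>))" using r by (intro mult_left_mono) auto
  then show ?thesis by (simp add: geom_const_def \<rho>_def power_add sum_distrib_left)
qed

text \<open>The hypotheses of the sewing lemma on \<open>A\<close> alone; the process \<open>\<A>\<close> enters later, through the
  limit of dyadic sums.\<close>
locale stochastic_sewing = prob_space M for M :: "'a measure" +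
  fixes F :: "real \<Rightarrow> 'a measure" and S T m :: real and n :: ennreal
    and A :: "real \<Rightarrow> real \<Rightarrow> 'a \<Rightarrow> real"
    and \<Gamma>\<^sub>1 \<Gamma>\<^sub>2 \<alpha>\<^sub>1 \<beta>\<^sub>1 \<alpha>\<^sub>2 \<beta>\<^sub>2 \<epsilon>\<^sub>1 \<epsilon>\<^sub>2 :: real
  assumes m: "2 \<le> m" and mn: "ennreal m \<le> n" and ST: "0 \<le> S" "S < T"
    and filtration: "filtration_upto M T F"
    and A_adapted: "S \<le> s \<Longrightarrow> s \<le> t \<Longrightarrow> t \<le> T \<Longrightarrow> A s t \<in> borel_measurable (F t)"
    and A_Lm: "S \<le> s \<Longrightarrow> s \<le> t \<Longrightarrow> t \<le> T \<Longrightarrow> in_Lm M m (A s t)"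
    and Gamma: "0 \<le> \<Gamma>\<^sub>1" "0 \<le> \<Gamma>\<^sub>2"
    and exponents: "0 \<le> \<alpha>\<^sub>1" "\<alpha>\<^sub>1 < 1" "0 \<le> \<beta>\<^sub>1" "\<beta>\<^sub>1 < 1"
      "0 \<le> \<alpha>\<^sub>2" "\<alpha>\<^sub>2 < 1 / 2" "0 \<le> \<beta>\<^sub>2" "\<beta>\<^sub>2 < 1 / 2" "0 < \<epsilon>\<^sub>1" "0 < \<epsilon>\<^sub>2"
    and cond_exp_increment: "S \<le> s \<Longrightarrow> s \<le> t \<Longrightarrow> t \<le> T \<Longrightarrow>
      Ln_norm M n (\<lambda>\<omega>. ennreal \<bar>real_cond_exp M (F s) (increment A s ((s + t) / 2) t) \<omega>\<bar>)
        \<le> ennreal (\<Gamma>\<^sub>1 * weight S T \<alpha>\<^sub>1 \<beta>\<^sub>1 ((s + t) / 2) * (t - s) powr (1 + \<epsilon>\<^sub>1))"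
    and cond_norm_increment: "S \<le> s \<Longrightarrow> s \<le> t \<Longrightarrow> t \<le> T \<Longrightarrow>
      Ln_norm M n (cond_Lm_norm M (F S) m (increment A s ((s + t) / 2) t))
        \<le> ennreal (\<Gamma>\<^sub>2 * weight S T \<alpha>\<^sub>2 \<beta>\<^sub>2 ((s + t) / 2) * (t - s) powr (1 / 2 + \<epsilon>\<^sub>2))"
begin

abbreviation "\<eta>\<^sub>1 \<equiv> eta S T \<alpha>\<^sub>1 \<beta>\<^sub>1"
abbreviation "\<eta>\<^sub>2 \<equiv> eta S T (2 * \<alpha>\<^sub>2) (2 * \<beta>\<^sub>2)"

sublocale w1: weight_params S T \<alpha>\<^sub>1 \<beta>\<^sub>1
  by unfold_locales (use ST exponents in auto)

sublocale w2: weight_params S T "2 * \<alpha>\<^sub>2" "2 * \<beta>\<^sub>2"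
  by unfold_locales (use ST exponents in auto)

lemma m1: "1 \<le> m" using m by simp

lemma subalgebra_M: "S \<le> s \<Longrightarrow> s \<le> T \<Longrightarrow> subalgebra M (F s)"
  using filtration ST by (auto simp: filtration_upto_def)

lemma subalgebra_F: "S \<le> s \<Longrightarrow> s \<le> t \<Longrightarrow> t \<le> T \<Longrightarrow> subalgebra (F t) (F s)"
  using filtration ST unfolding filtration_upto_def by auto

lemma FS: "subalgebra M (F S)" using subalgebra_M ST by simp

lemma increment_in_Lm:
  assumes "S \<le> s" "s \<le> u" "u \<le> t" "t \<le> T"
  shows "in_Lm M m (increment A s u t)"
  unfolding increment_def using assms by (intro in_Lm_diff A_Lm m1) auto

lemma increment_adapted:
  assumes "S \<le> s" "s \<le> u" "u \<le> t" "t \<le> T"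
  shows "increment A s u t \<in> borel_measurable (F t)"
proof -
  have "A s u \<in> borel_measurable (F t)"
    by (rule measurable_from_subalg[OF subalgebra_F A_adapted]) (use assms in auto)
  moreover have "A s t \<in> borel_measurable (F t)" "A u t \<in> borel_measurable (F t)"
    using assms by (auto intro: A_adapted)
  ultimately show ?thesis unfolding increment_def by measurable
qed

lemma cond_exp_increment_bound:
  assumes Z: "dual_weight M (F S) m n Z" and st: "S \<le> s" "s \<le> t" "t \<le> T"
  shows "Lm_bound (density M (\<lambda>\<omega>. ennreal (Z \<omega>))) m (real_cond_exp M (F s) (increment A s ((s + t) / 2) t))
    (\<Gamma>\<^sub>1 * weight S T \<alpha>\<^sub>1 \<beta>\<^sub>1 ((s + t) / 2) * (t - s) powr (1 + \<epsilon>\<^sub>1))"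
  using m Gamma
  by (intro Lm_bound_of_Ln_norm[OF _ FS Z] cond_exp_increment st) auto

lemma increment_bound:
  assumes Z: "dual_weight M (F S) m n Z" and st: "S \<le> s" "s \<le> t" "t \<le> T"
  shows "Lm_bound (density M (\<lambda>\<omega>. ennreal (Z \<omega>))) m (increment A s ((s + t) / 2) t)
    (\<Gamma>\<^sub>2 * weight S T \<alpha>\<^sub>2 \<beta>\<^sub>2 ((s + t) / 2) * (t - s) powr (1 / 2 + \<epsilon>\<^sub>2))"
  using m Gamma st
  by (intro Lm_bound_of_cond_Lm_norm[OF _ FS Z] cond_norm_increment in_Lm_measurable[OF increment_in_Lm]) auto

context
  fixes s t :: real
  assumes st: "S \<le> s" "s < t" "t \<le> T"
begin

abbreviation "D \<equiv> dyadic s t"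
abbreviation "U \<equiv> dyadic_sum A s t"

lemma D_range: "i \<le> 2 ^ k \<Longrightarrow> S \<le> D k i \<and> D k i \<le> T"
  using dyadic_range[of s t i k] st by auto

lemma U_in_Lm: "in_Lm M m (U k)"
  unfolding dyadic_sum_def using D_range st by (intro in_Lm_sum m1 A_Lm) (auto intro: dyadic_mono)

lemma sum_cond_exp_bounds_le:
  "(\<Sum>i<2 ^ k. \<Gamma>\<^sub>1 * weight S T \<alpha>\<^sub>1 \<beta>\<^sub>1 ((D k i + D k (Suc i)) / 2) * (D k (Suc i) - D k i) powr (1 + \<epsilon>\<^sub>1))
    \<le> \<Gamma>\<^sub>1 * \<eta>\<^sub>1 s t * ((t - s) / 2 ^ k) powr \<epsilon>\<^sub>1"
proof -
  define h where "h = (t - s) / 2 ^ k"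
  have h: "h > 0" using st by (simp add: h_def)
  have hp: "h powr (1 + \<epsilon>\<^sub>1) = h * h powr \<epsilon>\<^sub>1" using h by (simp add: powr_add)
  have "(\<Sum>i<2 ^ k. weight S T \<alpha>\<^sub>1 \<beta>\<^sub>1 ((D k i + D k (Suc i)) / 2) * h) \<le> \<eta>\<^sub>1 s t"
    using w1.weight_sum_le_eta[of "D k" "2 ^ k"] st by (simp add: dyadic_less_Suc dyadic_step h_def)
  then have "\<Gamma>\<^sub>1 * h powr \<epsilon>\<^sub>1 * (\<Sum>i<2 ^ k. weight S T \<alpha>\<^sub>1 \<beta>\<^sub>1 ((D k i + D k (Suc i)) / 2) * h)
      \<le> \<Gamma>\<^sub>1 * h powr \<epsilon>\<^sub>1 * \<eta>\<^sub>1 s t"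
    using Gamma by (intro mult_left_mono) auto
  then show ?thesis by (simp add: dyadic_step h_def[symmetric] hp sum_distrib_left mult_ac)
qed

lemma sum_squared_bounds_le:
  "(\<Sum>i<2 ^ k. (\<Gamma>\<^sub>2 * weight S T \<alpha>\<^sub>2 \<beta>\<^sub>2 ((D k i + D k (Suc i)) / 2) * (D k (Suc i) - D k i) powr (1 / 2 + \<epsilon>\<^sub>2))\<^sup>2)
    \<le> (\<Gamma>\<^sub>2 * sqrt (\<eta>\<^sub>2 s t) * ((t - s) / 2 ^ k) powr \<epsilon>\<^sub>2)\<^sup>2"
proof -
  define h where "h = (t - s) / 2 ^ k"
  have h: "h > 0" using st by (simp add: h_def)
  have hp: "(h powr (1 / 2 + \<epsilon>\<^sub>2))\<^sup>2 = h * (h powr \<epsilon>\<^sub>2)\<^sup>2"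
    using h by (simp add: powr_add power_mult_distrib powr_half_sqrt)
  have e: "0 \<le> \<eta>\<^sub>2 s t" using w2.eta_nonneg st by simp
  have "(\<Sum>i<2 ^ k. weight S T (2 * \<alpha>\<^sub>2) (2 * \<beta>\<^sub>2) ((D k i + D k (Suc i)) / 2) * h) \<le> \<eta>\<^sub>2 s t"
    using w2.weight_sum_le_eta[of "D k" "2 ^ k"] st by (simp add: dyadic_less_Suc dyadic_step h_def)
  then have "\<Gamma>\<^sub>2\<^sup>2 * (h powr \<epsilon>\<^sub>2)\<^sup>2 * (\<Sum>i<2 ^ k. weight S T (2 * \<alpha>\<^sub>2) (2 * \<beta>\<^sub>2) ((D k i + D k (Suc i)) / 2) * h)
      \<le> \<Gamma>\<^sub>2\<^sup>2 * (h powr \<epsilon>\<^sub>2)\<^sup>2 * \<eta>\<^sub>2 s t"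
    by (intro mult_left_mono) auto
  then show ?thesis
    using e by (simp add: dyadic_step h_def[symmetric] hp sum_distrib_left mult_ac power_mult_distrib weight_square)
qed

text \<open>One refinement step. The cells of the \<open>k\<close>-th partition have length \<open>(t - s) / 2 ^ k\<close>. In the square
  sum, squaring the moment bound produces one full power of this length, which completes the
  midpoint sum for \<open>\<eta>\<^sub>2\<close> and leaves the power \<open>2 * \<epsilon>\<^sub>2\<close> as a gain.\<close>
lemma refinement_bound:
  assumes Z: "dual_weight M (F S) m n Z"
  shows "Lm_bound (density M (\<lambda>\<omega>. ennreal (Z \<omega>))) m (\<lambda>\<omega>. U k \<omega> - U (Suc k) \<omega>)
      (4 * sqrt (taylor_const m) * \<Gamma>\<^sub>2 * sqrt (\<eta>\<^sub>2 s t) * ((t - s) / 2 ^ k) powr \<epsilon>\<^sub>2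
        + \<Gamma>\<^sub>1 * \<eta>\<^sub>1 s t * ((t - s) / 2 ^ k) powr \<epsilon>\<^sub>1)" (is ?th1)
    and "Lm_bound (density M (\<lambda>\<omega>. ennreal (Z \<omega>))) m (real_cond_exp M (F S) (\<lambda>\<omega>. U k \<omega> - U (Suc k) \<omega>))
      (\<Gamma>\<^sub>1 * \<eta>\<^sub>1 s t * ((t - s) / 2 ^ k) powr \<epsilon>\<^sub>1)" (is ?th2)
proof -
  obtain B where B: "\<And>\<omega>. Z \<omega> \<le> B" using Z unfolding dual_weight_def by blast
  note Zm = dual_weight_measurable[OF FS Z]
  let ?Q = "density M (\<lambda>\<omega>. ennreal (Z \<omega>))"
  let ?u = "\<lambda>i. (D k i + D k (Suc i)) / 2"
  define a where "a = (\<lambda>i. \<Gamma>\<^sub>1 * weight S T \<alpha>\<^sub>1 \<beta>\<^sub>1 (?u i) * (D k (Suc i) - D k i) powr (1 + \<epsilon>\<^sub>1))"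
  define b where "b = (\<lambda>i. \<Gamma>\<^sub>2 * weight S T \<alpha>\<^sub>2 \<beta>\<^sub>2 (?u i) * (D k (Suc i) - D k i) powr (1 / 2 + \<epsilon>\<^sub>2))"
  let ?X = "dyadic_increment A s t k"
  have ab0: "0 \<le> a i" "0 \<le> b i" for i using Gamma by (auto simp: a_def b_def)
  have H: "subalgebra M (F (D k i))" "subalgebra (F (D k i)) (F S)" if "i \<le> 2 ^ k" for i
    using D_range[OF that] by (auto intro: subalgebra_M subalgebra_F)
  have HH: "subalgebra (F (D k j)) (F (D k i))" if "i \<le> j" "j \<le> 2 ^ k" for i j
    using D_range[of i k] D_range[of j k] that st by (intro subalgebra_F dyadic_mono) auto
  have r: "S \<le> D k i" "D k i \<le> ?u i" "?u i \<le> D k (Suc i)" "D k (Suc i) \<le> T" "D k i \<le> D k (Suc i)" if "i < 2 ^ k" for i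
    using D_range[of i k] D_range[of "Suc i" k] that dyadic_less_Suc[OF st(2), of k i] by auto
  have X: "in_Lm M m (?X i)" "?X i \<in> borel_measurable (F (D k (Suc i)))" if "i < 2 ^ k" for i
    unfolding dyadic_increment_def using r[OF that] by (auto intro: increment_in_Lm increment_adapted)
  have a: "Lm_bound ?Q m (real_cond_exp M (F (D k i)) (?X i)) (a i)" if "i < 2 ^ k" for i
    unfolding a_def dyadic_increment_def using r[OF that] by (intro cond_exp_increment_bound[OF Z]) auto
  have b: "Lm_bound ?Q m (?X i) (b i)" if "i < 2 ^ k" for i
    unfolding b_def dyadic_increment_def using r[OF that] by (intro increment_bound[OF Z]) auto
  have sa: "(\<Sum>i<2 ^ k. a i) \<le> \<Gamma>\<^sub>1 * \<eta>\<^sub>1 s t * ((t - s) / 2 ^ k) powr \<epsilon>\<^sub>1"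
    unfolding a_def by (rule sum_cond_exp_bounds_le)
  have sa0: "0 \<le> (\<Sum>i<2 ^ k. a i)" using ab0 by (auto intro: sum_nonneg)
  have c: "0 \<le> taylor_const m" using taylor_const_ge_1[OF m] by simp
  have e: "0 \<le> \<eta>\<^sub>2 s t" using w2.eta_nonneg st by simp
  have sb: "sqrt (16 * taylor_const m * (\<Sum>i<2 ^ k. (b i)\<^sup>2))
      \<le> 4 * sqrt (taylor_const m) * \<Gamma>\<^sub>2 * sqrt (\<eta>\<^sub>2 s t) * ((t - s) / 2 ^ k) powr \<epsilon>\<^sub>2"
  proof -
    have "16 * taylor_const m * (\<Sum>i<2 ^ k. (b i)\<^sup>2)
        \<le> (4 * sqrt (taylor_const m))\<^sup>2 * (\<Gamma>\<^sub>2 * sqrt (\<eta>\<^sub>2 s t) * ((t - s) / 2 ^ k) powr \<epsilon>\<^sub>2)\<^sup>2"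
      using c sum_squared_bounds_le[of k] unfolding b_def
      by (intro mult_mono) (auto simp: power_mult_distrib intro!: sum_nonneg)
    then have "sqrt (16 * taylor_const m * (\<Sum>i<2 ^ k. (b i)\<^sup>2))
        \<le> \<bar>4 * sqrt (taylor_const m) * (\<Gamma>\<^sub>2 * sqrt (\<eta>\<^sub>2 s t) * ((t - s) / 2 ^ k) powr \<epsilon>\<^sub>2)\<bar>"
      unfolding power_mult_distrib[symmetric] real_sqrt_abs[symmetric] by (rule real_sqrt_le_mono)
    then show ?thesis using c Gamma e by (simp add: mult.assoc)
  qed
  have sb0: "0 \<le> sqrt (16 * taylor_const m * (\<Sum>i<2 ^ k. (b i)\<^sup>2))"
    using c by (auto intro!: mult_nonneg_nonneg sum_nonneg)
  have "Lm_bound ?Q m (\<lambda>\<omega>. \<Sum>i<2 ^ k. ?X i \<omega>)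
      (sqrt (16 * taylor_const m * (\<Sum>i<2 ^ k. (b i)\<^sup>2)) + (\<Sum>i<2 ^ k. a i))"
    by (rule sum_martingale_bound[OF m FS Zm(1) Zm(3) B, where H = "\<lambda>i. F (D k i)"])
       (use H HH X a b ab0 in auto)
  then show ?th1
    unfolding dyadic_sum_refine by (rule Lm_bound_mono) (use sa sb sa0 sb0 m in auto)
  have "Lm_bound ?Q m (real_cond_exp M (F S) (\<lambda>\<omega>. \<Sum>i<2 ^ k. ?X i \<omega>)) (\<Sum>i<2 ^ k. a i)"
    by (rule sum_cond_exp_bound[OF m1 FS Zm(1) Zm(3), where H = "\<lambda>i. F (D k i)"])
       (use H X a ab0 in auto)
  then show ?th2
    unfolding dyadic_sum_refine by (rule Lm_bound_mono) (use sa sa0 m in auto)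
qed

text \<open>The sums over all levels of the two contributions to \<open>refinement_bound\<close>: that of the
  conditional expectations and that of the martingale differences.\<close>
definition drift_bound :: real where "drift_bound = geom_const \<epsilon>\<^sub>1 * \<Gamma>\<^sub>1 * \<eta>\<^sub>1 s t * (t - s) powr \<epsilon>\<^sub>1"
definition fluctuation_bound :: real where "fluctuation_bound = geom_const \<epsilon>\<^sub>2 * 4 * sqrt (taylor_const m) * \<Gamma>\<^sub>2 * sqrt (\<eta>\<^sub>2 s t) * (t - s) powr \<epsilon>\<^sub>2"

lemma drift_bound_nonneg: "0 \<le> drift_bound"
  using geom_pos[of \<epsilon>\<^sub>1] exponents Gamma w1.eta_nonneg[of s t] st by (simp add: drift_bound_def)

lemma fluctuation_bound_nonneg: "0 \<le> fluctuation_bound"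
  using geom_pos[of \<epsilon>\<^sub>2] exponents Gamma w2.eta_nonneg[of s t] st taylor_const_ge_1[OF m] by (simp add: fluctuation_bound_def)

lemma sum_refinement_bounds:
  "(\<Sum>j<l. \<Gamma>\<^sub>1 * \<eta>\<^sub>1 s t * ((t - s) / 2 ^ (k + j)) powr \<epsilon>\<^sub>1) \<le> drift_bound * (2 powr (-\<epsilon>\<^sub>1)) ^ k"
  "(\<Sum>j<l. 4 * sqrt (taylor_const m) * \<Gamma>\<^sub>2 * sqrt (\<eta>\<^sub>2 s t) * ((t - s) / 2 ^ (k + j)) powr \<epsilon>\<^sub>2)
    \<le> fluctuation_bound * (2 powr (-\<epsilon>\<^sub>2)) ^ k"
proof -
  have *: "(\<Sum>j<l. c * ((t - s) / 2 ^ (k + j)) powr \<epsilon>) \<le> geom_const \<epsilon> * c * (t - s) powr \<epsilon> * (2 powr (-\<epsilon>)) ^ k"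
    if "\<epsilon> > 0" "c \<ge> 0" for c \<epsilon>
  proof -
    have "c * (t - s) powr \<epsilon> * (\<Sum>j<l. (2 powr (-\<epsilon>)) ^ (k + j))
       \<le> c * (t - s) powr \<epsilon> * (geom_const \<epsilon> * (2 powr (-\<epsilon>)) ^ k)"
      using that by (intro mult_left_mono sum_geom_le) auto
    then show ?thesis using st by (simp add: dyadic_mesh_powr sum_distrib_left mult_ac)
  qed
  show "(\<Sum>j<l. \<Gamma>\<^sub>1 * \<eta>\<^sub>1 s t * ((t - s) / 2 ^ (k + j)) powr \<epsilon>\<^sub>1) \<le> drift_bound * (2 powr (-\<epsilon>\<^sub>1)) ^ k"
    using *[of \<epsilon>\<^sub>1 "\<Gamma>\<^sub>1 * \<eta>\<^sub>1 s t"] exponents Gamma w1.eta_nonneg[of s t] st by (simp add: drift_bound_def mult_ac)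
  show "(\<Sum>j<l. 4 * sqrt (taylor_const m) * \<Gamma>\<^sub>2 * sqrt (\<eta>\<^sub>2 s t) * ((t - s) / 2 ^ (k + j)) powr \<epsilon>\<^sub>2)
    \<le> fluctuation_bound * (2 powr (-\<epsilon>\<^sub>2)) ^ k"
    using *[of \<epsilon>\<^sub>2 "4 * sqrt (taylor_const m) * \<Gamma>\<^sub>2 * sqrt (\<eta>\<^sub>2 s t)"] exponents Gamma w2.eta_nonneg[of s t] st
      taylor_const_ge_1[OF m]
    by (simp add: fluctuation_bound_def mult_ac)
qed

lemma U_telescope: "U k \<omega> - U (k + l) \<omega> = (\<Sum>j<l. U (k + j) \<omega> - U (Suc (k + j)) \<omega>)"
  by (induction l) auto

lemma cauchy_bound:
  assumes Z: "dual_weight M (F S) m n Z"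
  shows "Lm_bound (density M (\<lambda>\<omega>. ennreal (Z \<omega>))) m (\<lambda>\<omega>. U k \<omega> - U (k + l) \<omega>)
     (fluctuation_bound * (2 powr (-\<epsilon>\<^sub>2)) ^ k + drift_bound * (2 powr (-\<epsilon>\<^sub>1)) ^ k)" (is ?th1)
    and "Lm_bound (density M (\<lambda>\<omega>. ennreal (Z \<omega>))) m (real_cond_exp M (F S) (\<lambda>\<omega>. U k \<omega> - U (k + l) \<omega>))
     (drift_bound * (2 powr (-\<epsilon>\<^sub>1)) ^ k)" (is ?th2)
proof -
  let ?Q = "density M (\<lambda>\<omega>. ennreal (Z \<omega>))"
  let ?b1 = "\<lambda>j. \<Gamma>\<^sub>1 * \<eta>\<^sub>1 s t * ((t - s) / 2 ^ (k + j)) powr \<epsilon>\<^sub>1"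
  let ?b2 = "\<lambda>j. 4 * sqrt (taylor_const m) * \<Gamma>\<^sub>2 * sqrt (\<eta>\<^sub>2 s t) * ((t - s) / 2 ^ (k + j)) powr \<epsilon>\<^sub>2"
  have nonneg: "0 \<le> ?b1 j" "0 \<le> ?b2 j" for j
    using Gamma w1.eta_nonneg[of s t] w2.eta_nonneg[of s t] st taylor_const_ge_1[OF m] by auto
  have Um: "U j \<in> borel_measurable M" for j by (rule in_Lm_measurable[OF U_in_Lm])
  have Dm: "in_Lm M m (\<lambda>\<omega>. U i \<omega> - U j \<omega>)" for i j by (intro in_Lm_diff m1 U_in_Lm)
  have "Lm_bound ?Q m (\<lambda>\<omega>. \<Sum>j<l. U (k + j) \<omega> - U (Suc (k + j)) \<omega>) (\<Sum>j<l. ?b2 j + ?b1 j)"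
    using nonneg Um by (intro Lm_bound_sum m1 refinement_bound[OF Z]) auto
  then show ?th1
    unfolding U_telescope sum.distrib
    by (rule Lm_bound_mono) (use nonneg m sum_refinement_bounds[where k = k and l = l] in \<open>auto intro!: add_mono add_nonneg_nonneg sum_nonneg\<close>)
  have "AE \<omega> in M. real_cond_exp M (F S) (\<lambda>\<omega>. \<Sum>j<l. U (k + j) \<omega> - U (Suc (k + j)) \<omega>) \<omega>
     = (\<Sum>j<l. real_cond_exp M (F S) (\<lambda>\<omega>. U (k + j) \<omega> - U (Suc (k + j)) \<omega>) \<omega>)"
    by (intro real_cond_exp_sum_finite sigma_finite_subalgebraI FS in_Lm_integrable[OF m1] Dm)
  then have eq: "AE \<omega> in ?Q. real_cond_exp M (F S) (\<lambda>\<omega>. \<Sum>j<l. U (k + j) \<omega> - U (Suc (k + j)) \<omega>) \<omega>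
     = (\<Sum>j<l. real_cond_exp M (F S) (\<lambda>\<omega>. U (k + j) \<omega> - U (Suc (k + j)) \<omega>) \<omega>)"
    using dual_weight_measurable[OF FS Z] by (subst AE_density) auto
  have "Lm_bound ?Q m (\<lambda>\<omega>. \<Sum>j<l. real_cond_exp M (F S) (\<lambda>\<omega>. U (k + j) \<omega> - U (Suc (k + j)) \<omega>) \<omega>) (\<Sum>j<l. ?b1 j)"
    using nonneg by (intro Lm_bound_sum m1 refinement_bound[OF Z]) auto
  then have "Lm_bound ?Q m (real_cond_exp M (F S) (\<lambda>\<omega>. \<Sum>j<l. U (k + j) \<omega> - U (Suc (k + j)) \<omega>)) (\<Sum>j<l. ?b1 j)"
    using Lm_bound_cong_AE[OF eq] by blast
  then show ?th2
    unfolding U_telescope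
    by (rule Lm_bound_mono) (use nonneg m sum_refinement_bounds(1)[where k = k and l = l] in \<open>auto intro!: sum_nonneg\<close>)
qed

text \<open>The differences telescope from any level \<open>k\<close>, so the tails of the geometric series bound \<open>U k - Y\<close>
  in \<open>L\<^sub>m\<close> of the weighted measure. Level \<open>0\<close> is the first estimate; the vanishing of the tails is what the second estimate needs.\<close>
lemma sewing_limit:
  assumes Y: "Y \<in> borel_measurable M" and lim: "tendsto_in_prob M U Y"
  shows "in_Lm M m Y"
    and "dual_weight M (F S) m n Z \<Longrightarrow>
      Lm_bound (density M (\<lambda>\<omega>. ennreal (Z \<omega>))) m (\<lambda>\<omega>. A s t \<omega> - Y \<omega>) (fluctuation_bound + drift_bound)"
    and "dual_weight M (F S) m n Z \<Longrightarrow>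
      Lm_bound (density M (\<lambda>\<omega>. ennreal (Z \<omega>))) m (real_cond_exp M (F S) (\<lambda>\<omega>. A s t \<omega> - Y \<omega>)) drift_bound"
proof -
  let ?r = "\<lambda>k. fluctuation_bound * (2 powr (-\<epsilon>\<^sub>2)) ^ k + drift_bound * (2 powr (-\<epsilon>\<^sub>1)) ^ k"
  note Um[measurable] = in_Lm_measurable[OF U_in_Lm]
  have tail: "Lm_bound (density M (\<lambda>\<omega>. ennreal (Z \<omega>))) m (\<lambda>\<omega>. U k \<omega> - Y \<omega>) (?r k)"
    if Z: "dual_weight M (F S) m n Z" for Z k
    by (rule Lm_bound_limit_in_prob[OF m1 dual_weight_measurable(2)[OF FS Z] Um Y lim cauchy_bound(1)[OF Z]])
  then show main: "Lm_bound (density M (\<lambda>\<omega>. ennreal (Z \<omega>))) m (\<lambda>\<omega>. A s t \<omega> - Y \<omega>) (fluctuation_bound + drift_bound)"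
    if Z: "dual_weight M (F S) m n Z" for Z
    using tail[OF Z, of 0] by simp
  \<comment> \<open>the constant dual weight gives \<open>m\<close>-th moments of \<open>Y\<close> under \<open>M\<close>, without which its conditional expectation would have no meaning\<close>
  have half: "dual_weight M (F S) m n (\<lambda>_. 1 / 2)"
    using m mn by (intro dual_weight_half FS) auto
  show YL: "in_Lm M m Y"
  proof -
    have AY[measurable]: "(\<lambda>\<omega>. A s t \<omega> - Y \<omega>) \<in> borel_measurable M" using Um[of 0] Y by simp
    have "(\<integral>\<^sup>+\<omega>. ennreal (1 / 2) * ennreal (\<bar>A s t \<omega> - Y \<omega>\<bar> powr m) \<partial>M) \<le> ennreal ((fluctuation_bound + drift_bound) powr m)"
      using main[OF half] unfolding Lm_bound_density[OF dual_weight_measurable(2)[OF FS half] AY] .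
    also have "(\<integral>\<^sup>+\<omega>. ennreal (1 / 2) * ennreal (\<bar>A s t \<omega> - Y \<omega>\<bar> powr m) \<partial>M)
        = (\<integral>\<^sup>+\<omega>. ennreal (1 / 2 * \<bar>A s t \<omega> - Y \<omega>\<bar> powr m) \<partial>M)"
      by (intro nn_integral_cong ennreal_mult[symmetric]) auto
    finally have "(\<integral>\<^sup>+\<omega>. ennreal (1 / 2 * \<bar>A s t \<omega> - Y \<omega>\<bar> powr m) \<partial>M) < \<infinity>"
      using le_less_trans[OF _ ennreal_less_top] by (simp only: infinity_ennreal_def)
    then have "integrable M (\<lambda>\<omega>. 1 / 2 * \<bar>A s t \<omega> - Y \<omega>\<bar> powr m)"
      by (intro integrableI_bounded) auto
    from integrable_mult_right[OF this, of 2] have "integrable M (\<lambda>\<omega>. \<bar>A s t \<omega> - Y \<omega>\<bar> powr m)" by simp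
    then have "in_Lm M m (\<lambda>\<omega>. A s t \<omega> - Y \<omega>)"
      using m AY by (subst in_Lm_iff_integrable) auto
    from in_Lm_diff[OF m1 U_in_Lm[of 0] this] show ?thesis by simp
  qed
  show "Lm_bound (density M (\<lambda>\<omega>. ennreal (Z \<omega>))) m (real_cond_exp M (F S) (\<lambda>\<omega>. A s t \<omega> - Y \<omega>)) drift_bound"
    if Z: "dual_weight M (F S) m n Z" for Z
  proof -
    note Zm = dual_weight_measurable[OF FS Z]
    have "?r \<longlonglongrightarrow> fluctuation_bound * 0 + drift_bound * 0"
      using geom_ratio[of \<epsilon>\<^sub>1] geom_ratio[of \<epsilon>\<^sub>2] exponents
      by (intro tendsto_add tendsto_mult tendsto_const LIMSEQ_power_zero) auto
    then have r0: "?r \<longlonglongrightarrow> 0" by simp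
    have "Lm_bound (density M (\<lambda>\<omega>. ennreal (Z \<omega>))) m (real_cond_exp M (F S) (\<lambda>\<omega>. U 0 \<omega> - Y \<omega>)) drift_bound"
    proof (rule Lm_bound_cond_exp_limit[OF m1 FS Zm(1) Zm(3) U_in_Lm YL tail[OF Z] _ r0 _ drift_bound_nonneg])
      show "0 \<le> ?r k" for k using drift_bound_nonneg fluctuation_bound_nonneg by simp
      show "Lm_bound (density M (\<lambda>\<omega>. ennreal (Z \<omega>))) m (real_cond_exp M (F S) (\<lambda>\<omega>. U 0 \<omega> - U k \<omega>)) drift_bound" for k
        using cauchy_bound(2)[OF Z, of 0 k] by simp
    qed
    then show ?thesis by simp
  qed
qed

end

text \<open>Both claims for any limit \<open>Y\<close> of the dyadic sums. The factor \<open>2\<close> is the loss in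
  the duality for the norm.\<close>
lemma nondegenerate_estimates:
  assumes st: "S \<le> s" "s < t" "t \<le> T" and Y: "Y \<in> borel_measurable M"
    and lim: "tendsto_in_prob M (dyadic_sum A s t) Y"
  shows "Ln_norm M n (cond_Lm_norm M (F S) m (\<lambda>\<omega>. Y \<omega> - A s t \<omega>))
      \<le> ennreal (2 * (geom_const \<epsilon>\<^sub>2 * 4 * sqrt (taylor_const m) * \<Gamma>\<^sub>2 * sqrt (\<eta>\<^sub>2 s t) * (t - s) powr \<epsilon>\<^sub>2
           + geom_const \<epsilon>\<^sub>1 * \<Gamma>\<^sub>1 * \<eta>\<^sub>1 s t * (t - s) powr \<epsilon>\<^sub>1))" (is ?th1)
    and "Ln_norm M n (\<lambda>\<omega>. ennreal \<bar>real_cond_exp M (F S) (\<lambda>\<omega>. Y \<omega> - A s t \<omega>) \<omega>\<bar>)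
      \<le> ennreal (2 * (geom_const \<epsilon>\<^sub>1 * \<Gamma>\<^sub>1 * \<eta>\<^sub>1 s t * (t - s) powr \<epsilon>\<^sub>1))" (is ?th2)
proof -
  note L = sewing_limit[OF st Y lim]
  have AL: "in_Lm M m (A s t)" using A_Lm st by simp
  have AYL: "in_Lm M m (\<lambda>\<omega>. A s t \<omega> - Y \<omega>)" by (intro in_Lm_diff m1 AL L)
  have neg: "(\<lambda>\<omega>. Y \<omega> - A s t \<omega>) = (\<lambda>\<omega>. - (A s t \<omega> - Y \<omega>))" by simp
  have "Ln_norm M n (cond_Lm_norm M (F S) m (\<lambda>\<omega>. Y \<omega> - A s t \<omega>)) \<le> ennreal (2 * (fluctuation_bound s t + drift_bound s t))"
    unfolding neg using in_Lm_measurable[OF AYL] drift_bound_nonneg[OF st] fluctuation_bound_nonneg[OF st] L(2)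
    by (intro cond_Lm_norm_le m1 mn FS) (auto simp: Lm_bound_uminus simp del: minus_diff_eq)
  then show ?th1 by (simp add: drift_bound_def[OF st] fluctuation_bound_def[OF st])
  interpret G: sigma_finite_subalgebra M "F S" by (rule sigma_finite_subalgebraI[OF FS])
  have "Ln_norm M n (\<lambda>\<omega>. ennreal \<bar>real_cond_exp M (F S) (\<lambda>\<omega>. Y \<omega> - A s t \<omega>) \<omega>\<bar>) \<le> ennreal (2 * drift_bound s t)"
  proof (rule Ln_norm_le_of_Lm_bound[OF m1 mn FS drift_bound_nonneg[OF st]])
    fix Z assume Z: "dual_weight M (F S) m n Z"
    let ?Q = "density M (\<lambda>\<omega>. ennreal (Z \<omega>))"
    have "AE \<omega> in M. real_cond_exp M (F S) (\<lambda>\<omega>. (- 1) * (A s t \<omega> - Y \<omega>)) \<omega>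
        = (- 1) * real_cond_exp M (F S) (\<lambda>\<omega>. A s t \<omega> - Y \<omega>) \<omega>"
      by (rule G.real_cond_exp_cmult) (rule in_Lm_integrable[OF m1 AYL])
    then have eq: "AE \<omega> in ?Q. real_cond_exp M (F S) (\<lambda>\<omega>. Y \<omega> - A s t \<omega>) \<omega>
        = - real_cond_exp M (F S) (\<lambda>\<omega>. A s t \<omega> - Y \<omega>) \<omega>"
      using dual_weight_measurable[OF FS Z] by (subst AE_density) auto
    show "Lm_bound ?Q m (real_cond_exp M (F S) (\<lambda>\<omega>. Y \<omega> - A s t \<omega>)) (drift_bound s t)"
      using L(3)[OF Z] unfolding Lm_bound_cong_AE[OF eq] Lm_bound_uminus .
  qed simp
  then show ?th2 by (simp add: drift_bound_def[OF st])
qed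

text \<open>For \<open>s = t\<close> the dyadic points are not strictly increasing, but \<open>\<delta>A = - A s s\<close>, and the assumed bounds with
  \<open>\<bar>t - s\<bar> = 0\<close> force it to vanish almost surely.\<close>
lemma degenerate_estimates:
  assumes s: "S \<le> s" "s \<le> T"
  shows "Ln_norm M n (cond_Lm_norm M (F S) m (\<lambda>\<omega>. - A s s \<omega>)) = 0"
    and "Ln_norm M n (\<lambda>\<omega>. ennreal \<bar>real_cond_exp M (F S) (\<lambda>\<omega>. - A s s \<omega>) \<omega>\<bar>) = 0"
proof -
  have inc: "increment A s ((s + s) / 2) s = (\<lambda>\<omega>. - A s s \<omega>)" by (simp add: increment_def)
  show "Ln_norm M n (cond_Lm_norm M (F S) m (\<lambda>\<omega>. - A s s \<omega>)) = 0"
    using cond_norm_increment[of s s] s inc by simp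
  have L: "in_Lm M m (\<lambda>\<omega>. - A s s \<omega>)"
    using increment_in_Lm[of s s s] s inc by simp
  have "Ln_norm M n (\<lambda>\<omega>. ennreal \<bar>real_cond_exp M (F S) (\<lambda>\<omega>. - A s s \<omega>) \<omega>\<bar>) \<le> ennreal (2 * 0)"
  proof (rule Ln_norm_le_of_Lm_bound[OF m1 mn FS order_refl])
    fix Z assume Z: "dual_weight M (F S) m n Z"
    note Zm = dual_weight_measurable[OF FS Z]
    have "Lm_bound (density M (\<lambda>\<omega>. ennreal (Z \<omega>))) m (\<lambda>\<omega>. - A s s \<omega>) 0"
      using increment_bound[OF Z, of s s] s inc by simp
    then show "Lm_bound (density M (\<lambda>\<omega>. ennreal (Z \<omega>))) m (real_cond_exp M (F S) (\<lambda>\<omega>. - A s s \<omega>)) 0"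
      by (rule cond_exp_contraction[OF m1 FS Zm(1) Zm(3) L])
  qed simp
  then show "Ln_norm M n (\<lambda>\<omega>. ennreal \<bar>real_cond_exp M (F S) (\<lambda>\<omega>. - A s s \<omega>) \<omega>\<bar>) = 0" by simp
qed

end

section \<open>Dyadic sums along partitions\<close>


lemma mesh_le:
  assumes "\<And>i. i < k \<Longrightarrow> p (Suc i) - p i \<le> d" "d \<ge> 0"
  shows "mesh k p \<le> d" "0 \<le> mesh k p"
proof -
  have fin: "finite (insert 0 ((\<lambda>i. p (Suc i) - p i) ` {..<k}))" by simp
  show "mesh k p \<le> d" unfolding mesh_def using assms by (subst Max_le_iff[OF fin]) auto
  show "0 \<le> mesh k p" unfolding mesh_def by (rule Max_ge[OF fin]) simp
qed

text \<open>The assumption speaks of partitions of \<open>[S, t]\<close> only. The dyadic partition of \<open>[s, t]\<close> is completed by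
  the one of \<open>[S, s]\<close>, and the sums over \<open>[S, s]\<close>, which tend to \<open>\<A> s\<close>, are subtracted. For
  \<open>s = S\<close> the initial piece has no cells, since a partition is strictly increasing.\<close>
lemma dyadic_sums_tendsto_in_prob:
  fixes A :: "real \<Rightarrow> real \<Rightarrow> 'a \<Rightarrow> real" and \<A> :: "real \<Rightarrow> 'a \<Rightarrow> real"
  assumes "prob_space M" and st: "S \<le> s" "s < t" "t \<le> T"
    and A: "\<And>s t. S \<le> s \<Longrightarrow> s \<le> t \<Longrightarrow> t \<le> T \<Longrightarrow> A s t \<in> borel_measurable M"
    and meas: "\<And>t. S \<le> t \<Longrightarrow> t \<le> T \<Longrightarrow> \<A> t \<in> borel_measurable M"
    and lim: "\<And>t k \<pi>. S \<le> t \<Longrightarrow> t \<le> T \<Longrightarrow> (\<And>N. is_partition S t (k N) (\<pi> N)) \<Longrightarrow>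
        (\<lambda>N. mesh (k N) (\<pi> N)) \<longlonglongrightarrow> 0 \<Longrightarrow>
        tendsto_in_prob M (\<lambda>N \<omega>. \<Sum>i<k N. A (\<pi> N i) (\<pi> N (Suc i)) \<omega>) (\<A> t)"
  shows "tendsto_in_prob M (dyadic_sum A s t) (\<lambda>\<omega>. \<A> t \<omega> - \<A> s \<omega>)"
proof -
  interpret prob_space M by fact
  \<comment> \<open>\<open>k N\<close> is the number of cells in \<open>[S, s]\<close>\<close>
  define k where "k = (\<lambda>N. if S < s then 2 ^ N else 0 :: nat)"
  define p where "p = (\<lambda>N i. if i \<le> k N then dyadic S s N i else dyadic s t N (i - k N))"
  have pk: "dyadic S s N (k N) = s" for N using st by (auto simp: k_def)
  have p_first: "p N i = dyadic S s N i" if "i \<le> k N" for N i using that by (simp add: p_def)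
  have p_second: "p N (k N + i) = dyadic s t N i" for N i using pk by (cases "i = 0") (auto simp: p_def)
  have kpos: "S < s" if "i < k N" for i N using that by (auto simp: k_def split: if_splits)
  have d: "(s - S) / 2 ^ N \<le> (T - S) / 2 ^ N" "(t - s) / 2 ^ N \<le> (T - S) / 2 ^ N" for N
    using st by (auto intro!: divide_right_mono)
  have null: "(\<lambda>N. (T - S) / 2 ^ N) \<longlonglongrightarrow> 0"
  proof -
    have "(\<lambda>N. (T - S) * (1 / 2) ^ N) \<longlonglongrightarrow> (T - S) * 0"
      by (intro tendsto_mult tendsto_const LIMSEQ_power_zero) simp
    moreover have "(T - S) * (1 / 2) ^ N = (T - S) / 2 ^ N" for N by (simp add: power_divide)
    ultimately show ?thesis by simp
  qed
  have mesh_null: "(\<lambda>N. mesh (l N) (q N)) \<longlonglongrightarrow> 0"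
    if "\<And>N i. i < l N \<Longrightarrow> q N (Suc i) - q N i \<le> (T - S) / 2 ^ N" for l q
  proof (rule tendsto_sandwich[OF _ _ tendsto_const null])
    have "0 \<le> (T - S) / 2 ^ N" for N using st by simp
    then have "0 \<le> mesh (l N) (q N)" "mesh (l N) (q N) \<le> (T - S) / 2 ^ N" for N
      using that by (auto intro!: mesh_le[of "l N" "q N" "(T - S) / 2 ^ N"])
    then show "eventually (\<lambda>N. 0 \<le> mesh (l N) (q N)) sequentially"
      "eventually (\<lambda>N. mesh (l N) (q N) \<le> (T - S) / 2 ^ N) sequentially"
      by simp_all
  qed
  have first: "tendsto_in_prob M (\<lambda>N \<omega>. \<Sum>i<k N. A (dyadic S s N i) (dyadic S s N (Suc i)) \<omega>) (\<A> s)"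
  proof (rule lim)
    show "is_partition S s (k N) (dyadic S s N)" for N
      using pk kpos by (auto simp: is_partition_def intro: dyadic_less_Suc)
    show "(\<lambda>N. mesh (k N) (dyadic S s N)) \<longlonglongrightarrow> 0"
      using d by (intro mesh_null) (simp add: dyadic_step)
  qed (use st in auto)
  have second: "tendsto_in_prob M (\<lambda>N \<omega>. \<Sum>i<k N + 2 ^ N. A (p N i) (p N (Suc i)) \<omega>) (\<A> t)"
  proof (rule lim)
    have split: "p N (Suc i) = dyadic S s N (Suc i) \<and> p N i = dyadic S s N i \<and> S < s
        \<or> (\<exists>j<2 ^ N. p N (Suc i) = dyadic s t N (Suc j) \<and> p N i = dyadic s t N j)"
      if "i < k N + 2 ^ N" for N i
    proof (cases "i < k N")
      case True
      then show ?thesis using p_first[of i N] p_first[of "Suc i" N] kpos by auto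
    next
      case False
      define j where "j = i - k N"
      have "i = k N + j" "j < 2 ^ N" using False that by (auto simp: j_def)
      then show ?thesis using p_second[of N j] p_second[of N "Suc j"] by auto
    qed
    show "is_partition S t (k N + 2 ^ N) (p N)" for N
      unfolding is_partition_def
    proof (intro conjI allI impI)
      show "p N 0 = S" using p_first[of 0 N] by simp
      show "p N (k N + 2 ^ N) = t" unfolding p_second by simp
      show "p N i < p N (Suc i)" if "i < k N + 2 ^ N" for i
        using split[OF that] st by (auto intro: dyadic_less_Suc)
    qed
    show "(\<lambda>N. mesh (k N + 2 ^ N) (p N)) \<longlonglongrightarrow> 0"
    proof (rule mesh_null)
      fix N i assume "i < k N + 2 ^ N"
      from split[OF this] show "p N (Suc i) - p N i \<le> (T - S) / 2 ^ N"
        using d by (auto simp: dyadic_step)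
    qed
  qed (use st in auto)
  have sum_add: "(\<Sum>i<a + b. f i) = (\<Sum>i<a. f i) + (\<Sum>i<b. f (a + i))" for f :: "nat \<Rightarrow> real" and a b
    by (induction b) auto
  have "(\<Sum>i<k N + 2 ^ N. A (p N i) (p N (Suc i)) \<omega>)
      = (\<Sum>i<k N. A (dyadic S s N i) (dyadic S s N (Suc i)) \<omega>) + dyadic_sum A s t N \<omega>" for N \<omega>
  proof -
    have "(\<Sum>i<k N + 2 ^ N. A (p N i) (p N (Suc i)) \<omega>)
      = (\<Sum>i<k N. A (p N i) (p N (Suc i)) \<omega>) + (\<Sum>i<2 ^ N. A (p N (k N + i)) (p N (k N + Suc i)) \<omega>)"
      using sum_add[of "\<lambda>i. A (p N i) (p N (Suc i)) \<omega>" "k N" "2 ^ N"] by simp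
    then show ?thesis unfolding p_second dyadic_sum_def by (simp add: p_first)
  qed
  then have eq: "dyadic_sum A s t = (\<lambda>N \<omega>. (\<Sum>i<k N + 2 ^ N. A (p N i) (p N (Suc i)) \<omega>)
      - (\<Sum>i<k N. A (dyadic S s N i) (dyadic S s N (Suc i)) \<omega>))"
    by (intro ext) simp
  have m1: "(\<lambda>\<omega>. \<Sum>i<k N. A (dyadic S s N i) (dyadic S s N (Suc i)) \<omega>) \<in> borel_measurable M" for N
  proof (intro borel_measurable_sum A)
    fix i assume "i \<in> {..<k N}"
    then have i: "i < k N" "S < s" using kpos[of i N] by simp_all
    then have iN: "Suc i \<le> 2 ^ N" by (simp add: k_def)
    then show "S \<le> dyadic S s N i" "dyadic S s N i \<le> dyadic S s N (Suc i)" "dyadic S s N (Suc i) \<le> T"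
      using st i iN dyadic_range[of S s i N] dyadic_range[of S s "Suc i" N] dyadic_mono[of S s i "Suc i" N] by auto
  qed
  have m2: "dyadic_sum A s t N \<in> borel_measurable M" for N
    unfolding dyadic_sum_def
  proof (intro borel_measurable_sum A)
    fix i :: nat assume "i \<in> {..<2 ^ N}"
    then show "S \<le> dyadic s t N i" "dyadic s t N i \<le> dyadic s t N (Suc i)" "dyadic s t N (Suc i) \<le> T"
      using st dyadic_range[of s t i N] dyadic_range[of s t "Suc i" N] dyadic_mono[of s t i "Suc i" N] by auto
  qed
  have m3: "(\<lambda>\<omega>. \<Sum>i<k N + 2 ^ N. A (p N i) (p N (Suc i)) \<omega>) \<in> borel_measurable M" for N
  proof -
    have "(\<lambda>\<omega>. dyadic_sum A s t N \<omega> + (\<Sum>i<k N. A (dyadic S s N i) (dyadic S s N (Suc i)) \<omega>)) \<in> borel_measurable M"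
      using m1 m2 by (rule borel_measurable_add[rotated])
    then show ?thesis by (simp add: eq)
  qed
  show ?thesis
    unfolding eq using st by (intro tendsto_in_prob_diff m1 m3 meas first second) auto
qed

section \<open>The stochastic sewing lemma\<close>

lemma in_Lm_of_Ln_norm:
  assumes m: "m > 0" and X[measurable]: "X \<in> borel_measurable M"
    and fin: "Ln_norm M (ennreal m) (\<lambda>\<omega>. ennreal \<bar>X \<omega>\<bar>) < \<infinity>"
  shows "in_Lm M m X"
proof -
  define I where "I = (\<integral>\<^sup>+\<omega>. ennreal (\<bar>X \<omega>\<bar> powr m) \<partial>M)"
  have "ennpowr I (1 / m) < \<infinity>" using fin m by (simp add: Ln_norm_ennreal I_def)
  then have "I < \<infinity>" by (cases I) auto
  then have "integrable M (\<lambda>\<omega>. \<bar>X \<omega>\<bar> powr m)"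
    unfolding I_def by (intro integrableI_bounded) auto
  then show ?thesis using m by (simp add: in_Lm_iff_integrable)
qed

lemma (in stochastic_sewing) sewing_estimates:
  assumes st: "S \<le> s" "s \<le> t" "t \<le> T"
    and meas: "\<And>t. S \<le> t \<Longrightarrow> t \<le> T \<Longrightarrow> \<A> t \<in> borel_measurable M"
    and lim: "\<And>t k \<pi>. S \<le> t \<Longrightarrow> t \<le> T \<Longrightarrow> (\<And>N. is_partition S t (k N) (\<pi> N)) \<Longrightarrow>
        (\<lambda>N. mesh (k N) (\<pi> N)) \<longlonglongrightarrow> 0 \<Longrightarrow>
        tendsto_in_prob M (\<lambda>N \<omega>. \<Sum>i<k N. A (\<pi> N i) (\<pi> N (Suc i)) \<omega>) (\<A> t)"
    and C: "8 * geom_const \<epsilon>\<^sub>2 * sqrt (taylor_const m) \<le> C" "2 * geom_const \<epsilon>\<^sub>1 \<le> C"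
  shows "Ln_norm M n (cond_Lm_norm M (F S) m (\<lambda>\<omega>. \<A> t \<omega> - \<A> s \<omega> - A s t \<omega>))
          \<le> ennreal (C * \<Gamma>\<^sub>2 * (\<eta>\<^sub>2 s t) powr (1/2) * \<bar>t - s\<bar> powr \<epsilon>\<^sub>2
                   + C * \<Gamma>\<^sub>1 * \<eta>\<^sub>1 s t * \<bar>t - s\<bar> powr \<epsilon>\<^sub>1)" (is "?L \<le> ennreal (?R2 + ?R1)")
    and "Ln_norm M n (\<lambda>\<omega>. ennreal \<bar>real_cond_exp M (F S) (\<lambda>\<omega>. \<A> t \<omega> - \<A> s \<omega> - A s t \<omega>) \<omega>\<bar>)
          \<le> ennreal (C * \<Gamma>\<^sub>1 * \<eta>\<^sub>1 s t * \<bar>t - s\<bar> powr \<epsilon>\<^sub>1)" (is "?L' \<le> _")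
proof -
  have "?L \<le> ennreal (?R2 + ?R1) \<and> ?L' \<le> ennreal ?R1"
  proof (cases "s = t")
    case True
    then show ?thesis using degenerate_estimates[of s] st by simp
  next
    case False
    then have lt: "s < t" using st by simp
    have AM: "A s t \<in> borel_measurable M" if "S \<le> s" "s \<le> t" "t \<le> T" for s t
      using A_Lm[OF that] by (rule in_Lm_measurable)
    have conv: "tendsto_in_prob M (dyadic_sum A s t) (\<lambda>\<omega>. \<A> t \<omega> - \<A> s \<omega>)"
      by (rule dyadic_sums_tendsto_in_prob[OF prob_space_axioms st(1) lt st(3) AM meas lim])
    have Y: "(\<lambda>\<omega>. \<A> t \<omega> - \<A> s \<omega>) \<in> borel_measurable M"
      using meas[of s] meas[of t] st by simp
    note est = nondegenerate_estimates[OF st(1) lt st(3) Y conv]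
    have e: "0 \<le> \<eta>\<^sub>1 s t" "0 \<le> \<eta>\<^sub>2 s t" using w1.eta_nonneg w2.eta_nonneg st by auto
    have "2 * geom_const \<epsilon>\<^sub>1 * (\<Gamma>\<^sub>1 * \<eta>\<^sub>1 s t * (t - s) powr \<epsilon>\<^sub>1) \<le> C * (\<Gamma>\<^sub>1 * \<eta>\<^sub>1 s t * (t - s) powr \<epsilon>\<^sub>1)"
      using C e Gamma by (intro mult_right_mono) auto
    then have 1: "2 * (geom_const \<epsilon>\<^sub>1 * \<Gamma>\<^sub>1 * \<eta>\<^sub>1 s t * (t - s) powr \<epsilon>\<^sub>1) \<le> ?R1" using lt by (simp add: mult.assoc)
    have "8 * geom_const \<epsilon>\<^sub>2 * sqrt (taylor_const m) * (\<Gamma>\<^sub>2 * sqrt (\<eta>\<^sub>2 s t) * (t - s) powr \<epsilon>\<^sub>2)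
        \<le> C * (\<Gamma>\<^sub>2 * sqrt (\<eta>\<^sub>2 s t) * (t - s) powr \<epsilon>\<^sub>2)"
      using C e Gamma by (intro mult_right_mono) auto
    then have 2: "2 * (geom_const \<epsilon>\<^sub>2 * 4 * sqrt (taylor_const m) * \<Gamma>\<^sub>2 * sqrt (\<eta>\<^sub>2 s t) * (t - s) powr \<epsilon>\<^sub>2) \<le> ?R2"
      using lt e by (simp add: mult_ac powr_half_sqrt)
    show ?thesis
      by (intro conjI order_trans[OF est(1)] order_trans[OF est(2)] ennreal_leI)
         (unfold distrib_left, intro add_mono 1 2, rule 1)
  qed
  then show "?L \<le> ennreal (?R2 + ?R1)" "?L' \<le> ennreal ?R1" by auto
qed

theorem theorem4p1:
  fixes \<epsilon>\<^sub>1 \<epsilon>\<^sub>2 m :: real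
  assumes "\<epsilon>\<^sub>1 > 0" "\<epsilon>\<^sub>2 > 0" "m \<ge> 2"
  shows "\<exists>C\<ge>0. \<forall>(M :: 'a measure) (F :: real \<Rightarrow> 'a measure) (S :: real) (T :: real) (n :: ennreal)
      (A :: real \<Rightarrow> real \<Rightarrow> 'a \<Rightarrow> real) (\<A> :: real \<Rightarrow> 'a \<Rightarrow> real)
      (\<Gamma>\<^sub>1 :: real) (\<Gamma>\<^sub>2 :: real) (\<alpha>\<^sub>1 :: real) (\<beta>\<^sub>1 :: real) (\<alpha>\<^sub>2 :: real) (\<beta>\<^sub>2 :: real).
    prob_space M \<longrightarrow>
    0 \<le> S \<longrightarrow> S < T \<longrightarrow>
    filtration_upto M T F \<longrightarrow>
    ennreal m \<le> n \<longrightarrow>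
    (\<forall>(s, t)\<in>simplex2 S T.
        A s t \<in> borel_measurable (F t) \<and>
        Ln_norm M (ennreal m) (\<lambda>\<omega>. ennreal \<bar>A s t \<omega>\<bar>) < \<infinity>) \<longrightarrow>
    \<Gamma>\<^sub>1 \<ge> 0 \<longrightarrow> \<Gamma>\<^sub>2 \<ge> 0 \<longrightarrow>
    \<alpha>\<^sub>1 \<in> {0..<1} \<longrightarrow> \<beta>\<^sub>1 \<in> {0..<1} \<longrightarrow>
    \<alpha>\<^sub>2 \<in> {0..<1/2} \<longrightarrow> \<beta>\<^sub>2 \<in> {0..<1/2} \<longrightarrow>
    (\<forall>(s, t)\<in>simplex2 S T. let u = (s + t) / 2 in
        Ln_norm M n (\<lambda>\<omega>. ennreal \<bar>real_cond_exp M (F s) (increment A s u t) \<omega>\<bar>)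
          \<le> ennreal (\<Gamma>\<^sub>1 * (u - S) powr (-\<alpha>\<^sub>1) * (T - u) powr (-\<beta>\<^sub>1) * \<bar>t - s\<bar> powr (1 + \<epsilon>\<^sub>1))) \<longrightarrow>
    (\<forall>(s, t)\<in>simplex2 S T. let u = (s + t) / 2 in
        Ln_norm M n (cond_Lm_norm M (F S) m (increment A s u t))
          \<le> ennreal (\<Gamma>\<^sub>2 * (u - S) powr (-\<alpha>\<^sub>2) * (T - u) powr (-\<beta>\<^sub>2) * \<bar>t - s\<bar> powr (1/2 + \<epsilon>\<^sub>2))) \<longrightarrow>
    (\<forall>t\<in>{S..T}. \<A> t \<in> borel_measurable M) \<longrightarrow>
    (\<forall>t\<in>{S..T}. \<forall>(k :: nat \<Rightarrow> nat) (\<pi> :: nat \<Rightarrow> nat \<Rightarrow> real).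
        (\<forall>N. is_partition S t (k N) (\<pi> N)) \<longrightarrow>
        (\<lambda>N. mesh (k N) (\<pi> N)) \<longlonglongrightarrow> 0 \<longrightarrow>
        tendsto_in_prob M (\<lambda>N \<omega>. \<Sum>i<k N. A (\<pi> N i) (\<pi> N (Suc i)) \<omega>) (\<A> t)) \<longrightarrow>
    (\<forall>(s, t)\<in>simplex2 S T.
        Ln_norm M n (cond_Lm_norm M (F S) m (\<lambda>\<omega>. \<A> t \<omega> - \<A> s \<omega> - A s t \<omega>))
          \<le> ennreal (C * \<Gamma>\<^sub>2 * (eta S T (2 * \<alpha>\<^sub>2) (2 * \<beta>\<^sub>2) s t) powr (1/2) * \<bar>t - s\<bar> powr \<epsilon>\<^sub>2
                   + C * \<Gamma>\<^sub>1 * eta S T \<alpha>\<^sub>1 \<beta>\<^sub>1 s t * \<bar>t - s\<bar> powr \<epsilon>\<^sub>1) \<and>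
        Ln_norm M n (\<lambda>\<omega>. ennreal \<bar>real_cond_exp M (F S) (\<lambda>\<omega>. \<A> t \<omega> - \<A> s \<omega> - A s t \<omega>) \<omega>\<bar>)
          \<le> ennreal (C * \<Gamma>\<^sub>1 * eta S T \<alpha>\<^sub>1 \<beta>\<^sub>1 s t * \<bar>t - s\<bar> powr \<epsilon>\<^sub>1))"
proof -
  define C where "C = 8 * geom_const \<epsilon>\<^sub>2 * sqrt (taylor_const m) + 2 * geom_const \<epsilon>\<^sub>1"
  have pos: "0 \<le> 8 * geom_const \<epsilon>\<^sub>2 * sqrt (taylor_const m)" "0 \<le> 2 * geom_const \<epsilon>\<^sub>1"
    using geom_pos[of \<epsilon>\<^sub>1] geom_pos[of \<epsilon>\<^sub>2] taylor_const_ge_1[of m] assms by auto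
  then have C: "0 \<le> C" "8 * geom_const \<epsilon>\<^sub>2 * sqrt (taylor_const m) \<le> C" "2 * geom_const \<epsilon>\<^sub>1 \<le> C"
    by (auto simp: C_def)
  show ?thesis
  proof (intro exI[of _ C] conjI[OF C(1)] allI impI)
    fix M :: "'a measure" and F :: "real \<Rightarrow> 'a measure" and S T :: real and n :: ennreal
      and A :: "real \<Rightarrow> real \<Rightarrow> 'a \<Rightarrow> real" and \<A> :: "real \<Rightarrow> 'a \<Rightarrow> real"
      and \<Gamma>\<^sub>1 \<Gamma>\<^sub>2 \<alpha>\<^sub>1 \<beta>\<^sub>1 \<alpha>\<^sub>2 \<beta>\<^sub>2 :: real
    assume P: "prob_space M" and S: "0 \<le> S" and ST: "S < T" and filt: "filtration_upto M T F"
      and n: "ennreal m \<le> n"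
      and A: "\<forall>(s, t)\<in>simplex2 S T. A s t \<in> borel_measurable (F t) \<and>
        Ln_norm M (ennreal m) (\<lambda>\<omega>. ennreal \<bar>A s t \<omega>\<bar>) < \<infinity>"
      and G: "\<Gamma>\<^sub>1 \<ge> 0" "\<Gamma>\<^sub>2 \<ge> 0"
      and ex: "\<alpha>\<^sub>1 \<in> {0..<1}" "\<beta>\<^sub>1 \<in> {0..<1}" "\<alpha>\<^sub>2 \<in> {0..<1/2}" "\<beta>\<^sub>2 \<in> {0..<1/2}"
      and h1: "\<forall>(s, t)\<in>simplex2 S T. let u = (s + t) / 2 in
        Ln_norm M n (\<lambda>\<omega>. ennreal \<bar>real_cond_exp M (F s) (increment A s u t) \<omega>\<bar>)
          \<le> ennreal (\<Gamma>\<^sub>1 * (u - S) powr (-\<alpha>\<^sub>1) * (T - u) powr (-\<beta>\<^sub>1) * \<bar>t - s\<bar> powr (1 + \<epsilon>\<^sub>1))"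
      and h2: "\<forall>(s, t)\<in>simplex2 S T. let u = (s + t) / 2 in
        Ln_norm M n (cond_Lm_norm M (F S) m (increment A s u t))
          \<le> ennreal (\<Gamma>\<^sub>2 * (u - S) powr (-\<alpha>\<^sub>2) * (T - u) powr (-\<beta>\<^sub>2) * \<bar>t - s\<bar> powr (1/2 + \<epsilon>\<^sub>2))"
      and meas: "\<forall>t\<in>{S..T}. \<A> t \<in> borel_measurable M"
      and lim: "\<forall>t\<in>{S..T}. \<forall>(k :: nat \<Rightarrow> nat) (\<pi> :: nat \<Rightarrow> nat \<Rightarrow> real).
        (\<forall>N. is_partition S t (k N) (\<pi> N)) \<longrightarrow>
        (\<lambda>N. mesh (k N) (\<pi> N)) \<longlonglongrightarrow> 0 \<longrightarrow>
        tendsto_in_prob M (\<lambda>N \<omega>. \<Sum>i<k N. A (\<pi> N i) (\<pi> N (Suc i)) \<omega>) (\<A> t)"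
    have simplexI: "(s, t) \<in> simplex2 S T" if "S \<le> s" "s \<le> t" "t \<le> T" for s t
      using that by (simp add: simplex2_def)
    have sub: "subalgebra M (F t)" if "S \<le> t" "t \<le> T" for t
      using filt that S by (auto simp: filtration_upto_def)
    interpret stochastic_sewing M F S T m n A \<Gamma>\<^sub>1 \<Gamma>\<^sub>2 \<alpha>\<^sub>1 \<beta>\<^sub>1 \<alpha>\<^sub>2 \<beta>\<^sub>2 \<epsilon>\<^sub>1 \<epsilon>\<^sub>2
    proof (intro stochastic_sewing.intro[OF P] stochastic_sewing_axioms.intro)
      fix s t assume st: "S \<le> s" "s \<le> t" "t \<le> T"
      note h = bspec[OF A simplexI[OF st]] bspec[OF h1 simplexI[OF st]] bspec[OF h2 simplexI[OF st]]
      show AF: "A s t \<in> borel_measurable (F t)" using h(1) by simp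
      show "in_Lm M m (A s t)"
        using h(1) assms(3) st by (intro in_Lm_of_Ln_norm measurable_from_subalg[OF sub AF]) auto
      show "Ln_norm M n (\<lambda>\<omega>. ennreal \<bar>real_cond_exp M (F s) (increment A s ((s + t) / 2) t) \<omega>\<bar>)
        \<le> ennreal (\<Gamma>\<^sub>1 * weight S T \<alpha>\<^sub>1 \<beta>\<^sub>1 ((s + t) / 2) * (t - s) powr (1 + \<epsilon>\<^sub>1))"
        using h(2) st by (simp add: Let_def weight_def mult.assoc)
      show "Ln_norm M n (cond_Lm_norm M (F S) m (increment A s ((s + t) / 2) t))
        \<le> ennreal (\<Gamma>\<^sub>2 * weight S T \<alpha>\<^sub>2 \<beta>\<^sub>2 ((s + t) / 2) * (t - s) powr (1 / 2 + \<epsilon>\<^sub>2))"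
        using h(3) st by (simp add: Let_def weight_def mult.assoc)
    qed (use assms S ST filt n G ex in auto)
    show "\<forall>(s, t)\<in>simplex2 S T.
        Ln_norm M n (cond_Lm_norm M (F S) m (\<lambda>\<omega>. \<A> t \<omega> - \<A> s \<omega> - A s t \<omega>))
          \<le> ennreal (C * \<Gamma>\<^sub>2 * (eta S T (2 * \<alpha>\<^sub>2) (2 * \<beta>\<^sub>2) s t) powr (1/2) * \<bar>t - s\<bar> powr \<epsilon>\<^sub>2
                   + C * \<Gamma>\<^sub>1 * eta S T \<alpha>\<^sub>1 \<beta>\<^sub>1 s t * \<bar>t - s\<bar> powr \<epsilon>\<^sub>1) \<and>
        Ln_norm M n (\<lambda>\<omega>. ennreal \<bar>real_cond_exp M (F S) (\<lambda>\<omega>. \<A> t \<omega> - \<A> s \<omega> - A s t \<omega>) \<omega>\<bar>)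
          \<le> ennreal (C * \<Gamma>\<^sub>1 * eta S T \<alpha>\<^sub>1 \<beta>\<^sub>1 s t * \<bar>t - s\<bar> powr \<epsilon>\<^sub>1)"
    proof (intro ballI, clarify)
      fix s t assume "(s, t) \<in> simplex2 S T"
      then have st: "S \<le> s" "s \<le> t" "t \<le> T" by (auto simp: simplex2_def)
      have lim': "tendsto_in_prob M (\<lambda>N \<omega>. \<Sum>i<k N. A (\<pi> N i) (\<pi> N (Suc i)) \<omega>) (\<A> t)"
        if "S \<le> t" "t \<le> T" "\<And>N. is_partition S t (k N) (\<pi> N)" "(\<lambda>N. mesh (k N) (\<pi> N)) \<longlonglongrightarrow> 0" for t k \<pi>
        using lim that by auto
      have meas': "\<A> t \<in> borel_measurable M" if "S \<le> t" "t \<le> T" for t using meas that by auto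
      show "Ln_norm M n (cond_Lm_norm M (F S) m (\<lambda>\<omega>. \<A> t \<omega> - \<A> s \<omega> - A s t \<omega>))
          \<le> ennreal (C * \<Gamma>\<^sub>2 * (eta S T (2 * \<alpha>\<^sub>2) (2 * \<beta>\<^sub>2) s t) powr (1/2) * \<bar>t - s\<bar> powr \<epsilon>\<^sub>2
                   + C * \<Gamma>\<^sub>1 * eta S T \<alpha>\<^sub>1 \<beta>\<^sub>1 s t * \<bar>t - s\<bar> powr \<epsilon>\<^sub>1) \<and>
        Ln_norm M n (\<lambda>\<omega>. ennreal \<bar>real_cond_exp M (F S) (\<lambda>\<omega>. \<A> t \<omega> - \<A> s \<omega> - A s t \<omega>) \<omega>\<bar>)
          \<le> ennreal (C * \<Gamma>\<^sub>1 * eta S T \<alpha>\<^sub>1 \<beta>\<^sub>1 s t * \<bar>t - s\<bar> powr \<epsilon>\<^sub>1)"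
        by (intro conjI sewing_estimates st meas' lim' C)
    qed
  qed
qed

end
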